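(* Let $q$ be a prime power and $m\ge 1$, and let the $Q$-numbers $Q_k(i)$ of the association scheme of quadratic forms $\mathscr{Q}(m,q)$, the numbers $F^{(M)}_r(s)$, $\alpha_\epsilon$, $\beta_r$ and the sets $\mathscr S_k$ be as in the context. Then $Q_{(0,1)}(i)=1$ for every $i\in I$ with $\mathscr Q_i\neq\emptyset$, and $Q_k(0,1)=\mu_k:=\lvert\mathscr S_k\rvert$ for every $k\in I$. Moreover, for all integers $r,s$ and all $\epsilon,\tau\in\{1,-1\}$, where $r\ge 0$ in an index $2r+1$, $r\ge1$ in an index $(2r,\epsilon)$, $s\ge0$ in an argument $2s+1$ and $s\ge 1$ in an argument $(2s,\tau)$ (and the argument class $\mathscr Q_{2s+1}$, resp. $\mathscr Q_{2s,\tau}$, is nonempty): \begin{align*} Q_{2r+1}(2s+1)&=-q^{2r}F^{(m-1)}_r(s),\\ Q_{2r+1}(2s,\tau)&=-q^{2r}F^{(m-1)}_r(s-1)+\tau\, q^{m-s+2r}F^{(m-2)}_r(s-1),\\ Q_{2r,\epsilon}(2s+1)&=\alpha_\epsilon\, q^{2r}F^{(m-1)}_r(s)+\epsilon\,\beta_r\,F^{(m)}_r(s),\\ Q_{2r,\epsilon}(2s,\tau)&=\alpha_\epsilon\big[q^{2r}F^{(m-1)}_r(s-1)-\tau\, q^{m-s+2r-2}F^{(m-2)}_{r-1}(s-1)\big]+\epsilon\,\beta_r\,F^{(m)}_r(s). \end{align*}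
   Context: Let $q$ be a prime power, $m\ge1$, and $V$ an $m$-dimensional $\mathbb F_q$-vector space. $\mathscr Q(m,q)$ is the set of quadratic forms on $V$ and $\mathscr S(m,q)$ the set of symmetric bilinear forms on $V$. The rank of $S\in\mathscr S(m,q)$ is the codimension of $\{x\in V:S(x,y)=0\ \forall y\in V\}$. For $Q\in\mathscr Q(m,q)$ let $S_Q(x,y)=Q(x+y)-Q(x)-Q(y)$; the radical of $Q$ is $\{x: S_Q(x,y)=0\ \forall y,\ Q(x)=0\}$ and the rank of $Q$ is its codimension. Quadratic forms $Q,Q'$ are equivalent if $Q'(x)=aQ(Lx)$ for some $a\in\mathbb F_q^*$, $L\in GL(V)$; symmetric bilinear forms $S,S'$ are equivalent if $S'(x,y)=aS(Lx,Ly)$ for such $a,L$. Fix $\lambda\in\mathbb F_q$ of absolute trace $1$ (if $q$ even) and a nonsquare $\eta\in\mathbb F_q^*$ (if $q$ odd). A quadratic form of rank $2s\ge2$ has type $1$ (hyperbolic) if it is equivalent to the form given in coordinates of some basis by $\sum_{i=1}^s x_{2i-1}x_{2i}$, and type $-1$ (elliptic) if equivalent to $\sum_{i=1}^{s-1}x_{2i-1}x_{2i}+Q_0$, where $Q_0=x_{2s-1}^2+x_{2s-1}x_{2s}+\lambda x_{2s}^2$ ($q$ even) or $Q_0=x_{2s-1}^2-\eta x_{2s}^2$ ($q$ odd); each such form has exactly one type. A symmetric bilinear form of rank $2s\ge2$ has type $1$ if equivalent to $\sum_{i=1}^s(x_{2i-1}y_{2i}+x_{2i}y_{2i-1})$ and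 type $-1$ if equivalent to $\sum_{i=1}^{s-1}(x_{2i-1}y_{2i}+x_{2i}y_{2i-1})+S_0$, where $S_0=x_{2s-1}y_{2s}+x_{2s}y_{2s-1}+x_{2s}y_{2s}$ ($q$ even) or $S_0=x_{2s-1}y_{2s-1}-\eta x_{2s}y_{2s}$ ($q$ odd); each has exactly one type. Zero forms have rank $0$ and type $1$. Let $I=\{2s+1:s\in\mathbb Z\}\cup\{(2s,\tau):s\in\mathbb Z,\tau=\pm1\}$. For $i=2s+1$, $\mathscr Q_i$ (resp. $\mathscr S_i$) is the set of quadratic (resp. symmetric bilinear) forms of rank $2s+1$; for $i=(2s,\tau)$ it is the set of those of rank $2s$ and type $\tau$ (possibly empty; e.g. $\mathscr Q_{0,-1}=\mathscr S_{0,-1}=\emptyset$). Pairing: fix a nontrivial character $\chi$ of $(\mathbb F_q,+)$ and bases $(u_1,\dots,u_m)$, $(w_1,\dots,w_m)$ of $V$. For $Q$ pick $A\in\mathbb F_q^{m\times m}$ with $Q(\sum_i x_iu_i)=\sum_{i,j}A_{ij}x_ix_j$ (unique modulo alternating matrices); for $S$ let $B_{ij}=S(w_i,w_j)$; set $\langle Q,S\rangle=\chi(\operatorname{tr}(AB))$ (well defined). For $k,i\in I$ with $\mathscr Q_i\ne\emptyset$, $Q_k(i)=\sum_{S\in\mathscr S_k}\langle Q,S\rangle$ for any $Q\in\mathscr Q_i$ (independent of the choice; $0$ if $\mathscr S_k=\emptyset$). Numbers: ${a\brack b}=\prod_{i=0}^{b-1}\frac{q^{2a}-q^{2i}}{q^{2b}-q^{2i}}$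 for integers $a$ and $b\ge0$. For an integer $M\ge0$ let $n=\lfloor M/2\rfloor$ and (if $n\ge1$) $c=q^{M(M-1)/(2n)}$; for integers $0\le r,s\le n$ put $F^{(M)}_r(s)=\sum_{j=0}^r(-1)^{r-j}q^{(r-j)(r-j-1)}{n-j\brack n-r}{n-s\brack j}c^j$ (so $F^{(M)}_0(0)=1$ when $n=0$), and $F^{(M)}_r(s)=0$ for all other integers $r,s$ and for $M<0$. Finally $\alpha_\epsilon=\frac12(1-\epsilon)$, $\beta_r=1$ if $q$ is even, and $\alpha_\epsilon=\frac12$, $\beta_r=\frac12q^r$ if $q$ is odd. *)

theory Defs
  imports Complex_Main "HOL-Library.Cardinality"
begin

text \<open>
  Throughout, the type \<open>'a\<close> of class \<open>{finite, field}\<close> is the field with \<open>q = CARD('a)\<close> elements,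
  and the vector space \<open>V\<close> is the whole type \<open>'v\<close> with scalar multiplication \<open>scale\<close>.  Bases are
  families \<open>nat \<Rightarrow> 'v\<close> of which only the members with index in \<open>{1..m}\<close>, \<open>m = dim V\<close>, matter;
  likewise for coordinate vectors \<open>nat \<Rightarrow> 'a\<close> and matrices \<open>nat \<Rightarrow> nat \<Rightarrow> 'a\<close>.
\<close>

definition vdim :: "('a::field \<Rightarrow> 'v::ab_group_add \<Rightarrow> 'v) \<Rightarrow> nat" where
  "vdim scale = vector_space.dim scale UNIV"

definition codimension :: "('a::field \<Rightarrow> 'v::ab_group_add \<Rightarrow> 'v) \<Rightarrow> 'v set \<Rightarrow> nat" where
  "codimension scale W = vdim scale - vector_space.dim scale W"

definition is_basis :: "('a::field \<Rightarrow> 'v::ab_group_add \<Rightarrow> 'v) \<Rightarrow> (nat \<Rightarrow> 'v) \<Rightarrow> bool" where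
  "is_basis scale b \<longleftrightarrow>
     inj_on b {1..vdim scale} \<and>
     \<not> module.dependent scale (b ` {1..vdim scale}) \<and>
     module.span scale (b ` {1..vdim scale}) = UNIV"

definition lincomb :: "('a::field \<Rightarrow> 'v::ab_group_add \<Rightarrow> 'v) \<Rightarrow> (nat \<Rightarrow> 'v) \<Rightarrow> (nat \<Rightarrow> 'a) \<Rightarrow> 'v" where
  "lincomb scale b x = (\<Sum>i = 1..vdim scale. scale (x i) (b i))"

definition general_linear :: "('a::field \<Rightarrow> 'v::ab_group_add \<Rightarrow> 'v) \<Rightarrow> ('v \<Rightarrow> 'v) set" where
  "general_linear scale = {L. Vector_Spaces.linear scale scale L \<and> bij L}"


section \<open>Quadratic and symmetric bilinear forms\<close>

definition bilinear_form :: "('a::field \<Rightarrow> 'v::ab_group_add \<Rightarrow> 'v) \<Rightarrow> ('v \<Rightarrow> 'v \<Rightarrow> 'a) \<Rightarrow> bool" where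
  "bilinear_form scale S \<longleftrightarrow>
     (\<forall>y. Vector_Spaces.linear scale (*) (\<lambda>x. S x y)) \<and>
     (\<forall>x. Vector_Spaces.linear scale (*) (\<lambda>y. S x y))"

definition sym_forms :: "('a::field \<Rightarrow> 'v::ab_group_add \<Rightarrow> 'v) \<Rightarrow> ('v \<Rightarrow> 'v \<Rightarrow> 'a) set" where
  "sym_forms scale = {S. bilinear_form scale S \<and> (\<forall>x y. S x y = S y x)}"

definition polar_form :: "('v::ab_group_add \<Rightarrow> 'a::field) \<Rightarrow> 'v \<Rightarrow> 'v \<Rightarrow> 'a" where
  "polar_form Q x y = Q (x + y) - Q x - Q y"

definition quad_forms :: "('a::field \<Rightarrow> 'v::ab_group_add \<Rightarrow> 'v) \<Rightarrow> ('v \<Rightarrow> 'a) set" where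
  "quad_forms scale =
     {Q. (\<forall>a x. Q (scale a x) = a\<^sup>2 * Q x) \<and> bilinear_form scale (polar_form Q)}"

definition sym_rank :: "('a::field \<Rightarrow> 'v::ab_group_add \<Rightarrow> 'v) \<Rightarrow> ('v \<Rightarrow> 'v \<Rightarrow> 'a) \<Rightarrow> nat" where
  "sym_rank scale S = codimension scale {x. \<forall>y. S x y = 0}"

definition quad_rank :: "('a::field \<Rightarrow> 'v::ab_group_add \<Rightarrow> 'v) \<Rightarrow> ('v \<Rightarrow> 'a) \<Rightarrow> nat" where
  "quad_rank scale Q = codimension scale {x. (\<forall>y. polar_form Q x y = 0) \<and> Q x = 0}"

definition quad_equiv ::
  "('a::field \<Rightarrow> 'v::ab_group_add \<Rightarrow> 'v) \<Rightarrow> ('v \<Rightarrow> 'a) \<Rightarrow> ('v \<Rightarrow> 'a) \<Rightarrow> bool" where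
  "quad_equiv scale Q Q' \<longleftrightarrow>
     (\<exists>a L. a \<noteq> 0 \<and> L \<in> general_linear scale \<and> (\<forall>x. Q' x = a * Q (L x)))"

definition sym_equiv ::
  "('a::field \<Rightarrow> 'v::ab_group_add \<Rightarrow> 'v) \<Rightarrow> ('v \<Rightarrow> 'v \<Rightarrow> 'a) \<Rightarrow> ('v \<Rightarrow> 'v \<Rightarrow> 'a) \<Rightarrow> bool" where
  "sym_equiv scale S S' \<longleftrightarrow>
     (\<exists>a L. a \<noteq> 0 \<and> L \<in> general_linear scale \<and> (\<forall>x y. S' x y = a * S (L x) (L y)))"


section \<open>Types\<close>

text \<open>The normal forms, as functions of the coordinate vectors \<open>x\<close> and \<open>y\<close>.\<close>

definition quad_hyp :: "nat \<Rightarrow> (nat \<Rightarrow> 'a::field) \<Rightarrow> 'a" where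
  "quad_hyp s x = (\<Sum>i = 1..s. x (2*i - 1) * x (2*i))"

definition quad_ell :: "'a::{finite,field} \<Rightarrow> 'a \<Rightarrow> nat \<Rightarrow> (nat \<Rightarrow> 'a) \<Rightarrow> 'a" where
  "quad_ell lam eta s x = quad_hyp (s - 1) x +
     (if even CARD('a)
      then (x (2*s - 1))\<^sup>2 + x (2*s - 1) * x (2*s) + lam * (x (2*s))\<^sup>2
      else (x (2*s - 1))\<^sup>2 - eta * (x (2*s))\<^sup>2)"

definition sym_hyp :: "nat \<Rightarrow> (nat \<Rightarrow> 'a::field) \<Rightarrow> (nat \<Rightarrow> 'a) \<Rightarrow> 'a" where
  "sym_hyp s x y = (\<Sum>i = 1..s. x (2*i - 1) * y (2*i) + x (2*i) * y (2*i - 1))"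

definition sym_ell :: "'a::{finite,field} \<Rightarrow> nat \<Rightarrow> (nat \<Rightarrow> 'a) \<Rightarrow> (nat \<Rightarrow> 'a) \<Rightarrow> 'a" where
  "sym_ell eta s x y = sym_hyp (s - 1) x y +
     (if even CARD('a)
      then x (2*s - 1) * y (2*s) + x (2*s) * y (2*s - 1) + x (2*s) * y (2*s)
      else x (2*s - 1) * y (2*s - 1) - eta * x (2*s) * y (2*s))"

definition quad_equiv_coord ::
  "('a::field \<Rightarrow> 'v::ab_group_add \<Rightarrow> 'v) \<Rightarrow> ((nat \<Rightarrow> 'a) \<Rightarrow> 'a) \<Rightarrow> ('v \<Rightarrow> 'a) \<Rightarrow> bool" where
  "quad_equiv_coord scale f Q \<longleftrightarrow>
     (\<exists>Q' b. is_basis scale b \<and> (\<forall>x. Q' (lincomb scale b x) = f x) \<and> quad_equiv scale Q Q')"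

definition sym_equiv_coord ::
  "('a::field \<Rightarrow> 'v::ab_group_add \<Rightarrow> 'v) \<Rightarrow> ((nat \<Rightarrow> 'a) \<Rightarrow> (nat \<Rightarrow> 'a) \<Rightarrow> 'a) \<Rightarrow>
    ('v \<Rightarrow> 'v \<Rightarrow> 'a) \<Rightarrow> bool" where
  "sym_equiv_coord scale f S \<longleftrightarrow>
     (\<exists>S' b. is_basis scale b \<and>
        (\<forall>x y. S' (lincomb scale b x) (lincomb scale b y) = f x y) \<and> sym_equiv scale S S')"

text \<open>The type of a form of even rank; the form of rank \<open>0\<close> has type \<open>1\<close> only.\<close>

definition quad_has_type ::
  "('a::{finite,field} \<Rightarrow> 'v::ab_group_add \<Rightarrow> 'v) \<Rightarrow> 'a \<Rightarrow> 'a \<Rightarrow> ('v \<Rightarrow> 'a) \<Rightarrow> int \<Rightarrow> bool" where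
  "quad_has_type scale lam eta Q \<tau> \<longleftrightarrow>
     (quad_rank scale Q = 0 \<and> \<tau> = 1) \<or>
     (\<exists>s\<ge>1. quad_rank scale Q = 2 * s \<and>
        ((\<tau> = 1 \<and> quad_equiv_coord scale (quad_hyp s) Q) \<or>
         (\<tau> = -1 \<and> quad_equiv_coord scale (quad_ell lam eta s) Q)))"

definition sym_has_type ::
  "('a::{finite,field} \<Rightarrow> 'v::ab_group_add \<Rightarrow> 'v) \<Rightarrow> 'a \<Rightarrow> ('v \<Rightarrow> 'v \<Rightarrow> 'a) \<Rightarrow> int \<Rightarrow> bool" where
  "sym_has_type scale eta S \<tau> \<longleftrightarrow>
     (sym_rank scale S = 0 \<and> \<tau> = 1) \<or>
     (\<exists>s\<ge>1. sym_rank scale S = 2 * s \<and>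
        ((\<tau> = 1 \<and> sym_equiv_coord scale (sym_hyp s) S) \<or>
         (\<tau> = -1 \<and> sym_equiv_coord scale (sym_ell eta s) S)))"


section \<open>The classes\<close>

text \<open>\<open>Odd s\<close> stands for the index \<open>2s + 1\<close> and \<open>Even s \<tau>\<close> for the index \<open>(2s, \<tau>)\<close>.\<close>

datatype form_index = Odd int | Even int int

definition index_set :: "form_index set" where
  "index_set = {Odd s |s. True} \<union> {Even s \<tau> |s \<tau>. \<tau> \<in> {1, -1}}"

fun quad_class ::
  "('a::{finite,field} \<Rightarrow> 'v::ab_group_add \<Rightarrow> 'v) \<Rightarrow> 'a \<Rightarrow> 'a \<Rightarrow> form_index \<Rightarrow> ('v \<Rightarrow> 'a) set" where
  "quad_class scale lam eta (Odd s) =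
     {Q \<in> quad_forms scale. int (quad_rank scale Q) = 2 * s + 1}"
| "quad_class scale lam eta (Even s \<tau>) =
     {Q \<in> quad_forms scale. int (quad_rank scale Q) = 2 * s \<and> quad_has_type scale lam eta Q \<tau>}"

fun sym_class ::
  "('a::{finite,field} \<Rightarrow> 'v::ab_group_add \<Rightarrow> 'v) \<Rightarrow> 'a \<Rightarrow> form_index \<Rightarrow> ('v \<Rightarrow> 'v \<Rightarrow> 'a) set" where
  "sym_class scale eta (Odd s) =
     {S \<in> sym_forms scale. int (sym_rank scale S) = 2 * s + 1}"
| "sym_class scale eta (Even s \<tau>) =
     {S \<in> sym_forms scale. int (sym_rank scale S) = 2 * s \<and> sym_has_type scale eta S \<tau>}"


section \<open>The pairing and the \<open>Q\<close>-numbers\<close>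

text \<open>The trace from \<open>'a\<close> to its prime field, here as an element of \<open>'a\<close>.\<close>

definition abs_trace :: "'a::{finite,field} \<Rightarrow> 'a" where
  "abs_trace x = (\<Sum>i < (THE e. CARD('a) = CHAR('a) ^ e). x ^ (CHAR('a) ^ i))"

definition additive_character :: "('a::{finite,field} \<Rightarrow> complex) \<Rightarrow> bool" where
  "additive_character \<chi> \<longleftrightarrow> \<chi> 0 = 1 \<and> (\<forall>x y. \<chi> (x + y) = \<chi> x * \<chi> y)"

definition matrix_of_quad ::
  "('a::field \<Rightarrow> 'v::ab_group_add \<Rightarrow> 'v) \<Rightarrow> (nat \<Rightarrow> 'v) \<Rightarrow> ('v \<Rightarrow> 'a) \<Rightarrow> (nat \<Rightarrow> nat \<Rightarrow> 'a) \<Rightarrow> bool" where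
  "matrix_of_quad scale u Q A \<longleftrightarrow>
     (\<forall>x. Q (lincomb scale u x) =
        (\<Sum>i = 1..vdim scale. \<Sum>j = 1..vdim scale. A i j * x i * x j))"

text \<open>
  The matrix of a quadratic form is only unique modulo alternating matrices, hence the choice of
  \<open>A\<close>; the double sum is the trace of the matrix product of \<open>A\<close> and \<open>B\<close>, where \<open>B i j = S (w i) (w j)\<close>.
\<close>

definition pairing ::
  "('a::{finite,field} \<Rightarrow> 'v::ab_group_add \<Rightarrow> 'v) \<Rightarrow> ('a \<Rightarrow> complex) \<Rightarrow> (nat \<Rightarrow> 'v) \<Rightarrow> (nat \<Rightarrow> 'v) \<Rightarrow>
    ('v \<Rightarrow> 'a) \<Rightarrow> ('v \<Rightarrow> 'v \<Rightarrow> 'a) \<Rightarrow> complex" where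
  "pairing scale \<chi> u w Q S =
     (let A = (SOME A. matrix_of_quad scale u Q A)
      in \<chi> (\<Sum>i = 1..vdim scale. \<Sum>j = 1..vdim scale. A i j * S (w j) (w i)))"

text \<open>
  The definite description makes \<open>Q_number \<dots> k i\<close> the value of the character sum that is
  common to all \<open>Q\<close> in the (nonempty) class \<open>i\<close>.
\<close>

definition Q_number ::
  "('a::{finite,field} \<Rightarrow> 'v::ab_group_add \<Rightarrow> 'v) \<Rightarrow> 'a \<Rightarrow> 'a \<Rightarrow> ('a \<Rightarrow> complex) \<Rightarrow>
    (nat \<Rightarrow> 'v) \<Rightarrow> (nat \<Rightarrow> 'v) \<Rightarrow> form_index \<Rightarrow> form_index \<Rightarrow> complex" where
  "Q_number scale lam eta \<chi> u w k i =
     (THE c. \<forall>Q \<in> quad_class scale lam eta i.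
        c = (\<Sum>S \<in> sym_class scale eta k. pairing scale \<chi> u w Q S))"


section \<open>The numbers in the explicit formulas\<close>

definition gauss_binomial_sq :: "nat \<Rightarrow> int \<Rightarrow> nat \<Rightarrow> real" where
  "gauss_binomial_sq q a b =
     (\<Prod>i < b. (real q powi (2 * a) - real q ^ (2 * i)) / (real q ^ (2 * b) - real q ^ (2 * i)))"

text \<open>
  The division in the exponent of \<open>c\<close> is exact for \<open>n \<ge> 1\<close>; for \<open>n = 0\<close> only \<open>c powi 0\<close> occurs.
\<close>

definition F_number :: "nat \<Rightarrow> int \<Rightarrow> int \<Rightarrow> int \<Rightarrow> real" where
  "F_number q M r s =
     (let n = M div 2; c = real q powi (M * (M - 1) div (2 * n))
      in if 0 \<le> M \<and> 0 \<le> r \<and> r \<le> n \<and> 0 \<le> s \<and> s \<le> n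
         then \<Sum>j = 0..r. (-1) powi (r - j) * real q powi ((r - j) * (r - j - 1)) *
                gauss_binomial_sq q (n - j) (nat (n - r)) *
                gauss_binomial_sq q (n - s) (nat j) * c powi j
         else 0)"

definition alpha_coeff :: "nat \<Rightarrow> int \<Rightarrow> real" where
  "alpha_coeff q \<epsilon> = (if even q then (1 - of_int \<epsilon>) / 2 else 1 / 2)"

definition beta_coeff :: "nat \<Rightarrow> int \<Rightarrow> real" where
  "beta_coeff q r = (if even q then 1 else real q powi r / 2)"

end

theory Submission
  imports Defs "HOL-Number_Theory.Residues"
begin

text \<open>
  In coordinates the \<open>Q\<close>-numbers are sums of \<open>\<chi> (tr (A B))\<close> over the symmetric matrices \<open>B\<close> of a
  given rank (and type).  Bordering a symmetric matrix by a row and column \<open>b\<close> with corner \<open>\<beta>\<close>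
  raises the rank by 2 if \<open>b\<close> lies outside the column space, and otherwise by 0 for exactly one
  \<open>\<beta>\<close> and by 1 for all others.  Carrying out the character sums over \<open>b\<close> and \<open>\<beta>\<close> shows how the rank
  sum at \<open>A\<close> changes when \<open>A\<close> is extended by a radical vector or by a hyperbolic plane; the
  right-hand sides of the theorem satisfy the same recursions, and they agree for the anisotropic kernels of
  dimension 1 and 2 and the hyperbolic plane.

  The type is detected by the average \<open>\<Omega>(S)\<close> of \<open>\<chi> (S x x)\<close> over \<open>x\<close>: on forms of rank
  \<open>2r\<close> and type \<open>\<epsilon>\<close> it equals \<open>\<epsilon> q\<^sup>-\<^sup>r\<close> if \<open>q\<close> is odd, and it is the indicator of \<open>\<epsilon> = 1\<close>
  if \<open>q\<close> is even.  Hence the indicator of type \<open>\<epsilon>\<close> is \<open>\<alpha>\<^sub>\<epsilon> + \<epsilon> \<beta>\<^sub>r \<Omega>\<close>, and the sums weighted by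
  \<open>\<Omega>\<close> obey a simpler recursion, which is that of \<open>F\<^bsup>(m)\<^esup>\<^sub>r(s)\<close>.
\<close>

section \<open>The numbers \<open>F\<close>\<close>

text \<open>Rank is easy to follow through a bordering, type is not. The average \<Omega> repairs
  this: summed over all corners \<beta> it returns its old value, and when \<open>b\<close> lies in
  the column space the one corner that keeps the rank already accounts for that value, so the
  corners that raise the rank by 1 contribute 0 in total. Hence the weighted sums link rank k with k
  - 2 only, while the plain sums also involve k - 1. Replacing types by \<Omega> requires that every
  symmetric form of even rank has a type, which is why a classification in all characteristics is
  carried out. For quadratic forms only odd rank is classified; in even rank the type itself
  supplies the normal form. Linear algebra is done by counting: kernels, column spaces and subspaces
  enter through their cardinalities, which character sums deliver directly. The numbers F are
  generalised Krawtchouk polynomials in base q^2, the eigenvalues of the scheme of alternating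
  forms.\<close>

fun gauss_binomial :: "real \<Rightarrow> nat \<Rightarrow> nat \<Rightarrow> real" where
  "gauss_binomial b n 0 = 1"
| "gauss_binomial b 0 (Suc k) = 0"
| "gauss_binomial b (Suc n) (Suc k) =
     b ^ Suc k * gauss_binomial b n (Suc k) + gauss_binomial b n k"

lemma gauss_binomial_eq_0: "n < k \<Longrightarrow> gauss_binomial b n k = 0"
  by (induction b n k rule: gauss_binomial.induct) auto

text \<open>The ratio of neighbouring coefficients, cleared of denominators. Both product formulas
  and \<open>krawtchouk_scale\<close> rest on it.\<close>

lemma gauss_binomial_step:
  "k \<le> n \<Longrightarrow>
   (b ^ Suc k - 1) * gauss_binomial b n (Suc k) = (b ^ (n - k) - 1) * gauss_binomial b n k"
proof (induction n arbitrary: k)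
  case 0
  then show ?case by simp
next
  case (Suc n)
  show ?case
  proof (cases k)
    case 0
    have "(b - 1) * gauss_binomial b n (Suc 0) = b ^ n - 1"
      using Suc.IH[of 0] by simp
    then show ?thesis
      using 0 by (simp add: algebra_simps)
  next
    case (Suc j)
    show ?thesis
    proof (cases "k = Suc n")
      case True
      then show ?thesis
        using gauss_binomial_eq_0[of n "Suc n"] gauss_binomial_eq_0[of n "Suc (Suc n)"] by simp
    next
      case False
      with Suc Suc.prems have le: "Suc j \<le> n" by simp
      let ?g = "gauss_binomial b n"
      have e: "b ^ (n - j) * b ^ Suc j = b ^ Suc n"
              "b ^ Suc (Suc j) * b ^ (n - Suc j) = b ^ Suc n"
        using le by (simp_all only: power_add [symmetric], simp_all)
      have 1: "(b ^ Suc (Suc j) - 1) * ?g (Suc (Suc j)) = (b ^ (n - Suc j) - 1) * ?g (Suc j)"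
        using Suc.IH[OF le] .
      have 2: "(b ^ Suc j - 1) * ?g (Suc j) = (b ^ (n - j) - 1) * ?g j"
        using Suc.IH[of j] le by simp
      have "(b ^ Suc (Suc j) - 1) * (b ^ Suc (Suc j) * ?g (Suc (Suc j)) + ?g (Suc j))
          = b ^ Suc (Suc j) * ((b ^ Suc (Suc j) - 1) * ?g (Suc (Suc j)))
            + (b ^ Suc (Suc j) - 1) * ?g (Suc j)"
        by (simp only: algebra_simps)
      also have "\<dots> = (b ^ Suc (Suc j) * b ^ (n - Suc j) - 1) * ?g (Suc j)"
        unfolding 1 by (simp only: algebra_simps)
      also have "\<dots> = (b ^ (n - j) * b ^ Suc j - 1) * ?g (Suc j)"
        by (simp only: e)
      also have "\<dots> = (b ^ (n - j) - 1) * b ^ Suc j * ?g (Suc j) + (b ^ Suc j - 1) * ?g (Suc j)"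
        by (simp only: algebra_simps)
      also have "\<dots> = (b ^ (n - j) - 1) * (b ^ Suc j * ?g (Suc j) + ?g j)"
        unfolding 2 by (simp only: algebra_simps)
      finally show ?thesis
        using Suc by simp
    qed
  qed
qed

text \<open>Denominators are cleared so that the induction on \<open>k\<close> uses only
  \<open>gauss_binomial_step\<close>. This identifies the recursive coefficients with
  \<open>gauss_binomial_sq\<close>.\<close>

lemma gauss_binomial_prod:
  "gauss_binomial b n k * (\<Prod>i<k. b ^ k - b ^ i) = (\<Prod>i<k. b ^ n - b ^ i)"
proof (induction k)
  case 0
  then show ?case by simp
next
  case (Suc k)
  have P: "(\<Prod>i<Suc k. b ^ Suc k - b ^ i) = (b ^ Suc k - 1) * (b ^ k * (\<Prod>i<k. b ^ k - b ^ i))"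
  proof -
    have "(\<Prod>i<k. b ^ Suc k - b ^ Suc i) = (\<Prod>i<k. b * (b ^ k - b ^ i))"
      by (simp add: algebra_simps)
    also have "\<dots> = b ^ k * (\<Prod>i<k. b ^ k - b ^ i)"
      by (simp only: prod.distrib) simp
    finally show ?thesis
      by (subst prod.lessThan_Suc_shift) simp
  qed
  show ?case
  proof (cases "k \<le> n")
    case True
    have "gauss_binomial b n (Suc k) * (\<Prod>i<Suc k. b ^ Suc k - b ^ i)
        = ((b ^ Suc k - 1) * gauss_binomial b n (Suc k)) * b ^ k * (\<Prod>i<k. b ^ k - b ^ i)"
      unfolding P by (simp only: ac_simps)
    also have "\<dots> = (b ^ k * b ^ (n - k) - b ^ k)
                      * (gauss_binomial b n k * (\<Prod>i<k. b ^ k - b ^ i))"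
      unfolding gauss_binomial_step[OF True] by (simp only: algebra_simps)
    also have "b ^ k * b ^ (n - k) = b ^ n"
      using True by (simp flip: power_add)
    finally show ?thesis
      using Suc by (simp add: mult.commute)
  next
    case False
    \<comment> \<open>The factor with index \<open>n\<close> is zero, as is the coefficient on the
      left.\<close>
    then have "(\<Prod>i<Suc k. b ^ n - b ^ i) = 0"
      by (auto intro!: bexI[of _ n])
    then show ?thesis
      using False gauss_binomial_eq_0[of n "Suc k" b] by simp
  qed
qed

text \<open>The products of \<open>b ^ Suc i - 1\<close> act as factorials, up to powers of
  \<open>b - 1\<close>; the formula is symmetric in \<open>k\<close> and
  \<open>n - k\<close>.\<close>

lemma gauss_binomial_fact:
  "k \<le> n \<Longrightarrow> gauss_binomial b n k * (\<Prod>i<k. b ^ Suc i - 1) * (\<Prod>i<n - k. b ^ Suc i - 1)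
     = (\<Prod>i<n. b ^ Suc i - 1)"
proof (induction k)
  case 0
  then show ?case by simp
next
  case (Suc k)
  have e: "n - k = Suc (n - Suc k)" using Suc.prems by simp
  have "gauss_binomial b n (Suc k) * (\<Prod>i<Suc k. b ^ Suc i - 1) * (\<Prod>i<n - Suc k. b ^ Suc i - 1)
      = ((b ^ Suc k - 1) * gauss_binomial b n (Suc k)) * (\<Prod>i<k. b ^ Suc i - 1)
          * (\<Prod>i<n - Suc k. b ^ Suc i - 1)"
    by (simp only: prod.lessThan_Suc ac_simps)
  also have "(b ^ Suc k - 1) * gauss_binomial b n (Suc k)
      = (b ^ (n - k) - 1) * gauss_binomial b n k"
    using gauss_binomial_step[of k n b] Suc.prems by simp
  also have "(b ^ (n - k) - 1) * gauss_binomial b n k * (\<Prod>i<k. b ^ Suc i - 1)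
               * (\<Prod>i<n - Suc k. b ^ Suc i - 1)
      = gauss_binomial b n k * (\<Prod>i<k. b ^ Suc i - 1) * (\<Prod>i<n - k. b ^ Suc i - 1)"
    unfolding e by (simp only: prod.lessThan_Suc ac_simps)
  also have "\<dots> = (\<Prod>i<n. b ^ Suc i - 1)"
    using Suc.IH Suc.prems by (simp only: Suc_leD)
  finally show ?case .
qed

lemma gauss_binomial_symmetric:
  assumes "b > 1" "k \<le> n"
  shows "gauss_binomial b n (n - k) = gauss_binomial b n k"
proof -
  have nz: "(\<Prod>i<j. b ^ Suc i - 1) \<noteq> 0" for j
    using assms one_less_power[of b "Suc i" for i] by (auto simp: less_le)
  have "gauss_binomial b n (n - k) * (\<Prod>i<n - k. b ^ Suc i - 1) * (\<Prod>i<k. b ^ Suc i - 1)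
      = gauss_binomial b n k * (\<Prod>i<k. b ^ Suc i - 1) * (\<Prod>i<n - k. b ^ Suc i - 1)"
    using gauss_binomial_fact[of k n b] gauss_binomial_fact[of "n - k" n b] assms(2) by simp
  then show ?thesis using nz[of k] nz[of "n - k"] by simp
qed

lemma gauss_binomial_sq_eq:
  assumes "q \<ge> 2"
  shows "gauss_binomial_sq q (int n) k = gauss_binomial ((real q)\<^sup>2) n k"
proof -
  let ?b = "(real q)\<^sup>2"
  have "?b > 1"
    using assms by (intro one_less_power) auto
  then have nz: "(\<Prod>i<k. ?b ^ k - ?b ^ i) \<noteq> 0"
    using power_strict_increasing[of _ k ?b] by fastforce
  have "real q powi (2 * int n) = ?b ^ n"
    by (simp only: power_int_mult power_int_of_nat power_int_numeral)
  then have "gauss_binomial_sq q (int n) k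
      = (\<Prod>i<k. ?b ^ n - ?b ^ i) / (\<Prod>i<k. ?b ^ k - ?b ^ i)"
    by (simp add: gauss_binomial_sq_def prod_dividef power_mult)
  also have "\<dots> = gauss_binomial ?b n k"
    unfolding gauss_binomial_prod[of ?b n k, symmetric] using nz
    by (rule nonzero_mult_div_cancel_right)
  finally show ?thesis .
qed

text \<open>The sum F in base \<open>b\<close> with free parameters \<open>n\<close> and
  \<open>c\<close>. The product of the \<open>b ^ i\<close> is \<open>b\<close> to the power (r -
  j)(r - j - 1)/2. By symmetry the lower index \<open>r - j\<close> replaces n - r, so that the sum
  vanishes by itself for r > n.\<close>

definition krawtchouk :: "real \<Rightarrow> nat \<Rightarrow> real \<Rightarrow> nat \<Rightarrow> nat \<Rightarrow> real" where
  "krawtchouk b n c r s =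
     (\<Sum>j\<le>r. (-1) ^ (r - j) * (\<Prod>i<r - j. b ^ i) * gauss_binomial b (n - j) (r - j)
              * (gauss_binomial b (n - s) j * c ^ j))"

lemma krawtchouk_0 [simp]: "krawtchouk b n c 0 s = 1"
  by (simp add: krawtchouk_def)

lemma krawtchouk_eq_0: "n < r \<Longrightarrow> s \<le> n \<Longrightarrow> krawtchouk b n c r s = 0"
  unfolding krawtchouk_def
proof (rule sum.neutral, rule ballI)
  fix j assume "n < r" "s \<le> n" "j \<in> {..r}"
  show "(-1) ^ (r - j) * (\<Prod>i<r - j. b ^ i) * gauss_binomial b (n - j) (r - j)
              * (gauss_binomial b (n - s) j * c ^ j) = 0"
    using \<open>n < r\<close> by (cases "j \<le> n") (auto simp: gauss_binomial_eq_0)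
qed

text \<open>Pascal's rule for \<open>gauss_binomial b (Suc n - j) (Suc r - j)\<close>, term by term;
  the factor \<open>b ^ j\<close> that comes from scaling \<open>c\<close> completes the powers to
  \<open>b ^ Suc r\<close> and \<open>b ^ r\<close>.\<close>

lemma krawtchouk_Suc_Suc:
  "krawtchouk b (Suc n) (c * b) (Suc r) (Suc s)
     = b ^ Suc r * krawtchouk b n c (Suc r) s - b ^ r * krawtchouk b n c r s"
proof -
  let ?X = "\<lambda>j. gauss_binomial b (n - s) j * c ^ j"
  let ?g = "gauss_binomial b"
  have t: "(-1) ^ (Suc r - j) * (\<Prod>i<Suc r - j. b ^ i) * ?g (Suc n - j) (Suc r - j)
             * (?g (Suc n - Suc s) j * (c * b) ^ j)
      = b ^ Suc r * ((-1) ^ (Suc r - j) * (\<Prod>i<Suc r - j. b ^ i) * ?g (n - j) (Suc r - j) * ?X j)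
        - b ^ r * ((-1) ^ (r - j) * (\<Prod>i<r - j. b ^ i) * ?g (n - j) (r - j) * ?X j)"
    if j: "j \<le> r" for j
  proof (cases "j \<le> n")
    case False
    then show ?thesis by (simp add: gauss_binomial_eq_0)
  next
    case True
    obtain k where k: "r = j + k" using j le_iff_add by blast
    have e: "Suc r - j = Suc k" "r - j = k" "Suc n - j = Suc (n - j)"
      using True k by auto
    show ?thesis
      unfolding e
      by (simp add: power_mult_distrib power_add k algebra_simps)
  qed
  show ?thesis
    unfolding krawtchouk_def sum.atMost_Suc
    by (subst sum.cong[OF refl t])
       (simp_all add: sum_subtractf right_diff_distrib distrib_left power_mult_distrib
          flip: sum_distrib_left)
qed

text \<open>Write \<open>b ^ j\<close> as \<open>b ^ Suc r - b ^ j * (b ^ (Suc r - j) - 1)\<close>;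
  by \<open>gauss_binomial_step\<close> the second part lowers r by 1. This serves the step from
  even M to M + 1, where n stays and c grows.\<close>

lemma krawtchouk_scale:
  "krawtchouk b n (c * b) (Suc r) s
     = b ^ Suc r * krawtchouk b n c (Suc r) s + (b ^ n - b ^ r) * krawtchouk b n c r s"
proof -
  let ?X = "\<lambda>j. gauss_binomial b (n - s) j * c ^ j"
  let ?g = "gauss_binomial b"
  have t: "(-1) ^ (Suc r - j) * (\<Prod>i<Suc r - j. b ^ i) * ?g (n - j) (Suc r - j)
             * (?g (n - s) j * (c * b) ^ j)
      = b ^ Suc r * ((-1) ^ (Suc r - j) * (\<Prod>i<Suc r - j. b ^ i) * ?g (n - j) (Suc r - j) * ?X j)
        + (b ^ n - b ^ r) * ((-1) ^ (r - j) * (\<Prod>i<r - j. b ^ i) * ?g (n - j) (r - j) * ?X j)"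
    if j: "j \<le> r" for j
  proof (cases "j \<le> n")
    case False
    then show ?thesis by (simp add: gauss_binomial_eq_0)
  next
    case True
    obtain k where k: "r = j + k" using j le_iff_add by blast
    have e: "Suc r - j = Suc k" "r - j = k" using k by auto
    have *: "b ^ r * ((b ^ Suc k - 1) * ?g (n - j) (Suc k)) = (b ^ n - b ^ r) * ?g (n - j) k"
    proof (cases "k \<le> n - j")
      case True2: True
      have "b ^ r * b ^ (n - j - k) = b ^ n"
        using True True2 k by (simp flip: power_add)
      then show ?thesis
        unfolding gauss_binomial_step[OF True2] by (simp add: algebra_simps)
    next
      case False
      then show ?thesis by (simp add: gauss_binomial_eq_0)
    qed
    have "(b ^ n - b ^ r) * ((-1) ^ k * (\<Prod>i<k. b ^ i) * ?g (n - j) k * ?X j)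
        = (-1) ^ k * (\<Prod>i<k. b ^ i) * ?X j * (b ^ r * ((b ^ Suc k - 1) * ?g (n - j) (Suc k)))"
      unfolding * by simp
    then show ?thesis
      unfolding e
      by (simp add: power_mult_distrib power_add k algebra_simps)
  qed
  show ?thesis
    unfolding krawtchouk_def sum.atMost_Suc
    by (subst sum.cong[OF refl t])
       (simp_all add: sum.distrib distrib_left power_mult_distrib flip: sum_distrib_left)
qed

text \<open>Pascal's rule for the coefficient with upper index \<open>Suc n - s\<close>: one part
  scales \<open>c\<close> by \<open>b\<close> and is covered by \<open>krawtchouk_Suc_Suc\<close>,
  the other shifts j and releases a factor \<open>c\<close>. This serves the step from odd M to M +
  1, where n grows and c stays.\<close>

lemma krawtchouk_Suc:
  assumes "s \<le> n"
  shows "krawtchouk b (Suc n) c (Suc r) s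
     = b ^ Suc r * krawtchouk b n c (Suc r) s + (c - b ^ r) * krawtchouk b n c r s"
proof -
  let ?g = "gauss_binomial b"
  let ?t = "\<lambda>j. (-1) ^ (Suc r - j) * (\<Prod>i<Suc r - j. b ^ i) * ?g (Suc n - j) (Suc r - j)"
  have "krawtchouk b (Suc n) c (Suc r) s = (\<Sum>j\<le>Suc r. ?t j * (?g (Suc (n - s)) j * c ^ j))"
    using assms by (simp add: krawtchouk_def Suc_diff_le)
  also have "\<dots> = ?t 0 + (\<Sum>j\<le>r. ?t (Suc j) * (?g (Suc (n - s)) (Suc j) * c ^ Suc j))"
    by (subst sum.atMost_Suc_shift) simp
  also have "\<dots> = (?t 0 + (\<Sum>j\<le>r. ?t (Suc j) * (?g (n - s) (Suc j) * (c * b) ^ Suc j)))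
                  + c * (\<Sum>j\<le>r. ?t (Suc j) * (?g (n - s) j * c ^ j))"
    by (simp add: sum.distrib sum_distrib_left algebra_simps power_mult_distrib)
  also have "?t 0 + (\<Sum>j\<le>r. ?t (Suc j) * (?g (n - s) (Suc j) * (c * b) ^ Suc j))
             = (\<Sum>j\<le>Suc r. ?t j * (?g (n - s) j * (c * b) ^ j))"
    by (subst sum.atMost_Suc_shift) simp
  also have "\<dots> = krawtchouk b (Suc n) (c * b) (Suc r) (Suc s)"
    by (simp add: krawtchouk_def)
  also have "(\<Sum>j\<le>r. ?t (Suc j) * (?g (n - s) j * c ^ j)) = krawtchouk b n c r s"
    by (simp add: krawtchouk_def)
  finally show ?thesis
    unfolding krawtchouk_Suc_Suc by (simp add: algebra_simps)
qed

text \<open>The exponent M(M - 1)/(2n) is M - 1 for even M and M for odd M, and this expression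
  covers both. For n = 0 no positive power of c survives in the sum.\<close>

definition krawtchouk_c :: "nat \<Rightarrow> nat \<Rightarrow> real" where
  "krawtchouk_c q M = real q powi (2 * ((int M + 1) div 2) - 1)"

lemma F_number_eq:
  assumes q: "q \<ge> 2"
  shows "F_number q (int M) r s =
    (if 0 \<le> r \<and> 0 \<le> s \<and> s \<le> int (M div 2)
     then krawtchouk ((real q)\<^sup>2) (M div 2) (krawtchouk_c q M) (nat r) (nat s) else 0)"
proof (cases "0 \<le> r \<and> r \<le> int (M div 2) \<and> 0 \<le> s \<and> s \<le> int (M div 2)")
  case False
  \<comment> \<open>With s in range and r nonnegative, only r > n is left, where the polynomial
    vanishes as F does.\<close>
  have "M div 2 < nat r" "nat s \<le> M div 2"
    if "0 \<le> r" "0 \<le> s" "s \<le> int (M div 2)"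
    using that False by linarith+
  then show ?thesis
    using False by (auto simp: F_number_def zdiv_int Let_def krawtchouk_eq_0)
next
  case True
  define n where "n = M div 2"
  define R where "R = nat r"
  define S where "S = nat s"
  have rs: "r = int R" "s = int S" "R \<le> n" "S \<le> n"
    using True by (auto simp: R_def S_def n_def)
  have b: "(real q)\<^sup>2 > 1"
    using q by (intro one_less_power) auto
  have c: "(real q powi (int M * (int M - 1) div (2 * int n))) ^ j
           = krawtchouk_c q M ^ j" if "j \<le> n" for j
  proof (cases "n = 0")
    case True
    then show ?thesis using that by simp
  next
    case False
    have "int M * (int M - 1) div (2 * int n) = 2 * ((int M + 1) div 2) - 1"
    proof (cases "even M")
      case True
      then have "int M = 2 * int n" unfolding n_def by presburger
      then show ?thesis using False by simp
    next
      case odd: False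
      then have "int M = 2 * int n + 1" unfolding n_def by presburger
      moreover have "(2 * int n + 1) * (2 * int n) div (2 * int n) = 2 * int n + 1"
        using False by simp
      ultimately show ?thesis by simp
    qed
    then show ?thesis by (simp add: krawtchouk_c_def)
  qed
  have E: "real q ^ (k * (k - 1)) = (\<Prod>i<k. (real q)\<^sup>2 ^ i)" for k
  proof (induction k)
    case (Suc k)
    have "Suc k * (Suc k - 1) = 2 * k + k * (k - 1)" by (cases k) auto
    then have "real q ^ (Suc k * (Suc k - 1)) = ((real q)\<^sup>2) ^ k * real q ^ (k * (k - 1))"
      by (simp only: power_add power_mult)
    then show ?case
      unfolding Suc by (simp only: prod.lessThan_Suc mult.commute)
  qed simp
  have "F_number q (int M) r s =
    (\<Sum>j\<in>int ` {..R}. (-1) powi (r - j) * real q powi ((r - j) * (r - j - 1)) *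
                gauss_binomial_sq q (int n - j) (nat (int n - r)) *
                gauss_binomial_sq q (int n - s) (nat j) *
       (real q powi (int M * (int M - 1) div (2 * int n))) powi j)"
    using True unfolding F_number_def Let_def
    by (simp add: zdiv_int n_def image_int_atLeastAtMost rs flip: atLeast0AtMost)
  also have "\<dots> = (\<Sum>j\<le>R. (-1) powi (r - int j) * real q powi ((r - int j) * (r - int j - 1)) *
                gauss_binomial_sq q (int n - int j) (nat (int n - r)) *
                gauss_binomial_sq q (int n - s) j *
       (real q powi (int M * (int M - 1) div (2 * int n))) powi int j)"
    by (subst sum.reindex) simp_all
  also have "\<dots> = krawtchouk ((real q)\<^sup>2) n (krawtchouk_c q M) R S"
    unfolding krawtchouk_def
  proof (rule sum.cong [OF refl])
    fix j assume "j \<in> {..R}"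
    then have j: "j \<le> R" "j \<le> n" using rs by auto
    have 1: "r - int j = int (R - j)" "int n - int j = int (n - j)" "int n - s = int (n - S)"
      "nat (int n - r) = n - R"
      using j rs by auto
    have 2: "int (R - j) * (int (R - j) - 1) = int ((R - j) * (R - j - 1))"
      by (cases "R - j") (auto simp: algebra_simps)
    have 3: "gauss_binomial ((real q)\<^sup>2) (n - j) (n - R)
             = gauss_binomial ((real q)\<^sup>2) (n - j) (R - j)"
      using gauss_binomial_symmetric[OF b, of "R - j" "n - j"] j rs by simp
    show "(-1) powi (r - int j) * real q powi ((r - int j) * (r - int j - 1)) *
                gauss_binomial_sq q (int n - int j) (nat (int n - r)) *
                gauss_binomial_sq q (int n - s) j *
           (real q powi (int M * (int M - 1) div (2 * int n))) powi int j
        = (-1) ^ (R - j) * (\<Prod>i<R - j. (real q)\<^sup>2 ^ i) *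
           gauss_binomial ((real q)\<^sup>2) (n - j) (R - j) *
           (gauss_binomial ((real q)\<^sup>2) (n - S) j * krawtchouk_c q M ^ j)"
      unfolding c[OF j(2)] 1 2 power_int_of_nat gauss_binomial_sq_eq[OF q] 3 E
      by simp
  qed
  finally show ?thesis
    using True by (simp add: n_def R_def S_def)
qed

lemma F_number_neg [simp]: "r < 0 \<Longrightarrow> F_number q M r s = 0"
  by (simp add: F_number_def Let_def)

lemma F_number_zero [simp]: "q \<ge> 2 \<Longrightarrow> F_number q 0 r 0 = (if r = 0 then 1 else 0)"
  using F_number_eq[of q 0 r 0] krawtchouk_eq_0[of 0 "nat r" 0] by auto

lemma F_number_one [simp]: "q \<ge> 2 \<Longrightarrow> F_number q 1 r 0 = (if r = 0 then 1 else 0)"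
  using F_number_eq[of q 1 r 0] krawtchouk_eq_0[of 0 "nat r" 0] by auto

text \<open>Here n - s is unchanged while c is multiplied by q^2, which is the situation of
  \<open>krawtchouk_Suc_Suc\<close>.\<close>

lemma F_number_hyperbolic:
  assumes q: "q \<ge> 2" and s: "0 \<le> s" "s \<le> int (M div 2)"
  shows "F_number q (int M + 2) r (s + 1)
    = real q powi (2 * r) * F_number q (int M) r s
      - real q powi (2 * r - 2) * F_number q (int M) (r - 1) s"
proof -
  have c: "krawtchouk_c q (M + 2) = krawtchouk_c q M * (real q)\<^sup>2"
  proof -
    have "2 * ((int (M + 2) + 1) div 2) - 1 = (2 * ((int M + 1) div 2) - 1) + 2" by presburger
    moreover have "real q powi (e + 2) = real q powi e * (real q)\<^sup>2" for e
      using q by (simp add: power_int_add)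
    ultimately show ?thesis
      by (simp only: krawtchouk_c_def)
  qed
  have F: "F_number q (int M + 2) r (s + 1) = (if 0 \<le> r then
      krawtchouk ((real q)\<^sup>2) (Suc (M div 2)) (krawtchouk_c q M * (real q)\<^sup>2) (nat r) (Suc (nat s))
      else 0)"
    using F_number_eq[OF q, of "M + 2" r "s + 1"] s c by (simp add: nat_add_distrib add.commute)
  consider "r < 0" | "r = 0" | t where "r = int (Suc t)"
    by (metis int_cases zero_less_nat_eq less_le not_less old.nat.exhaust of_nat_0 nonneg_int_cases)
  then show ?thesis
  proof cases
    case 3
    have "2 * r = 2 * int (Suc t)" "2 * r - 2 = 2 * int t"
      using 3 by auto
    then have "real q powi (2 * r) = ((real q)\<^sup>2) ^ Suc t"
        "real q powi (2 * r - 2) = ((real q)\<^sup>2) ^ t"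
      by (simp_all only: power_int_mult power_int_of_nat power_int_numeral)
    then show ?thesis
      unfolding F using F_number_eq[OF q, of M] 3 s krawtchouk_Suc_Suc
      by (simp add: nat_add_distrib)
  qed (use F F_number_eq[OF q, of M 0 s] s in auto)
qed

text \<open>One formula serves both parities: \<open>b ^ n\<close> for even M and \<open>c\<close>
  for odd M are both equal to \<open>q ^ M\<close>.\<close>

lemma F_number_radical:
  assumes q: "q \<ge> 2" and s: "0 \<le> s" "s \<le> int (M div 2)"
  shows "F_number q (int M + 1) r s
    = real q powi (2 * r) * F_number q (int M) r s
      + (real q ^ M - real q powi (2 * r - 2)) * F_number q (int M) (r - 1) s"
proof -
  consider "r < 0" | "r = 0" | t where "r = int (Suc t)"
    by (metis int_cases zero_less_nat_eq less_le not_less old.nat.exhaust of_nat_0 nonneg_int_cases)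
  then show ?thesis
  proof cases
    case 1
    then show ?thesis by simp
  next
    case 2
    have "s \<le> int (Suc M div 2)" using s by linarith
    then show ?thesis
      using 2 F_number_eq[OF q, of M 0 s] F_number_eq[OF q, of "Suc M" 0 s] s
      by (simp add: add.commute)
  next
    case 3
    have "2 * r = 2 * int (Suc t)" "2 * r - 2 = 2 * int t"
      using 3 by auto
    then have p: "real q powi (2 * r) = ((real q)\<^sup>2) ^ Suc t"
        "real q powi (2 * r - 2) = ((real q)\<^sup>2) ^ t"
      by (simp_all only: power_int_mult power_int_of_nat power_int_numeral)
    have F: "F_number q (int M + 1) r s =
      krawtchouk ((real q)\<^sup>2) (Suc M div 2) (krawtchouk_c q (Suc M)) (Suc t) (nat s)"
    proof -
      have "s \<le> int (Suc M div 2)" using s by linarith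
      then show ?thesis
        using F_number_eq[OF q, of "Suc M" r s] s 3 by (simp add: add.commute nat_add_distrib)
    qed
    define n where "n = M div 2"
    have s': "nat s \<le> n" using s n_def by linarith
    show ?thesis
    proof (cases "even M")
      case True
      then have M: "M = 2 * n" by (simp add: n_def)
      have "krawtchouk_c q (Suc M) = krawtchouk_c q M * (real q)\<^sup>2"
      proof -
        have "2 * ((int (Suc M) + 1) div 2) - 1 = (2 * ((int M + 1) div 2) - 1) + 2"
          unfolding M by simp
        moreover have "real q powi (e + 2) = real q powi e * (real q)\<^sup>2" for e
          using q by (simp add: power_int_add)
        ultimately show ?thesis
          by (simp only: krawtchouk_c_def)
      qed
      moreover have "real q ^ M = ((real q)\<^sup>2) ^ n"
        by (simp add: M power_mult)
      moreover have "Suc M div 2 = n" using M by simp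
      ultimately show ?thesis
        unfolding F p using F_number_eq[OF q, of M] 3 s krawtchouk_scale
        by (simp add: nat_add_distrib flip: n_def)
    next
      case False
      then have M: "M = Suc (2 * n)" unfolding n_def by presburger
      have "krawtchouk_c q (Suc M) = krawtchouk_c q M"
        unfolding krawtchouk_c_def M by simp
      moreover have "krawtchouk_c q M = real q ^ M"
      proof -
        have "2 * ((int M + 1) div 2) - 1 = int M" unfolding M by simp
        then show ?thesis
          unfolding krawtchouk_c_def by (simp only: power_int_of_nat)
      qed
      moreover have "Suc M div 2 = Suc n" using M by simp
      ultimately show ?thesis
        unfolding F p using F_number_eq[OF q, of M] 3 s krawtchouk_Suc[OF s']
        by (simp add: nat_add_distrib flip: n_def)
    qed
  qed
qed

section \<open>Symmetric matrices\<close>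

text \<open>Vectors and matrices are functions on all indices that vanish outside 1..n, so those of
  size n are literally among those of size n + 1.\<close>

definition vecs :: "nat \<Rightarrow> (nat \<Rightarrow> 'a::zero) set" where
  "vecs n = {x. \<forall>i. i \<notin> {1..n} \<longrightarrow> x i = 0}"

definition sym_mats :: "nat \<Rightarrow> (nat \<Rightarrow> nat \<Rightarrow> 'a::zero) set" where
  "sym_mats n = {B. (\<forall>i j. B i j = B j i) \<and> (\<forall>i j. i \<notin> {1..n} \<longrightarrow> B i j = 0)}"

definition dot :: "nat \<Rightarrow> (nat \<Rightarrow> 'a::comm_semiring_0) \<Rightarrow> (nat \<Rightarrow> 'a) \<Rightarrow> 'a" where
  "dot n x y = (\<Sum>i = 1..n. x i * y i)"

definition mat_vec :: "nat \<Rightarrow> (nat \<Rightarrow> nat \<Rightarrow> 'a::comm_semiring_0) \<Rightarrow> (nat \<Rightarrow> 'a) \<Rightarrow> nat \<Rightarrow> 'a" where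
  "mat_vec n B x i = dot n (B i) x"

definition trace_prod ::
    "nat \<Rightarrow> (nat \<Rightarrow> nat \<Rightarrow> 'a::comm_semiring_0) \<Rightarrow> (nat \<Rightarrow> nat \<Rightarrow> 'a) \<Rightarrow> 'a" where
  "trace_prod n A B = (\<Sum>i = 1..n. \<Sum>j = 1..n. A i j * B j i)"

definition ker_card :: "nat \<Rightarrow> (nat \<Rightarrow> nat \<Rightarrow> 'a::comm_semiring_0) \<Rightarrow> nat" where
  "ker_card n B = card {x \<in> vecs n. mat_vec n B x = (\<lambda>_. 0)}"

definition col_space :: "nat \<Rightarrow> (nat \<Rightarrow> nat \<Rightarrow> 'a::comm_semiring_0) \<Rightarrow> (nat \<Rightarrow> 'a) set" where
  "col_space n B = mat_vec n B ` vecs n"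

definition border ::
    "nat \<Rightarrow> (nat \<Rightarrow> nat \<Rightarrow> 'a) \<Rightarrow> (nat \<Rightarrow> 'a) \<Rightarrow> 'a \<Rightarrow> nat \<Rightarrow> nat \<Rightarrow> 'a" where
  "border n B b \<beta> = (\<lambda>i j. if i = Suc n then (if j = Suc n then \<beta> else b j)
                            else (if j = Suc n then b i else B i j))"

text \<open>Rank k is expressed by a kernel of q^(n - k) vectors. The index is an integer so that
  the recursions may speak of k - 1 and k - 2; negative ranks give empty sets.\<close>

definition rank_mats :: "nat \<Rightarrow> int \<Rightarrow> (nat \<Rightarrow> nat \<Rightarrow> 'a::{finite,field}) set" where
  "rank_mats n k = {B \<in> sym_mats n.
     real (ker_card n B) * real CARD('a) powi k = real CARD('a) ^ n}"

lemma vecs_0: "vecs 0 = {\<lambda>_. 0}"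
  by (auto simp: vecs_def)

lemma sym_mats_0: "sym_mats 0 = {\<lambda>_ _. 0}"
  by (auto simp: sym_mats_def fun_eq_iff)

lemma dot_Suc: "dot (Suc n) x y = dot n x y + x (Suc n) * y (Suc n)"
  by (simp add: dot_def)

lemma dot_zero [simp]: "dot n x (\<lambda>_. 0) = 0" "dot n (\<lambda>_. 0) x = 0"
  by (simp_all add: dot_def)

lemma dot_commute: "dot n x y = dot n y x"
  by (simp add: dot_def mult.commute)

lemma dot_cong: "(\<And>i. i \<in> {1..n} \<Longrightarrow> x i = x' i) \<Longrightarrow> (\<And>i. i \<in> {1..n} \<Longrightarrow> y i = y' i) \<Longrightarrow>
    dot n x y = dot n x' y'"
  by (simp add: dot_def)

lemma dot_add_scale:
  fixes c :: "'a::comm_ring"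
  shows "dot n x (\<lambda>i. y i + c * z i) = dot n x y + c * dot n x z"
  by (simp add: dot_def sum.distrib sum_distrib_left algebra_simps)

lemma dot_scale:
  fixes c :: "'a::comm_ring"
  shows "dot n x (\<lambda>i. c * z i) = c * dot n x z"
  by (simp add: dot_def sum_distrib_left algebra_simps)

lemma mat_vec_add_scale:
  fixes c :: "'a::comm_ring"
  shows "mat_vec n B (\<lambda>i. y i + c * z i) = (\<lambda>i. mat_vec n B y i + c * mat_vec n B z i)"
  by (simp add: fun_eq_iff mat_vec_def dot_add_scale)

lemma dot_mat_vec:
  assumes "B \<in> sym_mats n"
  shows "dot n x (mat_vec n B y) = dot n (mat_vec n B x) y"
proof -
  have "dot n x (mat_vec n B y) = (\<Sum>i = 1..n. \<Sum>j = 1..n. B i j * x i * y j)"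
    by (simp add: dot_def mat_vec_def sum_distrib_left algebra_simps)
  also have "\<dots> = (\<Sum>j = 1..n. \<Sum>i = 1..n. B i j * x i * y j)"
    by (rule sum.swap)
  also have "\<dots> = (\<Sum>j = 1..n. \<Sum>i = 1..n. B j i * x i * y j)"
    using assms by (simp add: sym_mats_def)
  also have "\<dots> = dot n (mat_vec n B x) y"
    by (simp add: dot_def mat_vec_def sum_distrib_left sum_distrib_right algebra_simps)
  finally show ?thesis .
qed

lemma mat_vec_in_vecs: "B \<in> sym_mats n \<Longrightarrow> mat_vec n B x \<in> vecs n"
  by (auto simp: sym_mats_def vecs_def mat_vec_def dot_def)

lemma vecs_add_scale:
  fixes c :: "'a::comm_ring"
  shows "x \<in> vecs n \<Longrightarrow> y \<in> vecs n \<Longrightarrow> (\<lambda>i. x i + c * y i) \<in> vecs n"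
  by (auto simp: vecs_def)

lemma vecs_Suc: "vecs (Suc n) = (\<lambda>(x, t). x(Suc n := t)) ` (vecs n \<times> UNIV)"
proof (intro subset_antisym subsetI)
  fix x :: "nat \<Rightarrow> 'a" assume "x \<in> vecs (Suc n)"
  then have "x(Suc n := 0) \<in> vecs n" "x = (x(Suc n := 0))(Suc n := x (Suc n))"
    by (auto simp: vecs_def)
  then show "x \<in> (\<lambda>(x, t). x(Suc n := t)) ` (vecs n \<times> UNIV)"
    by (intro image_eqI[of _ _ "(x(Suc n := 0), x (Suc n))"]) auto
qed (auto simp: vecs_def)

lemma sum_vecs_Suc:
  fixes f :: "(nat \<Rightarrow> 'a::zero) \<Rightarrow> 'b::comm_monoid_add"
  shows "(\<Sum>x\<in>vecs (Suc n). f x) = (\<Sum>x\<in>vecs n. \<Sum>t\<in>UNIV. f (x(Suc n := t)))"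
proof -
  have "inj_on (\<lambda>(x, t). x(Suc n := t)) (vecs n \<times> (UNIV :: 'a set))"
  proof (rule inj_onI, clarify)
    fix x y :: "nat \<Rightarrow> 'a" and s t
    assume *: "x \<in> vecs n" "y \<in> vecs n" "x(Suc n := s) = y(Suc n := t)"
    have "x i = y i" for i
      using fun_cong[OF *(3), of i] *(1,2) by (cases "i = Suc n") (auto simp: vecs_def)
    moreover have "s = t"
      using fun_cong[OF *(3), of "Suc n"] by simp
    ultimately show "x = y \<and> s = t" by auto
  qed
  then show ?thesis
    unfolding vecs_Suc by (simp add: sum.reindex sum.cartesian_product case_prod_unfold)
qed

lemma finite_vecs [simp]: "finite (vecs n :: (nat \<Rightarrow> 'a::{finite,zero}) set)"
  by (induction n) (auto simp: vecs_0 vecs_Suc)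

lemma card_vecs: "card (vecs n :: (nat \<Rightarrow> 'a::{finite,zero}) set) = CARD('a) ^ n"
proof (induction n)
  case (Suc n)
  have "card (vecs (Suc n) :: (nat \<Rightarrow> 'a) set) = (\<Sum>x\<in>(vecs (Suc n) :: (nat \<Rightarrow> 'a) set). 1)"
    by simp
  also have "\<dots> = CARD('a) ^ Suc n"
    unfolding sum_vecs_Suc by (simp add: Suc mult.commute)
  finally show ?case .
qed (simp add: vecs_0)

lemma border_in_sym_mats:
  "B \<in> sym_mats n \<Longrightarrow> b \<in> vecs n \<Longrightarrow> border n B b \<beta> \<in> sym_mats (Suc n)"
  by (auto simp: sym_mats_def vecs_def border_def)

lemma sym_mats_Suc:
  "sym_mats (Suc n) = (\<lambda>(B, b, \<beta>). border n B b \<beta>) ` (sym_mats n \<times> vecs n \<times> UNIV)"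
proof (intro subset_antisym subsetI)
  fix B :: "nat \<Rightarrow> nat \<Rightarrow> 'a" assume B: "B \<in> sym_mats (Suc n)"
  let ?B = "\<lambda>i j. if i = Suc n \<or> j = Suc n then 0 else B i j"
  let ?b = "(B (Suc n))(Suc n := 0)"
  have z: "B i j = 0" if "i \<notin> {1..Suc n} \<or> j \<notin> {1..Suc n}" for i j
    using B that unfolding sym_mats_def mem_Collect_eq by metis
  have s: "B i j = B j i" for i j
    using B unfolding sym_mats_def by blast
  have "?B \<in> sym_mats n" "?b \<in> vecs n"
    using z s by (auto simp: sym_mats_def vecs_def)
  moreover have "B = border n ?B ?b (B (Suc n) (Suc n))"
    using s by (auto simp: border_def fun_eq_iff)
  ultimately show "B \<in> (\<lambda>(B, b, \<beta>). border n B b \<beta>) ` (sym_mats n \<times> vecs n \<times> UNIV)"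
    by (intro image_eqI[of _ _ "(?B, ?b, B (Suc n) (Suc n))"]) auto
qed (auto simp: border_in_sym_mats)

lemma sum_sym_mats_Suc:
  fixes f :: "(nat \<Rightarrow> nat \<Rightarrow> 'a::zero) \<Rightarrow> 'b::comm_monoid_add"
  shows "(\<Sum>B\<in>sym_mats (Suc n). f B)
     = (\<Sum>B\<in>sym_mats n. \<Sum>b\<in>vecs n. \<Sum>\<beta>\<in>UNIV. f (border n B b \<beta>))"
proof -
  have "inj_on (\<lambda>(B, b, \<beta>). border n B b \<beta>) (sym_mats n \<times> vecs n \<times> (UNIV :: 'a set))"
  proof (rule inj_onI)
    fix X Y :: "(nat \<Rightarrow> nat \<Rightarrow> 'a) \<times> (nat \<Rightarrow> 'a) \<times> 'a"
    assume X: "X \<in> sym_mats n \<times> vecs n \<times> UNIV" and Y: "Y \<in> sym_mats n \<times> vecs n \<times> UNIV"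
      and XY: "(case X of (B, b, \<beta>) \<Rightarrow> border n B b \<beta>) = (case Y of (B, b, \<beta>) \<Rightarrow> border n B b \<beta>)"
    obtain B b \<beta> B' b' \<beta>' where [simp]: "X = (B, b, \<beta>)" "Y = (B', b', \<beta>')"
      by (metis prod_cases3)
    have *: "B \<in> sym_mats n" "B' \<in> sym_mats n" "b \<in> vecs n" "b' \<in> vecs n"
      and eq: "border n B b \<beta> = border n B' b' \<beta>'"
      using X Y XY by auto
    have eq': "border n B b \<beta> i j = border n B' b' \<beta>' i j" for i j
      using eq by simp
    have z: "C i j = 0" if "i = Suc n \<or> j = Suc n" "C \<in> sym_mats n" for C :: "nat \<Rightarrow> nat \<Rightarrow> 'a"
        and i j
      using that unfolding sym_mats_def mem_Collect_eq
      by (metis atLeastAtMost_iff not_less_eq_eq order_refl)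
    have "B i j = B' i j" for i j
    proof (cases "i = Suc n \<or> j = Suc n")
      case True
      then show ?thesis using z[OF True] *(1,2) by metis
    next
      case False
      then show ?thesis using eq'[of i j] by (simp add: border_def)
    qed
    moreover have "b i = b' i" for i
      using eq'[of "Suc n" i] * by (cases "i = Suc n") (auto simp: border_def vecs_def)
    moreover have "\<beta> = \<beta>'"
      using eq'[of "Suc n" "Suc n"] by (simp add: border_def)
    ultimately show "X = Y" by auto
  qed
  then show ?thesis
    unfolding sym_mats_Suc by (simp add: sum.reindex sum.cartesian_product case_prod_unfold)
qed

lemma finite_sym_mats [simp]: "finite (sym_mats n :: (nat \<Rightarrow> nat \<Rightarrow> 'a::{finite,zero}) set)"
  by (induction n) (auto simp: sym_mats_0 sym_mats_Suc)

lemma sum_rank_mats: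
  fixes f :: "(nat \<Rightarrow> nat \<Rightarrow> 'a::{finite,field}) \<Rightarrow> 'b::semiring_1"
  shows "(\<Sum>B\<in>rank_mats n k. f B) = (\<Sum>B\<in>sym_mats n. of_bool (B \<in> rank_mats n k) * f B)"
proof -
  have "(rank_mats n k :: (nat \<Rightarrow> nat \<Rightarrow> 'a) set) = {B \<in> sym_mats n. B \<in> rank_mats n k}"
    by (auto simp: rank_mats_def)
  then have "(\<Sum>B\<in>rank_mats n k. f B) = (\<Sum>B\<in>{B \<in> sym_mats n. B \<in> rank_mats n k}. f B)"
    by simp
  then show ?thesis
    by (simp add: sum.inter_filter of_bool_def if_distrib[of "\<lambda>c. c * _"] cong: if_cong)
qed

lemma mat_vec_border:
  "mat_vec (Suc n) (border n B b \<beta>) (x(Suc n := t)) =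
     (\<lambda>i. if i = Suc n then dot n b x + \<beta> * t else mat_vec n B x i + b i * t)"
  by (auto simp: mat_vec_def dot_def border_def fun_eq_iff intro!: sum.cong)

lemma ker_card_eq_sum:
  "ker_card n B = (\<Sum>x\<in>vecs n. of_bool (mat_vec n B x = (\<lambda>_. 0)))"
  for B :: "nat \<Rightarrow> nat \<Rightarrow> 'a::{finite,comm_semiring_0}"
  by (simp add: ker_card_def of_bool_def sum.If_cases Collect_conj_eq)

lemma mat_vec_border_eq_0_iff:
  fixes B :: "nat \<Rightarrow> nat \<Rightarrow> 'a::comm_ring"
  assumes "B \<in> sym_mats n" "b \<in> vecs n"
  shows "mat_vec (Suc n) (border n B b \<beta>) (x(Suc n := t)) = (\<lambda>_. 0) \<longleftrightarrow>
    dot n b x + \<beta> * t = 0 \<and> (\<lambda>i. mat_vec n B x i + t * b i) = (\<lambda>_. 0)"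
proof -
  have "mat_vec n B x (Suc n) + t * b (Suc n) = 0"
    using mat_vec_in_vecs[OF assms(1), of x] assms(2) by (simp add: vecs_def)
  then show ?thesis
    unfolding mat_vec_border by (auto simp: fun_eq_iff mult.commute)
qed

lemma bij_betw_vecs_shift:
  fixes c :: "'a::comm_ring"
  assumes "y \<in> vecs n"
  shows "bij_betw (\<lambda>x i. x i + c * y i) (vecs n) (vecs n)"
proof (rule bij_betw_byWitness[where f' = "\<lambda>x i. x i + (- c) * y i"])
  show "(\<lambda>x i. x i + c * y i) ` vecs n \<subseteq> vecs n" "(\<lambda>x i. x i + (- c) * y i) ` vecs n \<subseteq> vecs n"
    using vecs_add_scale[OF _ assms] by blast+
qed auto

text \<open>The shear \<open>x - t * y\<close> removes the new column: the system becomes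
  \<open>B x = 0\<close> together with \<open>(\<beta> - \<beta>0) * t = 0\<close>, where \<beta>0
  is \<open>dot n (mat_vec n B y) y\<close>, because \<open>B y\<close> is orthogonal to the kernel
  of \<open>B\<close>. The second equation is void exactly for \<beta> = \<beta>0.\<close>

lemma ker_card_border_col:
  fixes B :: "nat \<Rightarrow> nat \<Rightarrow> 'a::{finite,field}"
  assumes B: "B \<in> sym_mats n" and y: "y \<in> vecs n"
  shows "ker_card (Suc n) (border n B (mat_vec n B y) \<beta>)
    = ker_card n B * (if \<beta> = dot n (mat_vec n B y) y then CARD('a) else 1)"
proof -
  let ?b = "mat_vec n B y" and ?\<beta>0 = "dot n (mat_vec n B y) y"
  have b: "?b \<in> vecs n" using mat_vec_in_vecs[OF B] .
  have iff: "mat_vec (Suc n) (border n B ?b \<beta>) ((\<lambda>i. x i + (- t) * y i)(Suc n := t)) = (\<lambda>_. 0) \<longleftrightarrow>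
      (\<beta> = ?\<beta>0 \<or> t = 0) \<and> mat_vec n B x = (\<lambda>_. 0)" for x t
  proof -
    have "mat_vec (Suc n) (border n B ?b \<beta>) ((\<lambda>i. x i + (- t) * y i)(Suc n := t)) = (\<lambda>_. 0) \<longleftrightarrow>
       dot n ?b x + (- t) * ?\<beta>0 + \<beta> * t = 0 \<and> mat_vec n B x = (\<lambda>_. 0)"
      unfolding mat_vec_border_eq_0_iff[OF B b] dot_add_scale mat_vec_add_scale
          by (simp add: fun_eq_iff)
    moreover have "dot n ?b x = 0" if "mat_vec n B x = (\<lambda>_. 0)"
      using dot_mat_vec[OF B, of y x] that by (simp add: dot_def)
    moreover have "(- t) * ?\<beta>0 + \<beta> * t = 0 \<longleftrightarrow> \<beta> = ?\<beta>0 \<or> t = 0"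
      by (auto simp: algebra_simps)
    ultimately show ?thesis by auto
  qed
  have "ker_card (Suc n) (border n B ?b \<beta>)
      = (\<Sum>t\<in>UNIV. \<Sum>x\<in>vecs n. of_bool (mat_vec (Suc n) (border n B ?b \<beta>) (x(Suc n := t)) = (\<lambda>_. 0)))"
    unfolding ker_card_eq_sum sum_vecs_Suc by (rule sum.swap)
  also have "\<dots> = (\<Sum>t\<in>UNIV. \<Sum>x\<in>vecs n. of_bool (mat_vec (Suc n) (border n B ?b \<beta>)
                     ((\<lambda>i. x i + (- t) * y i)(Suc n := t)) = (\<lambda>_. 0)))"
    by (intro sum.cong refl sum.reindex_bij_betw[OF bij_betw_vecs_shift[OF y], symmetric])
  also have "\<dots> = (\<Sum>t\<in>(UNIV :: 'a set). if \<beta> = ?\<beta>0 \<or> t = 0 then ker_card n B else 0)"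
    unfolding iff ker_card_eq_sum by (intro sum.cong refl) (simp add: sum_distrib_left of_bool_conj)
  also have "\<dots> = ker_card n B * (if \<beta> = ?\<beta>0 then CARD('a) else 1)"
    by (cases "\<beta> = ?\<beta>0") simp_all
  finally show ?thesis .
qed

text \<open>As a simplification rule, \<open>of_nat_CARD\<close> turns every cardinality of the
  field into the complex number \<open>q\<close>.\<close>

locale nontrivial_character =
  fixes \<chi> :: "'a::{finite,field} \<Rightarrow> complex" and q :: complex
  assumes of_nat_CARD [simp]: "of_nat CARD('a) = q"
    and chi_0 [simp]: "\<chi> 0 = 1"
    and chi_add: "\<chi> (x + y) = \<chi> x * \<chi> y"
    and chi_nontrivial: "\<exists>x. \<chi> x \<noteq> 1"
begin

text \<open>Reindexing by \<open>g\<close> multiplies the sum by \<open>\<chi> c\<close>, which is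
  not 1. The orthogonality relations below all come from this.\<close>

lemma sum_chi_shift_0:
  assumes "bij_betw g K K" "\<And>x. x \<in> K \<Longrightarrow> \<phi> (g x) = \<phi> x + c" "\<chi> c \<noteq> 1"
  shows "(\<Sum>x\<in>K. \<chi> (\<phi> x)) = 0"
proof -
  have "(\<Sum>x\<in>K. \<chi> (\<phi> x)) = (\<Sum>x\<in>K. \<chi> (\<phi> (g x)))"
    using sum.reindex_bij_betw[OF assms(1), of "\<lambda>x. \<chi> (\<phi> x)"] by simp
  also have "\<dots> = \<chi> c * (\<Sum>x\<in>K. \<chi> (\<phi> x))"
    using assms(2) by (simp add: chi_add sum_distrib_left mult.commute)
  finally show ?thesis
    using assms(3) by (metis mult_cancel_right1)
qed

lemma sum_chi_mult: "(\<Sum>t\<in>UNIV. \<chi> (a * t)) = (if a = 0 then q else 0)"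
proof (cases "a = 0")
  case False
  obtain c where c: "\<chi> c \<noteq> 1" using chi_nontrivial by blast
  have "bij (\<lambda>t. t + c / a)"
    by (rule bij_betw_byWitness[where f' = "\<lambda>t. t - c / a"]) auto
  then show ?thesis
    using sum_chi_shift_0[of "\<lambda>t. t + c / a" UNIV "\<lambda>t. a * t" c] False c
        by (simp add: algebra_simps)
qed simp

lemma sum_chi_dot:
  "(\<Sum>x\<in>vecs n. \<chi> (dot n a x)) = (if \<forall>i\<in>{1..n}. a i = 0 then q ^ n else 0)"
proof (induction n)
  case 0
  then show ?case by (simp add: vecs_0 dot_def)
next
  case (Suc n)
  have "(\<Sum>x\<in>vecs (Suc n). \<chi> (dot (Suc n) a x))
      = (\<Sum>x\<in>vecs n. \<Sum>t\<in>UNIV. \<chi> (dot n a x) * \<chi> (a (Suc n) * t))"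
  proof -
    have "dot n a (x(Suc n := t)) = dot n a x" for x t
      by (rule dot_cong) auto
    then show ?thesis
      unfolding sum_vecs_Suc by (simp add: dot_Suc chi_add)
  qed
  also have "\<dots> = (\<Sum>x\<in>vecs n. \<chi> (dot n a x)) * (\<Sum>t\<in>UNIV. \<chi> (a (Suc n) * t))"
    by (simp add: sum_product)
  also have "\<dots> = (if \<forall>i\<in>{1..Suc n}. a i = 0 then q ^ Suc n else 0)"
    unfolding Suc sum_chi_mult by (auto simp: atLeastAtMostSuc_conv)
  finally show ?case .
qed

lemma sum_ker_chi:
  fixes B :: "nat \<Rightarrow> nat \<Rightarrow> 'a" and n :: nat
  defines "K \<equiv> {x \<in> vecs n. mat_vec n B x = (\<lambda>_. 0)}"
  shows "(\<Sum>x\<in>K. \<chi> (dot n b x)) = (if \<forall>x\<in>K. dot n b x = 0 then of_nat (card K) else 0)"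
proof (cases "\<forall>x\<in>K. dot n b x = 0")
  case False
  then obtain x where x: "x \<in> K" "dot n b x \<noteq> 0" by blast
  obtain c where c: "\<chi> c \<noteq> 1" using chi_nontrivial by blast
  \<comment> \<open>The kernel vector \<open>s * x\<close> has product \<open>c\<close> with
    \<open>b\<close>, so it serves as the translation.\<close>
  define s where "s = c / dot n b x"
  have closed: "(\<lambda>i. z i + s * x i) \<in> K" if "z \<in> K" for z s
    using that x(1) unfolding K_def
    by (auto simp: vecs_add_scale mat_vec_add_scale)
  have "bij_betw (\<lambda>z i. z i + s * x i) K K"
  proof (rule bij_betw_byWitness[where f' = "\<lambda>z i. z i + (- s) * x i"])
    show "(\<lambda>z i. z i + s * x i) ` K \<subseteq> K" "(\<lambda>z i. z i + (- s) * x i) ` K \<subseteq> K"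
      using closed by blast+
  qed auto
  moreover have "dot n b (\<lambda>i. z i + s * x i) = dot n b z + c" for z
    using x(2) by (simp only: dot_add_scale s_def) simp
  ultimately have "(\<Sum>x\<in>K. \<chi> (dot n b x)) = 0"
    using sum_chi_shift_0[where g = "\<lambda>z i. z i + s * x i" and \<phi> = "dot n b"] c by blast
  then show ?thesis
    unfolding if_not_P[OF False] .
qed simp

text \<open>Each fibre of \<open>B\<close> over its column space is a translate of the
  kernel.\<close>

lemma sum_col_space:
  fixes B :: "nat \<Rightarrow> nat \<Rightarrow> 'a" and f :: "_ \<Rightarrow> complex"
  shows "(\<Sum>y\<in>vecs n. f (mat_vec n B y)) = of_nat (ker_card n B) * (\<Sum>b\<in>col_space n B. f b)"
proof -
  have fib: "card {y \<in> vecs n. mat_vec n B y = b} = ker_card n B" if "b \<in> col_space n B" for b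
  proof -
    from that obtain z where z: "z \<in> vecs n" "b = mat_vec n B z"
      by (auto simp: col_space_def)
    let ?K = "\<lambda>c. {x \<in> vecs n. mat_vec n B x = c}"
    have shift: "(\<lambda>i. x i + c * z i) \<in> ?K (\<lambda>i. d i + c * b i)" if "x \<in> ?K d" for x c d
    proof -
      from that have x: "x \<in> vecs n" "d = mat_vec n B x" by auto
      have "mat_vec n B (\<lambda>i. x i + c * z i) = (\<lambda>i. d i + c * b i)"
        unfolding mat_vec_add_scale x(2) z(2) ..
      then show ?thesis
        using vecs_add_scale[OF x(1) z(1)] by blast
    qed
    have "bij_betw (\<lambda>x i. x i + 1 * z i) (?K (\<lambda>_. 0)) (?K b)"
    proof (rule bij_betw_byWitness[where f' = "\<lambda>x i. x i + (- 1) * z i"])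
      show "(\<lambda>x i. x i + 1 * z i) ` ?K (\<lambda>_. 0) \<subseteq> ?K b"
      proof (rule image_subsetI)
        fix x assume "x \<in> ?K (\<lambda>_. 0)"
        from shift[OF this, of 1] show "(\<lambda>i. x i + 1 * z i) \<in> ?K b" by simp
      qed
      show "(\<lambda>x i. x i + (- 1) * z i) ` ?K b \<subseteq> ?K (\<lambda>_. 0)"
      proof (rule image_subsetI)
        fix x assume "x \<in> ?K b"
        from shift[OF this, of "- 1"] show "(\<lambda>i. x i + (- 1) * z i) \<in> ?K (\<lambda>_. 0)" by simp
      qed
    qed auto
    from bij_betw_same_card[OF this] show ?thesis
      by (simp only: ker_card_def)
  qed
  have "(\<Sum>y\<in>vecs n. f (mat_vec n B y))
      = (\<Sum>b\<in>col_space n B. \<Sum>y\<in>{y \<in> vecs n. mat_vec n B y = b}. f (mat_vec n B y))"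
    unfolding col_space_def by (rule sum.image_gen) simp
  also have "\<dots> = (\<Sum>b\<in>col_space n B. of_nat (ker_card n B) * f b)"
    using fib by (intro sum.cong refl) simp
  finally show ?thesis by (simp add: sum_distrib_left)
qed

text \<open>Rank plus nullity in counted form, read off from the constant function 1.\<close>

lemma card_col_space: "ker_card n B * card (col_space n B) = CARD('a) ^ n"
  for B :: "nat \<Rightarrow> nat \<Rightarrow> 'a"
proof -
  have "of_nat (ker_card n B * card (col_space n B)) = (of_nat (CARD('a) ^ n) :: complex)"
    using sum_col_space[where f = "\<lambda>_. 1" and n = n and B = B] by (simp add: card_vecs)
  then show ?thesis by (simp only: of_nat_eq_iff)
qed

lemma ker_card_pos: "ker_card n B > 0"
  for B :: "nat \<Rightarrow> nat \<Rightarrow> 'a"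
  using card_col_space[of n B] by (metis mult_is_0 not_gr_zero power_not_zero zero_less_card_finite)

text \<open>A symmetric matrix maps onto the orthogonal complement of its kernel; the two have the same
  cardinality by summing \<open>\<chi> (b \<bullet> x)\<close> over all vectors \<open>b\<close> and all \<open>x\<close> in the kernel.\<close>

lemma not_in_col_space:
  fixes B :: "nat \<Rightarrow> nat \<Rightarrow> 'a"
  assumes B: "B \<in> sym_mats n" and b: "b \<in> vecs n" "b \<notin> col_space n B"
  obtains x where "x \<in> vecs n" "mat_vec n B x = (\<lambda>_. 0)" "dot n b x \<noteq> 0"
proof -
  define K where "K = {x \<in> vecs n. mat_vec n B x = (\<lambda>_. 0)}"
  define P where "P = {b \<in> vecs n. \<forall>x\<in>K. dot n b x = 0}"
  have fin: "finite P" "finite K" by (simp_all add: P_def K_def)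
  have sub: "col_space n B \<subseteq> P"
  proof
    fix c assume "c \<in> col_space n B"
    then obtain y where "y \<in> vecs n" "c = mat_vec n B y" by (auto simp: col_space_def)
    then show "c \<in> P"
      using mat_vec_in_vecs[OF B] by (auto simp: P_def K_def simp flip: dot_mat_vec[OF B])
  qed
  have zero: "(\<lambda>_. 0) \<in> K" by (auto simp: K_def vecs_def mat_vec_def dot_def)
  have "of_nat (card P * card K) = (\<Sum>b\<in>vecs n. if b \<in> P then of_nat (card K) else (0::complex))"
    using fin by (simp add: P_def sum.If_cases Collect_conj_eq Int_commute)
  also have "\<dots> = (\<Sum>b\<in>vecs n. \<Sum>x\<in>K. \<chi> (dot n b x))"
    unfolding sum_ker_chi[where n = n and B = B, folded K_def]
    by (intro sum.cong refl) (simp add: P_def)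
  also have "\<dots> = (\<Sum>x\<in>K. \<Sum>b\<in>vecs n. \<chi> (dot n x b))"
    by (subst sum.swap) (simp add: dot_commute)
  also have "\<dots> = (\<Sum>x\<in>K. if x = (\<lambda>_. 0) then q ^ n else 0)"
  proof (intro sum.cong refl)
    fix x assume "x \<in> K"
    then have "(\<forall>i\<in>{1..n}. x i = 0) \<longleftrightarrow> x = (\<lambda>_. 0)"
      by (auto simp: K_def vecs_def fun_eq_iff)
    then show "(\<Sum>b\<in>vecs n. \<chi> (dot n x b)) = (if x = (\<lambda>_. 0) then q ^ n else 0)"
      by (simp add: sum_chi_dot)
  qed
  also have "\<dots> = of_nat (CARD('a) ^ n)"
    using zero fin by simp
  finally have "card P * card K = CARD('a) ^ n"
    by (simp only: of_nat_eq_iff)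
  moreover have "card (col_space n B) * card K = CARD('a) ^ n"
    using card_col_space[of n B] by (simp add: ker_card_def K_def mult.commute)
  moreover have "card K \<noteq> 0"
    using zero fin by auto
  ultimately have "card (col_space n B) = card P"
    by (metis mult_cancel2)
  then have "col_space n B = P"
    using sub fin card_subset_eq by metis
  then show ?thesis
    using b that by (auto simp: P_def K_def)
qed

text \<open>As \<open>b\<close> is not in the column space, \<open>B x + t * b = 0\<close> forces
  \<open>t = 0\<close>; the remaining condition \<open>dot n b x = 0\<close> cuts a subspace of
  index q out of the kernel.\<close>

lemma ker_card_border_not_col:
  fixes B :: "nat \<Rightarrow> nat \<Rightarrow> 'a"
  assumes B: "B \<in> sym_mats n" and b: "b \<in> vecs n" "b \<notin> col_space n B"
  shows "ker_card (Suc n) (border n B b \<beta>) * CARD('a) = ker_card n B"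
proof -
  define K where "K = {x \<in> vecs n. mat_vec n B x = (\<lambda>_. 0)}"
  have fin: "finite K" by (simp add: K_def)
  have iff: "mat_vec (Suc n) (border n B b \<beta>) (x(Suc n := t)) = (\<lambda>_. 0) \<longleftrightarrow>
      t = 0 \<and> x \<in> K \<and> dot n b x = 0" if x: "x \<in> vecs n" for x t
  proof (cases "t = 0")
    case True
    then show ?thesis
      using x by (auto simp: mat_vec_border_eq_0_iff[OF B b(1)] K_def)
  next
    case False
    have "b \<in> col_space n B" if "(\<lambda>i. mat_vec n B x i + t * b i) = (\<lambda>_. 0)"
    proof -
      have "mat_vec n B (\<lambda>i. 0 + (- inverse t) * x i) = (\<lambda>i. - inverse t * mat_vec n B x i)"
        unfolding mat_vec_add_scale by (simp add: mat_vec_def dot_def)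
      also have "\<dots> = b"
      proof
        fix i
        have "mat_vec n B x i = - (t * b i)"
          using fun_cong[OF that, of i] by (simp add: eq_neg_iff_add_eq_0)
        then show "- inverse t * mat_vec n B x i = b i"
          using False by simp
      qed
      moreover have "(\<lambda>i. 0 + (- inverse t) * x i) \<in> vecs n"
        using x by (intro vecs_add_scale) (auto simp: vecs_def)
      ultimately show ?thesis
        unfolding col_space_def by (metis image_eqI)
    qed
    then show ?thesis
      using False b(2) by (auto simp: mat_vec_border_eq_0_iff[OF B b(1)])
  qed
  have "ker_card (Suc n) (border n B b \<beta>)
      = (\<Sum>x\<in>vecs n. \<Sum>t\<in>(UNIV :: 'a set). of_bool (t = 0 \<and> x \<in> K \<and> dot n b x = 0))"
    unfolding ker_card_eq_sum sum_vecs_Suc by (intro sum.cong refl) (simp only: iff)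
  also have "\<dots> = (\<Sum>x\<in>vecs n. \<Sum>t\<in>(UNIV :: 'a set).
      if t = 0 then of_bool (x \<in> K \<and> dot n b x = 0) else 0)"
    by (intro sum.cong refl) auto
  also have "\<dots> = card {x \<in> vecs n. x \<in> K \<and> dot n b x = 0}"
    by (simp add: of_bool_def sum.If_cases Collect_conj_eq)
  also have "{x \<in> vecs n. x \<in> K \<and> dot n b x = 0} = {x \<in> K. dot n b x = 0}"
    by (auto simp: K_def)
  finally have card: "ker_card (Suc n) (border n B b \<beta>) = card {x \<in> K. dot n b x = 0}" .
  obtain x0 where x0: "x0 \<in> K" "dot n b x0 \<noteq> 0"
    using not_in_col_space[OF B b] unfolding K_def by blast
  \<comment> \<open>The sum over \<open>t\<close> detects \<open>dot n b x = 0\<close>. After the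
    exchange of sums, \<open>t \<noteq> 0\<close> contributes nothing because of
    \<open>x0\<close>.\<close>
  have "of_nat (card {x \<in> K. dot n b x = 0} * CARD('a)) = (\<Sum>x\<in>K. if dot n b x = 0 then q else 0)"
    using fin by (simp add: sum.If_cases Collect_conj_eq Int_commute)
  also have "\<dots> = (\<Sum>x\<in>K. \<Sum>t\<in>UNIV. \<chi> (dot n b x * t))"
    by (simp add: sum_chi_mult)
  also have "\<dots> = (\<Sum>t\<in>UNIV. \<Sum>x\<in>K. \<chi> (dot n (\<lambda>i. t * b i) x))"
    by (subst sum.swap) (simp add: dot_commute[of n "\<lambda>i. _ * b i"] dot_scale dot_commute[of n b]
        mult.commute)
  also have "\<dots> = (\<Sum>t\<in>(UNIV :: 'a set). if t = 0 then of_nat (card K) else 0)"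
  proof (intro sum.cong refl)
    fix t
    have "(\<forall>x\<in>K. dot n (\<lambda>i. t * b i) x = 0) \<longleftrightarrow> t = 0"
      using x0 by (auto simp: dot_commute[of n "\<lambda>i. _ * b i"] dot_scale dot_commute[of n _ b])
    then show "(\<Sum>x\<in>K. \<chi> (dot n (\<lambda>i. t * b i) x)) = (if t = 0 then of_nat (card K) else 0)"
      by (simp only: sum_ker_chi[where n = n and B = B, folded K_def])
  qed
  also have "\<dots> = of_nat (ker_card n B)"
    by (simp add: K_def ker_card_def)
  finally show ?thesis
    unfolding card by (simp only: of_nat_eq_iff)
qed

end

lemma border_in_rank_mats_col:
  fixes B :: "nat \<Rightarrow> nat \<Rightarrow> 'a::{finite,field}"
  assumes B: "B \<in> sym_mats n" and y: "y \<in> vecs n"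
  shows "border n B (mat_vec n B y) \<beta> \<in> rank_mats (Suc n) k \<longleftrightarrow>
    B \<in> rank_mats n (if \<beta> = dot n (mat_vec n B y) y then k else k - 1)"
proof -
  have "border n B (mat_vec n B y) \<beta> \<in> sym_mats (Suc n)"
    using border_in_sym_mats[OF B mat_vec_in_vecs[OF B]] .
  moreover have "real CARD('a) \<noteq> 0" by simp
  ultimately show ?thesis
    using B by (simp add: rank_mats_def ker_card_border_col[OF B y] power_int_diff field_simps)
qed

lemma border_zero:
  assumes "B \<in> sym_mats n"
  shows "border n B (\<lambda>_. 0) 0 = B"
proof (intro ext)
  fix i j
  have "B i j = 0" if "i = Suc n \<or> j = Suc n"
    using assms that unfolding sym_mats_def mem_Collect_eq
    by (metis atLeastAtMost_iff not_less_eq_eq order_refl)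
  then show "border n B (\<lambda>_. 0) 0 i j = B i j"
    by (auto simp: border_def)
qed

lemma zero_in_vecs: "(\<lambda>_. 0) \<in> vecs n"
  by (simp add: vecs_def)

lemma mat_vec_zero [simp]: "mat_vec n B (\<lambda>_. 0) = (\<lambda>_. 0)"
  by (simp add: mat_vec_def fun_eq_iff)

text \<open>A zero border is the column \<open>B 0\<close> with the corner that keeps the rank. This
  compares the rank of one and the same function in sizes n and n + 1.\<close>

lemma rank_mats_Suc_iff:
  fixes B :: "nat \<Rightarrow> nat \<Rightarrow> 'a::{finite,field}"
  assumes "B \<in> sym_mats n"
  shows "B \<in> rank_mats (Suc n) k \<longleftrightarrow> B \<in> rank_mats n k"
  using border_in_rank_mats_col[OF assms zero_in_vecs, of 0 k] by (simp add: border_zero[OF assms])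

lemma sym_mats_mono:
  fixes B :: "nat \<Rightarrow> nat \<Rightarrow> 'a::{finite,field}"
  assumes "B \<in> sym_mats n"
  shows "B \<in> sym_mats (Suc n)"
  using assms by (auto simp: sym_mats_def)

lemma trace_prod_border:
  fixes A :: "nat \<Rightarrow> nat \<Rightarrow> 'a::comm_ring"
  shows "trace_prod (Suc n) A (border n B b \<beta>)
    = trace_prod n A B + dot n (\<lambda>i. A i (Suc n) + A (Suc n) i) b + A (Suc n) (Suc n) * \<beta>"
proof -
  have "trace_prod n A (border n B b \<beta>) = trace_prod n A B"
    unfolding trace_prod_def by (intro sum.cong refl) (auto simp: border_def)
  moreover have "(\<Sum>i = 1..n. A i (Suc n) * border n B b \<beta> (Suc n) i)
      = (\<Sum>i = 1..n. A i (Suc n) * b i)"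
    "(\<Sum>i = 1..n. A (Suc n) i * border n B b \<beta> i (Suc n)) = (\<Sum>i = 1..n. A (Suc n) i * b i)"
    by (intro sum.cong refl; auto simp: border_def)+
  ultimately show ?thesis
    by (simp add: trace_prod_def dot_def sum.distrib distrib_right border_def)
qed

lemma trace_prod_Suc:
  fixes A :: "nat \<Rightarrow> nat \<Rightarrow> 'a::comm_ring"
  assumes "B \<in> sym_mats n"
  shows "trace_prod (Suc n) A B = trace_prod n A B"
  using trace_prod_border[of n A B "\<lambda>_. 0" 0] by (simp add: border_zero[OF assms])

lemma dot_mat_vec_border:
  fixes B :: "nat \<Rightarrow> nat \<Rightarrow> 'a::comm_ring_1"
  shows "dot (Suc n) (x(Suc n := t)) (mat_vec (Suc n) (border n B b \<beta>) (x(Suc n := t)))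
    = dot n x (mat_vec n B x) + dot n b x * (2 * t) + \<beta> * t\<^sup>2"
proof -
  have "dot n (x(Suc n := t)) (\<lambda>i. if i = Suc n then dot n b x + \<beta> * t else mat_vec n B x i + b i
      * t)
      = dot n x (\<lambda>i. mat_vec n B x i + t * b i)"
    by (rule dot_cong) (auto simp: mult.commute)
  also have "\<dots> = dot n x (mat_vec n B x) + t * dot n b x"
    unfolding dot_add_scale dot_commute[of n x b] ..
  finally show ?thesis
    unfolding mat_vec_border dot_Suc by (simp add: algebra_simps power2_eq_square)
qed

lemma dot_mat_vec_add_scale:
  fixes B :: "nat \<Rightarrow> nat \<Rightarrow> 'a::comm_ring_1"
  assumes B: "B \<in> sym_mats n"
  shows "dot n (\<lambda>i. x i + c * y i) (mat_vec n B (\<lambda>i. x i + c * y i))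
    = dot n x (mat_vec n B x) + dot n (mat_vec n B y) x * (2 * c) + dot n (mat_vec n B y) y * c\<^sup>2"
proof -
  have 1: "dot n y (mat_vec n B x) = dot n (mat_vec n B y) x"
    using dot_mat_vec[OF B] .
  have 2: "dot n x (mat_vec n B y) = dot n (mat_vec n B y) x"
    using dot_commute .
  have 3: "dot n (\<lambda>i. x i + c * y i) z = dot n x z + c * dot n y z" for z
    using dot_add_scale[of n z x c y] by (simp add: dot_commute)
  show ?thesis
    unfolding mat_vec_add_scale dot_add_scale 3 1 2 dot_commute[of n y "mat_vec n B y"]
    by (simp add: algebra_simps power2_eq_square)
qed

context nontrivial_character
begin

lemma q_nonzero [simp]: "q \<noteq> 0"
  using of_nat_CARD zero_less_card_finite by (metis of_nat_eq_0_iff less_irrefl)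

lemma border_in_rank_mats_not_col:
  fixes B :: "nat \<Rightarrow> nat \<Rightarrow> 'a"
  assumes B: "B \<in> sym_mats n" and b: "b \<in> vecs n" "b \<notin> col_space n B"
  shows "border n B b \<beta> \<in> rank_mats (Suc n) k \<longleftrightarrow> B \<in> rank_mats n (k - 2)"
proof -
  have "border n B b \<beta> \<in> sym_mats (Suc n)"
    using border_in_sym_mats[OF B b(1)] .
  moreover have "real CARD('a) \<noteq> 0" by simp
  moreover have "real (ker_card n B) = real (ker_card (Suc n) (border n B b \<beta>)) * real CARD('a)"
    using ker_card_border_not_col[OF B b, of \<beta>] by (metis of_nat_mult)
  ultimately show ?thesis
    using B by (simp add: rank_mats_def power_int_diff field_simps power2_eq_square)
qed

lemma card_col_space_rank:
  fixes B :: "nat \<Rightarrow> nat \<Rightarrow> 'a"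
  assumes "B \<in> rank_mats n k"
  shows "of_nat (card (col_space n B)) = q powi k"
proof -
  have "real (ker_card n B) * real CARD('a) powi k
      = real (ker_card n B) * real (card (col_space n B))"
    using assms card_col_space[of n B] by (simp add: rank_mats_def flip: of_nat_mult of_nat_power)
  then have "real CARD('a) powi k = real (card (col_space n B))"
    using ker_card_pos[of n B] by simp
  then have "of_real (real (card (col_space n B))) = (of_real (real CARD('a) powi k) :: complex)"
    by simp
  then show ?thesis by simp
qed

section \<open>Bordering recursions\<close>

text \<open>The average \<Omega> for the matrix \<open>B\<close>. The division by
  \<open>q ^ n\<close> makes it insensitive to zero borders (\<open>avg_chi_Suc\<close>).\<close>

definition avg_chi :: "nat \<Rightarrow> (nat \<Rightarrow> nat \<Rightarrow> 'a) \<Rightarrow> complex" where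
  "avg_chi n B = (\<Sum>x\<in>vecs n. \<chi> (dot n x (mat_vec n B x))) / q ^ n"

text \<open>For this corner the bordered form at (x, t) equals the form of \<open>B\<close> at
  \<open>x + t * y\<close>, so the sum over x does not depend on t.\<close>

lemma avg_chi_border_col:
  assumes B: "B \<in> sym_mats n" and y: "y \<in> vecs n"
  shows "avg_chi (Suc n) (border n B (mat_vec n B y) (dot n (mat_vec n B y) y)) = avg_chi n B"
proof -
  let ?f = "\<lambda>x. \<chi> (dot n x (mat_vec n B x))"
  have "(\<Sum>x\<in>vecs n. \<Sum>t\<in>UNIV. ?f (\<lambda>i. x i + t * y i)) = (\<Sum>t\<in>UNIV. \<Sum>x\<in>vecs n. ?f (\<lambda>i. x i + t * y i))"
    by (rule sum.swap)
  also have "\<dots> = (\<Sum>t\<in>(UNIV :: 'a set). \<Sum>x\<in>vecs n. ?f x)"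
    by (intro sum.cong refl sum.reindex_bij_betw[OF bij_betw_vecs_shift[OF y]])
  finally show ?thesis
    unfolding avg_chi_def sum_vecs_Suc dot_mat_vec_border dot_mat_vec_add_scale[OF B]
    by (simp add: field_simps)
qed

lemma avg_chi_Suc:
  assumes "B \<in> sym_mats n"
  shows "avg_chi (Suc n) B = avg_chi n B"
  using avg_chi_border_col[OF assms zero_in_vecs] by (simp add: border_zero[OF assms])

text \<open>Summing \<open>\<chi> (\<beta> * t\<^sup>2)\<close> over \<beta> leaves only
  \<open>t = 0\<close>, and the resulting factor q cancels the extra one in the denominator.\<close>

lemma sum_avg_chi_border:
  "(\<Sum>\<beta>\<in>UNIV. avg_chi (Suc n) (border n B b \<beta>)) = avg_chi n B"
proof -
  let ?f = "\<lambda>x t. \<chi> (dot n x (mat_vec n B x) + dot n b x * (2 * t))"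
  have "(\<Sum>\<beta>\<in>UNIV. \<Sum>x\<in>vecs n. \<Sum>t\<in>UNIV.
           \<chi> (dot n x (mat_vec n B x) + dot n b x * (2 * t) + \<beta> * t\<^sup>2))
      = (\<Sum>x\<in>vecs n. \<Sum>t\<in>UNIV. \<Sum>\<beta>\<in>UNIV. ?f x t * \<chi> (t\<^sup>2 * \<beta>))"
    by (rule trans[OF sum.swap], rule sum.cong[OF refl], rule trans[OF sum.swap],
        (rule sum.cong[OF refl])+, simp add: chi_add mult.commute)
  also have "\<dots> = (\<Sum>x\<in>vecs n. \<Sum>t\<in>UNIV. ?f x t * (\<Sum>\<beta>\<in>UNIV. \<chi> (t\<^sup>2 * \<beta>)))"
    by (simp only: sum_distrib_left)
  also have "\<dots> = (\<Sum>x\<in>vecs n. \<Sum>t\<in>(UNIV :: 'a set).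
      if t = 0 then \<chi> (dot n x (mat_vec n B x)) * q else 0)"
    by (intro sum.cong refl) (simp add: sum_chi_mult)
  also have "\<dots> = q * (\<Sum>x\<in>vecs n. \<chi> (dot n x (mat_vec n B x)))"
    by (simp add: sum_distrib_left mult.commute)
  finally show ?thesis
    unfolding avg_chi_def sum_vecs_Suc dot_mat_vec_border
    by (simp flip: sum_divide_distrib)
qed

text \<open>Weights that depend on the column alone suffice, since the matrices A of the
  applications have corner 0.\<close>

lemma sum_border_rank:
  fixes h :: "(nat \<Rightarrow> 'a) \<Rightarrow> complex"
  assumes B: "B \<in> sym_mats n"
  shows "(\<Sum>b\<in>vecs n. \<Sum>\<beta>\<in>UNIV. of_bool (border n B b \<beta> \<in> rank_mats (Suc n) k) * h b)
    = (\<Sum>b\<in>col_space n B. h b)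
        * (of_bool (B \<in> rank_mats n k) + (q - 1) * of_bool (B \<in> rank_mats n (k - 1)))
      + ((\<Sum>b\<in>vecs n. h b) - (\<Sum>b\<in>col_space n B. h b)) * q * of_bool (B \<in> rank_mats n (k - 2))"
proof -
  have sub: "col_space n B \<subseteq> vecs n"
    using mat_vec_in_vecs[OF B] by (auto simp: col_space_def)
  have 1: "(\<Sum>\<beta>\<in>UNIV. of_bool (border n B b \<beta> \<in> rank_mats (Suc n) k) * h b)
      = h b * (of_bool (B \<in> rank_mats n k) + (q - 1) * of_bool (B \<in> rank_mats n (k - 1)))"
    if "b \<in> col_space n B" for b
  proof -
    from that obtain y where y: "y \<in> vecs n" "b = mat_vec n B y"
      by (auto simp: col_space_def)
    let ?z = "dot n (mat_vec n B y) y"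
    have "(\<Sum>\<beta>\<in>UNIV. of_bool (border n B b \<beta> \<in> rank_mats (Suc n) k) * h b)
      = of_bool (B \<in> rank_mats n k) * h b
        + (\<Sum>\<beta>\<in>UNIV - {?z}. of_bool (B \<in> rank_mats n (k - 1)) * h b)"
      unfolding y(2) border_in_rank_mats_col[OF B y(1)]
      by (subst sum.remove[of UNIV ?z]) auto
    also have "\<dots> = h b * (of_bool (B \<in> rank_mats n k) + (q - 1)
        * of_bool (B \<in> rank_mats n (k - 1)))"
      by (simp add: card_Diff_singleton of_nat_diff algebra_simps)
    finally show ?thesis .
  qed
  have 2: "(\<Sum>\<beta>\<in>UNIV. of_bool (border n B b \<beta> \<in> rank_mats (Suc n) k) * h b)
      = h b * q * of_bool (B \<in> rank_mats n (k - 2))"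
    if "b \<in> vecs n - col_space n B" for b
    using that by (simp add: border_in_rank_mats_not_col[OF B])
  have "(\<Sum>b\<in>vecs n. \<Sum>\<beta>\<in>UNIV. of_bool (border n B b \<beta> \<in> rank_mats (Suc n) k) * h b)
    = (\<Sum>b\<in>col_space n B. h b * (of_bool (B \<in> rank_mats n k) + (q - 1)
        * of_bool (B \<in> rank_mats n (k - 1))))
      + (\<Sum>b\<in>vecs n - col_space n B. h b * q * of_bool (B \<in> rank_mats n (k - 2)))"
    unfolding sum.subset_diff[OF sub finite_vecs] add.commute[of "sum _ (vecs n - _)"]
    using 1 2 by (intro arg_cong2[where f = "(+)"] sum.cong refl)
  also have "\<dots> = (\<Sum>b\<in>col_space n B. h b) * (of_bool (B \<in> rank_mats n k) + (q - 1)
      * of_bool (B \<in> rank_mats n (k - 1)))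
      + (\<Sum>b\<in>vecs n - col_space n B. h b) * q * of_bool (B \<in> rank_mats n (k - 2))"
    by (simp only: sum_distrib_right)
  finally show ?thesis
    unfolding sum_diff[OF finite_vecs sub] .
qed

lemma sum_border_rank_avg:
  fixes h :: "(nat \<Rightarrow> 'a) \<Rightarrow> complex"
  assumes B: "B \<in> sym_mats n"
  shows "(\<Sum>b\<in>vecs n. \<Sum>\<beta>\<in>UNIV. of_bool (border n B b \<beta> \<in> rank_mats (Suc n) k)
              * avg_chi (Suc n) (border n B b \<beta>) * h b)
    = avg_chi n B * ((\<Sum>b\<in>col_space n B. h b) * of_bool (B \<in> rank_mats n k)
      + ((\<Sum>b\<in>vecs n. h b) - (\<Sum>b\<in>col_space n B. h b)) * of_bool (B \<in> rank_mats n (k - 2)))"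
proof -
  have sub: "col_space n B \<subseteq> vecs n"
    using mat_vec_in_vecs[OF B] by (auto simp: col_space_def)
  let ?a = "\<lambda>b \<beta>. avg_chi (Suc n) (border n B b \<beta>)"
  have 1: "(\<Sum>\<beta>\<in>UNIV. of_bool (border n B b \<beta> \<in> rank_mats (Suc n) k) * ?a b \<beta> * h b)
      = avg_chi n B * h b * of_bool (B \<in> rank_mats n k)"
    if "b \<in> col_space n B" for b
  proof -
    from that obtain y where y: "y \<in> vecs n" "b = mat_vec n B y"
      by (auto simp: col_space_def)
    let ?z = "dot n (mat_vec n B y) y"
    have "(\<Sum>\<beta>\<in>UNIV. ?a b \<beta>) = ?a b ?z + (\<Sum>\<beta>\<in>UNIV - {?z}. ?a b \<beta>)"
      by (rule sum.remove) auto
    \<comment> \<open>The total over all corners equals the value at \<open>?z\<close>, so the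
      corners that raise the rank by 1 cancel and no term with k - 1 remains.\<close>
    then have z: "(\<Sum>\<beta>\<in>UNIV - {?z}. ?a b \<beta>) = 0" and a: "?a b ?z = avg_chi n B"
      using sum_avg_chi_border[of n B b] avg_chi_border_col[OF B y(1)] y(2) by simp_all
    have "(\<Sum>\<beta>\<in>UNIV. of_bool (border n B b \<beta> \<in> rank_mats (Suc n) k) * ?a b \<beta> * h b)
      = of_bool (B \<in> rank_mats n k) * ?a b ?z * h b
        + (\<Sum>\<beta>\<in>UNIV - {?z}. of_bool (B \<in> rank_mats n (k - 1)) * ?a b \<beta> * h b)"
      unfolding y(2) border_in_rank_mats_col[OF B y(1)]
      by (subst sum.remove[of UNIV ?z]) auto
    also have "(\<Sum>\<beta>\<in>UNIV - {?z}. of_bool (B \<in> rank_mats n (k - 1)) * ?a b \<beta> * h b)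
        = of_bool (B \<in> rank_mats n (k - 1)) * (\<Sum>\<beta>\<in>UNIV - {?z}. ?a b \<beta>) * h b"
      by (simp only: sum_distrib_left sum_distrib_right)
    finally show ?thesis
      unfolding z a by simp
  qed
  have 2: "(\<Sum>\<beta>\<in>UNIV. of_bool (border n B b \<beta> \<in> rank_mats (Suc n) k) * ?a b \<beta> * h b)
      = avg_chi n B * h b * of_bool (B \<in> rank_mats n (k - 2))"
    if "b \<in> vecs n - col_space n B" for b
  proof -
    have "(\<Sum>\<beta>\<in>UNIV. of_bool (border n B b \<beta> \<in> rank_mats (Suc n) k) * ?a b \<beta> * h b)
      = of_bool (B \<in> rank_mats n (k - 2)) * (\<Sum>\<beta>\<in>UNIV. ?a b \<beta>) * h b"
      using that by (simp add: border_in_rank_mats_not_col[OF B] sum_distrib_left sum_distrib_right)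
    then show ?thesis
      by (simp add: sum_avg_chi_border)
  qed
  have "(\<Sum>b\<in>vecs n. \<Sum>\<beta>\<in>UNIV. of_bool (border n B b \<beta> \<in> rank_mats (Suc n) k) * ?a b \<beta> * h b)
    = (\<Sum>b\<in>col_space n B. avg_chi n B * h b * of_bool (B \<in> rank_mats n k))
      + (\<Sum>b\<in>vecs n - col_space n B. avg_chi n B * h b * of_bool (B \<in> rank_mats n (k - 2)))"
    unfolding sum.subset_diff[OF sub finite_vecs] add.commute[of "sum _ (vecs n - _)"]
    using 1 2 by (intro arg_cong2[where f = "(+)"] sum.cong refl)
  also have "\<dots> = avg_chi n B * (\<Sum>b\<in>col_space n B. h b) * of_bool (B \<in> rank_mats n k)
      + avg_chi n B * (\<Sum>b\<in>vecs n - col_space n B. h b) * of_bool (B \<in> rank_mats n (k - 2))"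
    by (simp only: sum_distrib_left sum_distrib_right)
  finally show ?thesis
    by (simp add: sum_diff[OF _ sub] algebra_simps)
qed

section \<open>Reduction of the rank sums by a radical vector or a hyperbolic plane\<close>

definition rank_sum :: "nat \<Rightarrow> int \<Rightarrow> (nat \<Rightarrow> nat \<Rightarrow> 'a) \<Rightarrow> complex" where
  "rank_sum n k A = (\<Sum>B\<in>rank_mats n k. \<chi> (trace_prod n A B))"

definition avg_sum :: "nat \<Rightarrow> int \<Rightarrow> (nat \<Rightarrow> nat \<Rightarrow> 'a) \<Rightarrow> complex" where
  "avg_sum n k A = (\<Sum>B\<in>rank_mats n k. avg_chi n B * \<chi> (trace_prod n A B))"

text \<open>Pulled back along the symmetric \<open>B\<close>, this is a full character sum with
  coefficient vector \<open>B v\<close>.\<close>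

lemma sum_col_space_chi_dot:
  assumes B: "B \<in> sym_mats n"
  shows "(\<Sum>b\<in>col_space n B. \<chi> (dot n v b))
    = of_bool (\<forall>i\<in>{1..n}. mat_vec n B v i = 0) * of_nat (card (col_space n B))"
proof -
  have "of_nat (ker_card n B) * (\<Sum>b\<in>col_space n B. \<chi> (dot n v b))
      = (\<Sum>y\<in>vecs n. \<chi> (dot n (mat_vec n B v) y))"
    by (simp add: dot_mat_vec[OF B] flip: sum_col_space)
  also have "\<dots> = of_bool (\<forall>i\<in>{1..n}. mat_vec n B v i = 0) * q ^ n"
    by (simp add: sum_chi_dot)
  also have "q ^ n = of_nat (ker_card n B) * of_nat (card (col_space n B))"
    using card_col_space[of n B] by (metis of_nat_CARD of_nat_mult of_nat_power)
  finally show ?thesis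
    using ker_card_pos[of n B] by (simp add: mult.left_commute)
qed

lemma of_bool_rank_card_col_space:
  fixes B :: "nat \<Rightarrow> nat \<Rightarrow> 'a"
  shows "of_bool (B \<in> rank_mats n k) * of_nat (card (col_space n B))
      = of_bool (B \<in> rank_mats n k) * q powi k"
  by (simp add: card_col_space_rank)

text \<open>With corner 0 in A, the character depends on the new column only through
  \<open>v\<close>. The factor \<open>z B\<close> tests \<open>B v = 0\<close>, and \<open>w\<close>
  is the sum over all columns. Two cases will be used: \<open>v = 0\<close>, and \<open>v\<close>
  supported on a single index.\<close>

lemma border_sum_eq:
  assumes A: "A (Suc n) (Suc n) = 0"
  defines "v \<equiv> \<lambda>i. A i (Suc n) + A (Suc n) i"
  defines "z \<equiv> \<lambda>B. of_bool (\<forall>i\<in>{1..n}. mat_vec n B v i = 0) :: complex"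
  defines "w \<equiv> if \<forall>i\<in>{1..n}. v i = 0 then q ^ n else 0"
  shows "rank_sum (Suc n) k A = (\<Sum>B\<in>sym_mats n. \<chi> (trace_prod n A B) *
      (z B * (of_bool (B \<in> rank_mats n k) * q powi k
              + (q - 1) * (of_bool (B \<in> rank_mats n (k - 1)) * q powi (k - 1)))
       + (w - z B * q powi (k - 2)) * q * of_bool (B \<in> rank_mats n (k - 2))))" (is ?T)
    and "avg_sum (Suc n) k A = (\<Sum>B\<in>sym_mats n. avg_chi n B * \<chi> (trace_prod n A B) *
      (z B * (of_bool (B \<in> rank_mats n k) * q powi k)
       + (w - z B * q powi (k - 2)) * of_bool (B \<in> rank_mats n (k - 2))))" (is ?U)
proof -
  have chi: "\<chi> (trace_prod (Suc n) A (border n B b \<beta>)) = \<chi> (trace_prod n A B) * \<chi> (dot n v b)"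
      for B b \<beta>
    using A by (simp add: trace_prod_border chi_add v_def)
  have w: "(\<Sum>b\<in>vecs n. \<chi> (dot n v b)) = w"
    by (simp add: sum_chi_dot w_def)
  have "rank_sum (Suc n) k A = (\<Sum>B\<in>sym_mats n. \<chi> (trace_prod n A B) *
     (\<Sum>b\<in>vecs n. \<Sum>\<beta>\<in>UNIV. of_bool (border n B b \<beta> \<in> rank_mats (Suc n) k) * \<chi> (dot n v b)))"
    unfolding rank_sum_def sum_rank_mats sum_sym_mats_Suc chi
    by (simp only: sum_distrib_left ac_simps)
  also have "\<dots> = (\<Sum>B\<in>sym_mats n. \<chi> (trace_prod n A B) *
      (z B * (of_bool (B \<in> rank_mats n k) * of_nat (card (col_space n B))
              + (q - 1) * (of_bool (B \<in> rank_mats n (k - 1)) * of_nat (card (col_space n B))))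
       + (w * of_bool (B \<in> rank_mats n (k - 2))
           - z B * (of_bool (B \<in> rank_mats n (k - 2)) * of_nat (card (col_space n B)))) * q))"
    by (intro sum.cong refl arg_cong2[where f = "(*)"])
       (simp only: sum_border_rank, simp only: sum_col_space_chi_dot w algebra_simps z_def
           mult_1_left)
  finally show ?T
    unfolding of_bool_rank_card_col_space by (simp add: algebra_simps)
  have "avg_sum (Suc n) k A = (\<Sum>B\<in>sym_mats n. \<chi> (trace_prod n A B) *
     (\<Sum>b\<in>vecs n. \<Sum>\<beta>\<in>UNIV. of_bool (border n B b \<beta> \<in> rank_mats (Suc n) k)
         * avg_chi (Suc n) (border n B b \<beta>) * \<chi> (dot n v b)))"
    unfolding avg_sum_def sum_rank_mats sum_sym_mats_Suc chi
    by (simp only: sum_distrib_left ac_simps)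
  also have "\<dots> = (\<Sum>B\<in>sym_mats n. \<chi> (trace_prod n A B) * (avg_chi n B *
      (z B * (of_bool (B \<in> rank_mats n k) * of_nat (card (col_space n B)))
       + (w * of_bool (B \<in> rank_mats n (k - 2))
           - z B * (of_bool (B \<in> rank_mats n (k - 2)) * of_nat (card (col_space n B)))))))"
    by (intro sum.cong refl arg_cong2[where f = "(*)"])
       (simp only: sum_border_rank_avg, simp only: sum_col_space_chi_dot w algebra_simps z_def)
  finally show ?U
    unfolding of_bool_rank_card_col_space by (simp add: algebra_simps)
qed

declare sum_of_bool_mult_eq [simp del] sum_mult_of_bool_eq [simp del]

text \<open>Here \<open>v = 0\<close>, so \<open>z B = 1\<close> for every \<open>B\<close> and
  \<open>w = q ^ n\<close>.\<close>

lemma radical_step: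
  assumes A: "\<And>i. i \<le> Suc n \<Longrightarrow> A i (Suc n) = 0" "\<And>i. i \<le> Suc n \<Longrightarrow> A (Suc n) i = 0"
  shows "rank_sum (Suc n) k A = q powi k * rank_sum n k A
      + (q - 1) * q powi (k - 1) * rank_sum n (k - 1) A
      + (q ^ Suc n - q powi (k - 1)) * rank_sum n (k - 2) A" (is ?T)
    and "avg_sum (Suc n) k A = q powi k * avg_sum n k A + (q ^ n - q powi (k - 2))
        * avg_sum n (k - 2) A"
    (is ?U)
proof -
  have v: "mat_vec n B (\<lambda>i. A i (Suc n) + A (Suc n) i) i = 0" for B i
    using A dot_cong[of n "B i" "B i" "\<lambda>i. A i (Suc n) + A (Suc n) i" "\<lambda>_. 0"]
    by (simp add: mat_vec_def)
  have e: "q powi (k - 2) * q = q powi (k - 1)"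
    by (simp add: power_int_diff field_simps power2_eq_square)
  have 0: "A (Suc n) (Suc n) = 0" "\<forall>i\<in>{1..n}. A i (Suc n) + A (Suc n) i = 0"
    using A by auto
  show ?T
    unfolding border_sum_eq(1)[where n = n and A = A, OF 0(1)] v
    unfolding rank_sum_def sum_rank_mats using 0(2)
    by (simp add: sum.distrib sum_distrib_left algebra_simps sum_subtractf flip: e)
  show ?U
    unfolding border_sum_eq(2)[where n = n and A = A, OF 0(1)] v
    unfolding avg_sum_def sum_rank_mats using 0(2)
    by (simp add: sum.distrib sum_distrib_left algebra_simps sum_subtractf)
qed

text \<open>Only the last index is removed by bordering. There \<open>v\<close> is \<open>c\<close>
  times the unit vector at n + 1, so \<open>w = 0\<close>, and \<open>z B\<close> is 1 exactly when
  the last column of \<open>B\<close> is 0, that is, when \<open>B\<close> already has size n. Thus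
  a single bordering removes two dimensions.\<close>

lemma hyperbolic_step:
  assumes A: "\<And>i. i \<le> n \<Longrightarrow> A i (Suc (Suc n)) = 0" "A (Suc n) (Suc (Suc n)) = c" "c \<noteq> 0"
    "\<And>i. i \<le> Suc (Suc n) \<Longrightarrow> A (Suc (Suc n)) i = 0"
    "A (Suc (Suc n)) (Suc (Suc n)) = 0"
  shows "rank_sum (Suc (Suc n)) k A = q powi k * rank_sum n k A
      + (q - 1) * q powi (k - 1) * rank_sum n (k - 1) A - q powi (k - 1)
          * rank_sum n (k - 2) A" (is ?T)
    and "avg_sum (Suc (Suc n)) k A = q powi k * avg_sum n k A - q powi (k - 2)
        * avg_sum n (k - 2) A"
    (is ?U)
proof -
  let ?N = "Suc n"
  let ?v = "\<lambda>i. A i (Suc ?N) + A (Suc ?N) i"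
  have v: "mat_vec ?N B ?v i = B i ?N * c" for B i
    using A by (simp add: mat_vec_def dot_def)
  have z: "(\<forall>i\<in>{1..?N}. mat_vec ?N B ?v i = 0) \<longleftrightarrow> B \<in> sym_mats n" if B: "B \<in> sym_mats ?N" for B
  proof -
    have "(\<forall>i\<in>{1..?N}. mat_vec ?N B ?v i = 0) \<longleftrightarrow> (\<forall>i\<in>{1..?N}. B i ?N = 0)"
      using A by (simp add: v)
    also have "\<dots> \<longleftrightarrow> (\<forall>i. B ?N i = 0)"
      using B unfolding sym_mats_def mem_Collect_eq by metis
    also have "\<dots> \<longleftrightarrow> B \<in> sym_mats n"
      using B unfolding sym_mats_def mem_Collect_eq
      by (metis atLeastAtMost_iff le_SucE not_less_eq_eq order_refl)
    finally show ?thesis .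
  qed
  have w: "\<not> (\<forall>i\<in>{1..?N}. ?v i = 0)"
    using A by (auto intro!: bexI[of _ ?N])
  have e: "q powi (k - 2) * q = q powi (k - 1)"
    by (simp add: power_int_diff field_simps power2_eq_square)
  have S: "(\<Sum>B\<in>sym_mats ?N. of_bool (\<forall>i\<in>{1..?N}. mat_vec ?N B ?v i = 0) * f B)
      = (\<Sum>B\<in>sym_mats n. f B)"
    for f :: "_ \<Rightarrow> complex"
  proof -
    have "(\<Sum>B\<in>sym_mats n. f B) = (\<Sum>B\<in>{B \<in> sym_mats ?N. B \<in> sym_mats n}. f B)"
      by (rule arg_cong[where f = "sum f"]) (use sym_mats_mono in blast)
    also have "\<dots> = (\<Sum>B\<in>sym_mats ?N. of_bool (B \<in> sym_mats n) * f B)"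
      by (simp add: sum.inter_filter of_bool_def if_distrib[of "\<lambda>c. c * _"] cong: if_cong)
    finally show ?thesis
      using z by simp
  qed
  have "rank_sum (Suc ?N) k A = (\<Sum>B\<in>sym_mats ?N. of_bool (\<forall>i\<in>{1..?N}. mat_vec ?N B ?v i = 0) *
     (\<chi> (trace_prod ?N A B) * (of_bool (B \<in> rank_mats ?N k) * q powi k
              + (q - 1) * (of_bool (B \<in> rank_mats ?N (k - 1)) * q powi (k - 1))
       - q powi (k - 2) * q * of_bool (B \<in> rank_mats ?N (k - 2)))))"
    unfolding border_sum_eq(1)[where n = ?N and A = A, OF A(5)] if_not_P[OF w]
    by (intro sum.cong refl) (simp add: algebra_simps)
  also have "\<dots> = (\<Sum>B\<in>sym_mats n. \<chi> (trace_prod n A B) * (of_bool (B \<in> rank_mats n k) * q powi k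
              + (q - 1) * (of_bool (B \<in> rank_mats n (k - 1)) * q powi (k - 1))
       - q powi (k - 2) * q * of_bool (B \<in> rank_mats n (k - 2))))"
    unfolding S by (intro sum.cong refl) (simp add: trace_prod_Suc rank_mats_Suc_iff)
  finally show ?T
    unfolding rank_sum_def sum_rank_mats e
    by (simp add: sum.distrib sum_distrib_left algebra_simps sum_subtractf)
  have "avg_sum (Suc ?N) k A = (\<Sum>B\<in>sym_mats ?N. of_bool (\<forall>i\<in>{1..?N}. mat_vec ?N B ?v i = 0) *
     (avg_chi ?N B * \<chi> (trace_prod ?N A B) * (of_bool (B \<in> rank_mats ?N k) * q powi k
       - q powi (k - 2) * of_bool (B \<in> rank_mats ?N (k - 2)))))"
    unfolding border_sum_eq(2)[where n = ?N and A = A, OF A(5)] if_not_P[OF w]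
    by (intro sum.cong refl) (simp add: algebra_simps)
  also have "\<dots> = (\<Sum>B\<in>sym_mats n. avg_chi n B * \<chi> (trace_prod n A B)
      * (of_bool (B \<in> rank_mats n k) * q powi k
       - q powi (k - 2) * of_bool (B \<in> rank_mats n (k - 2))))"
    unfolding S by (intro sum.cong refl) (simp add: trace_prod_Suc rank_mats_Suc_iff avg_chi_Suc)
  finally show ?U
    unfolding avg_sum_def sum_rank_mats
    by (simp add: sum.distrib sum_distrib_left algebra_simps sum_subtractf)
qed

end

section \<open>Binary forms over finite fields\<close>

lemma two_eq_0_iff_uminus: "(2 :: 'a::field) = 0 \<longleftrightarrow> (\<forall>x :: 'a. - x = x)"
proof
  assume "(2 :: 'a) = 0"
  then have "x + x = 0" for x :: 'a by (metis mult_2 mult_zero_left)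
  then show "\<forall>x :: 'a. - x = x" by (simp add: neg_eq_iff_add_eq_0)
next
  assume "\<forall>x :: 'a. - x = x"
  then have "- 1 = (1 :: 'a)" by blast
  then show "(2 :: 'a) = 0" by (simp add: neg_eq_iff_add_eq_0)
qed

text \<open>Squaring is two-to-one on the nonzero elements, and 0 is a square of its own.\<close>

lemma card_squares:
  assumes "(2 :: 'a::{finite,field}) \<noteq> 0"
  shows "CARD('a) + 1 = 2 * card (range (\<lambda>x :: 'a. x\<^sup>2))"
proof -
  let ?S = "(\<lambda>x :: 'a. x\<^sup>2) ` (UNIV - {0})"
  have fib: "card {x \<in> UNIV - {0}. x\<^sup>2 = y} = 2" if "y \<in> ?S" for y :: 'a
  proof -
    from that obtain z where z: "z \<noteq> 0" "y = z\<^sup>2" by auto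
    have "z + z \<noteq> 0" using z assms by (metis mult_2 mult_eq_0_iff)
    then have "z \<noteq> - z" by (simp add: eq_neg_iff_add_eq_0)
    moreover have "{x \<in> UNIV - {0}. x\<^sup>2 = y} = {z, - z}"
      using z by (auto simp: power2_eq_iff)
    ultimately show ?thesis by simp
  qed
  have "CARD('a) - 1 = (\<Sum>x\<in>UNIV - {0 :: 'a}. 1)"
    by (simp add: card_Diff_singleton)
  also have "\<dots> = (\<Sum>y\<in>?S. \<Sum>x\<in>{x \<in> UNIV - {0 :: 'a}. x\<^sup>2 = y}. 1)"
    by (rule sum.image_gen) simp
  also have "\<dots> = 2 * card ?S"
    using fib by simp
  finally have nz: "CARD('a) - 1 = 2 * card ?S" .
  have "range (\<lambda>x :: 'a. x\<^sup>2) = insert 0 ?S"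
    by (auto simp: image_iff)
  moreover have "0 \<notin> ?S" by auto
  ultimately have "card (range (\<lambda>x :: 'a. x\<^sup>2)) = Suc (card ?S)"
    by (metis card_insert_disjoint finite)
  moreover have "CARD('a) > 0" by simp
  ultimately show ?thesis using nz by linarith
qed

lemma CHAR_eq_2:
  assumes "(2 :: 'a::field) = 0"
  shows "CHAR('a) = 2"
proof -
  have "of_nat 2 = (0 :: 'a)" using assms by simp
  then have "CHAR('a) dvd 2" by (simp only: of_nat_eq_0_iff_char_dvd)
  then have "CHAR('a) = 1 \<or> CHAR('a) = 2"
    using two_is_prime_nat prime_nat_iff by blast
  then show ?thesis by simp
qed

text \<open>If 2 is nonzero, \<open>card_squares\<close> makes q odd; if 2 = 0, the characteristic 2
  divides q.\<close>

lemma even_CARD_iff: "even CARD('a::{finite,field}) \<longleftrightarrow> (2 :: 'a) = 0"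
proof
  assume "even CARD('a)"
  show "(2 :: 'a) = 0"
  proof (rule ccontr)
    assume "(2 :: 'a) \<noteq> 0"
    from card_squares[OF this] \<open>even CARD('a)\<close> show False by presburger
  qed
next
  assume "(2 :: 'a) = 0"
  then show "even CARD('a)"
    using CHAR_dvd_CARD[where 'a = 'a] by (simp add: CHAR_eq_2)
qed

lemma bij_square:
  assumes "(2 :: 'a::{finite,field}) = 0"
  shows "bij (\<lambda>x :: 'a. x\<^sup>2)"
proof -
  have "inj (\<lambda>x :: 'a. x\<^sup>2)"
  proof (rule injI)
    fix x y :: 'a assume "x\<^sup>2 = y\<^sup>2"
    moreover have "- y = y" using assms two_eq_0_iff_uminus by blast
    ultimately show "x = y" by (simp add: power2_eq_iff)
  qed
  then show ?thesis
    by (simp add: bij_def finite_UNIV_inj_surj)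
qed

text \<open>The sets of values of \<open>a x\<^sup>2\<close> and of \<open>c - b y\<^sup>2\<close> both have \<open>(q + 1) / 2\<close> elements,
  so they meet.\<close>

lemma ex_sum_two_squares:
  fixes a b c :: "'a::{finite,field}"
  assumes 2: "(2 :: 'a) \<noteq> 0" and ab: "a \<noteq> 0" "b \<noteq> 0"
  obtains x y where "a * x\<^sup>2 + b * y\<^sup>2 = c"
proof -
  let ?S = "range (\<lambda>x :: 'a. x\<^sup>2)"
  let ?A = "(\<lambda>z. a * z) ` ?S" and ?B = "(\<lambda>z. c - b * z) ` ?S"
  have "card ?A = card ?S" "card ?B = card ?S"
    using ab by (auto intro!: card_image inj_onI)
  moreover have "card (?A \<union> ?B) \<le> CARD('a)"
    by (intro card_mono) auto
  moreover have "card ?A + card ?B = card (?A \<union> ?B) + card (?A \<inter> ?B)"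
    by (rule card_Un_Int) auto
  ultimately have "card (?A \<inter> ?B) > 0"
    using card_squares[OF 2] by linarith
  then have "?A \<inter> ?B \<noteq> {}"
    by (metis card.empty less_irrefl)
  then obtain x y where "a * x\<^sup>2 = c - b * y\<^sup>2" by auto
  then have "a * x\<^sup>2 + b * y\<^sup>2 = c" by simp
  then show ?thesis using that by blast
qed

lemma norm_anisotropic:
  fixes eta :: "'a::field"
  assumes "\<nexists>x. eta = x\<^sup>2" "x\<^sup>2 - eta * y\<^sup>2 = 0"
  shows "x = 0 \<and> y = 0"
proof -
  have "y = 0"
  proof (rule ccontr)
    assume "y \<noteq> 0"
    then have "eta = (x / y)\<^sup>2" using assms(2) by (simp add: power_divide field_simps)
    then show False using assms(1) by blast
  qed
  then show ?thesis using assms(2) by simp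
qed

text \<open>The form \<open>x\<^sup>2 - \<eta> y\<^sup>2\<close> is multiplicative and represents every nonzero \<open>t\<close>; multiplying by
  a vector of norm \<open>t\<close> shows that it takes all nonzero values equally often.\<close>

lemma sum_norm_values:
  fixes eta :: "'a::{finite,field}" and f :: "'a \<Rightarrow> complex"
  assumes 2: "(2 :: 'a) \<noteq> 0" and eta: "\<nexists>x. eta = x\<^sup>2"
  shows "(\<Sum>x\<in>UNIV. \<Sum>y\<in>UNIV. f (x\<^sup>2 - eta * y\<^sup>2))
    = f 0 + (of_nat CARD('a) + 1) * (\<Sum>t\<in>UNIV - {0}. f t)"
proof -
  define N where "N = (\<lambda>(x, y). x\<^sup>2 - eta * y\<^sup>2)"
  have N0: "N v = 0 \<longleftrightarrow> v = (0, 0)" for v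
    using norm_anisotropic[OF eta] by (auto simp: N_def split: prod.splits)
  have eta0: "eta \<noteq> 0" using eta by (metis zero_power2)
  have card_fib: "card {v. N v = t} = card {v. N v = 1}" if t: "t \<noteq> 0" for t
  proof -
    obtain z w where zw: "1 * z\<^sup>2 + (- eta) * w\<^sup>2 = t"
      using ex_sum_two_squares[OF 2, of 1 "- eta" t] eta0 by auto
    define m where "m = (\<lambda>(x, y). (x * z + eta * y * w, x * w + y * z))"
    have mult: "N (m v) = t * N v" for v
      unfolding N_def m_def zw[symmetric] by (cases v) (simp add: power2_eq_square algebra_simps)
    have "inj m"
    proof (rule injI)
      fix v v' assume eq: "m v = m v'"
      obtain x y x' y' where v: "v = (x, y)" "v' = (x', y')" by (metis surj_pair)
      have "m (x - x', y - y') = (0, 0)"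
        using eq by (auto simp: v m_def algebra_simps)
      then have "N (x - x', y - y') = 0"
        using mult[of "(x - x', y - y')"] t by (simp add: N_def)
      then show "v = v'"
        unfolding N0 by (simp add: v)
    qed
    then have "bij m" by (simp add: bij_def finite_UNIV_inj_surj)
    have "m ` {v. N v = 1} = {v. N v = t}"
    proof (intro subset_antisym subsetI)
      fix v assume v: "v \<in> {v. N v = t}"
      obtain u where u: "v = m u" using \<open>bij m\<close> by (metis bij_pointE)
      then show "v \<in> m ` {v. N v = 1}"
        using v mult[of u] t by auto
    qed (auto simp: mult)
    then show ?thesis
      using \<open>inj m\<close> by (metis card_image inj_on_subset subset_UNIV)
  qed
  define n where "n = card {v. N v = 1}"
  have sum: "(\<Sum>x\<in>UNIV. \<Sum>y\<in>UNIV. g (x\<^sup>2 - eta * y\<^sup>2)) = g 0 + of_nat n * (\<Sum>t\<in>UNIV - {0}. g t)"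
    for g :: "'a \<Rightarrow> complex"
  proof -
    have "(\<Sum>x\<in>UNIV. \<Sum>y\<in>UNIV. g (x\<^sup>2 - eta * y\<^sup>2)) = (\<Sum>v\<in>UNIV. g (N v))"
      by (simp add: sum.cartesian_product N_def case_prod_unfold)
    also have "\<dots> = (\<Sum>t\<in>UNIV. \<Sum>v\<in>{v \<in> UNIV. N v = t}. g (N v))"
      by (rule sum.group [symmetric]) auto
    also have "\<dots> = (\<Sum>t\<in>UNIV. of_nat (card {v. N v = t}) * g t)"
      by simp
    also have "\<dots> = of_nat (card {v. N v = 0}) * g 0
        + (\<Sum>t\<in>UNIV - {0}. of_nat (card {v. N v = t}) * g t)"
      by (rule sum.remove) auto
    also have "(\<Sum>t\<in>UNIV - {0}. of_nat (card {v. N v = t}) * g t) = of_nat n * (\<Sum>t\<in>UNIV - {0}. g t)"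
    proof -
      have "(\<Sum>t\<in>UNIV - {0}. of_nat (card {v. N v = t}) * g t) = (\<Sum>t\<in>UNIV - {0}. of_nat n * g t)"
        unfolding n_def by (intro sum.cong refl arg_cong2[where f = "(*)"]
            arg_cong[where f = of_nat] card_fib) simp
      then show ?thesis by (simp only: sum_distrib_left)
    qed
    also have "{v. N v = 0} = {(0, 0)}"
      using N0 by auto
    finally show ?thesis by simp
  qed
  \<comment> \<open>The constant function 1 counts all q^2 pairs, which determines
    \<open>n\<close>.\<close>
  have "of_nat (CARD('a) * CARD('a)) = (of_nat (1 + n * (CARD('a) - 1)) :: complex)"
    using sum[of "\<lambda>_. 1"] by (simp add: card_Diff_singleton)
  then have "CARD('a) * CARD('a) = 1 + n * (CARD('a) - 1)"
    by (simp only: of_nat_eq_iff)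
  moreover have "CARD('a) \<ge> 2"
    using card_mono[of UNIV "{0, 1 :: 'a}"] by simp
  then obtain p where p: "CARD('a) = Suc (Suc p)"
    by (metis Suc_le_D Suc_1 le_Suc_ex add_2_eq_Suc)
  ultimately have "(p + 3) * (p + 1) = n * (p + 1)"
    by (simp add: algebra_simps)
  then have "n = p + 3"
    by (metis Suc_eq_plus1 mult_cancel2 nat.distinct(1))
  then have "n = CARD('a) + 1"
    using p by simp
  then show ?thesis
    using sum[of f] by simp
qed

lemma CARD_ge_2: "CARD('a::{finite,field}) \<ge> 2"
  using card_mono[of UNIV "{0, 1 :: 'a}"] by simp

text \<open>\<open>N\<^sub>1 + N\<^sub>2\<close> is the number of points of a nondegenerate conic.\<close>

lemma conic_count_odd:
  fixes eta c :: "'a::{finite,field}"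
  assumes 2: "(2 :: 'a) \<noteq> 0" and eta: "\<nexists>x. eta = x\<^sup>2" and c: "c \<noteq> 0"
  shows "(\<Sum>y\<in>UNIV. of_nat (card {x. x\<^sup>2 + c * (1 - eta * y\<^sup>2) = 0}))
      + of_nat (card {x. x\<^sup>2 + c * (- eta) = 0})
    = (of_nat CARD('a) + 1 :: complex)"
proof -
  \<comment> \<open>\<open>f t\<close> counts the points of the conic above the value t of the norm
    form. It does not change when t is multiplied by a nonzero square, and this permits a second
    evaluation of the double sum.\<close>
  define f where "f t = (of_nat (card {x. x\<^sup>2 + c * t = 0}) :: complex)" for t
  have scale: "f (s\<^sup>2 * t) = f t" if s: "s \<noteq> 0" for s t
  proof -
    have "bij_betw (\<lambda>x. s * x) {x. x\<^sup>2 + c * t = 0} {x. x\<^sup>2 + c * (s\<^sup>2 * t) = 0}"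
    proof (rule bij_betw_byWitness[where f' = "\<lambda>x. x / s"])
      have e: "(s * x)\<^sup>2 + c * (s\<^sup>2 * t) = s\<^sup>2 * (x\<^sup>2 + c * t)" for x
        by (simp add: algebra_simps)
      show "(\<lambda>x. s * x) ` {x. x\<^sup>2 + c * t = 0} \<subseteq> {x. x\<^sup>2 + c * (s\<^sup>2 * t) = 0}"
        using e by auto
      show "(\<lambda>x. x / s) ` {x. x\<^sup>2 + c * (s\<^sup>2 * t) = 0} \<subseteq> {x. x\<^sup>2 + c * t = 0}"
        using e[of "_ / s"] s by auto
    qed (use s in auto)
    then show ?thesis
      by (simp add: f_def bij_betw_same_card)
  qed
  let ?q = "of_nat CARD('a) :: complex"
  have f_sum: "(\<Sum>t\<in>UNIV. f t) = ?q"
  proof -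
    have "(\<Sum>t\<in>UNIV. f t) = (\<Sum>t\<in>UNIV. \<Sum>x\<in>{x \<in> UNIV. - x\<^sup>2 / c = t}. 1)"
      unfolding f_def using c
      by (intro sum.cong refl) (simp add: field_simps eq_neg_iff_add_eq_0 neg_eq_iff_add_eq_0
          add.commute)
    also have "\<dots> = (\<Sum>x\<in>(UNIV :: 'a set). 1)"
      by (rule sum.group) auto
    finally show ?thesis by simp
  qed
  have f0: "f 0 = 1"
    by (simp add: f_def)
  then have f_sum': "(\<Sum>t\<in>UNIV - {0}. f t) = ?q - 1"
    using f_sum by (simp add: sum_diff1)
  \<comment> \<open>By homogeneity each x \<noteq> 0 contributes as much as x = 1, and for x = 0
    each y \<noteq> 0 as much as y = 1. Apart from the origin, the points of
    \<open>X\<^sup>2 + c * (Z\<^sup>2 - eta * Y\<^sup>2) = 0\<close> are thus counted q - 1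
    times.\<close>
  have "(\<Sum>x\<in>UNIV. \<Sum>y\<in>UNIV. f (x\<^sup>2 - eta * y\<^sup>2))
      = (\<Sum>y\<in>UNIV. f (y\<^sup>2 * (- eta))) + (\<Sum>x\<in>UNIV - {0}. \<Sum>y\<in>UNIV. f (x\<^sup>2 - eta * y\<^sup>2))"
    by (subst sum.remove[of UNIV 0]) (simp_all add: mult.commute)
  also have "(\<Sum>y\<in>UNIV. f (y\<^sup>2 * (- eta))) = f 0 + (\<Sum>y\<in>UNIV - {0 :: 'a}. f (y\<^sup>2 * (- eta)))"
    by (subst sum.remove[of UNIV 0]) simp_all
  also have "(\<Sum>y\<in>UNIV - {0 :: 'a}. f (y\<^sup>2 * (- eta))) = (\<Sum>y\<in>UNIV - {0 :: 'a}. f (- eta))"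
    by (intro sum.cong refl scale) simp
  also have "(\<Sum>x\<in>UNIV - {0}. \<Sum>y\<in>UNIV. f (x\<^sup>2 - eta * y\<^sup>2))
      = (\<Sum>x\<in>UNIV - {0 :: 'a}. \<Sum>y\<in>UNIV. f (1 - eta * y\<^sup>2))"
  proof (rule sum.cong[OF refl])
    fix x :: 'a assume "x \<in> UNIV - {0}"
    then have x: "x \<noteq> 0" by simp
    have "bij (\<lambda>y. x * y)"
      by (rule bij_betw_byWitness[where f' = "\<lambda>y. y / x"]) (use x in auto)
    then have "(\<Sum>y\<in>UNIV. f (x\<^sup>2 - eta * y\<^sup>2)) = (\<Sum>y\<in>UNIV. f (x\<^sup>2 - eta * (x * y)\<^sup>2))"
      by (rule sum.reindex_bij_betw[symmetric])
    also have "\<dots> = (\<Sum>y\<in>UNIV. f (x\<^sup>2 * (1 - eta * y\<^sup>2)))"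
      by (simp add: algebra_simps power_mult_distrib)
    finally show "(\<Sum>y\<in>UNIV. f (x\<^sup>2 - eta * y\<^sup>2)) = (\<Sum>y\<in>UNIV. f (1 - eta * y\<^sup>2))"
      by (simp only: scale[OF x])
  qed
  finally have "f 0 + (?q - 1) * f (- eta) + (?q - 1) * (\<Sum>y\<in>UNIV. f (1 - eta * y\<^sup>2))
      = f 0 + (?q + 1) * (?q - 1)"
    unfolding sum_norm_values[OF 2 eta] f_sum' by (simp add: card_Diff_singleton of_nat_diff)
  then have "(?q - 1) * (f (- eta) + (\<Sum>y\<in>UNIV. f (1 - eta * y\<^sup>2))) = (?q - 1) * (?q + 1)"
    by (simp add: algebra_simps)
  moreover have "?q - 1 \<noteq> 0"
    using CARD_ge_2[where 'a = 'a] by (metis eq_iff_diff_eq_0 of_nat_1 of_nat_eq_iff one_neq_zero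
        Suc_1 not_less_eq_eq order_refl)
  ultimately have "f (- eta) + (\<Sum>y\<in>UNIV. f (1 - eta * y\<^sup>2)) = ?q + 1"
    by (metis mult_cancel_left)
  then show ?thesis
    by (simp add: f_def add.commute)
qed

section \<open>Fields of characteristic 2 and the absolute trace\<close>

lemma card_square_eq_char_2:
  assumes "(2 :: 'a::{finite,field}) = 0"
  shows "card {x :: 'a. x\<^sup>2 + t = 0} = 1"
proof -
  obtain z where "z\<^sup>2 = - t" using bij_square[OF assms] by (metis bij_pointE)
  moreover have "x = z" if "x\<^sup>2 = z\<^sup>2" for x
    using that bij_square[OF assms] by (metis (mono_tags, lifting) bij_pointE)
  moreover have "x\<^sup>2 + t = 0 \<longleftrightarrow> x\<^sup>2 = - t" for x
    by (rule eq_neg_iff_add_eq_0 [symmetric])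
  ultimately have "x\<^sup>2 + t = 0 \<longleftrightarrow> x = z" for x
    by metis
  then show ?thesis by simp
qed

text \<open>An additively closed set of 2-power size that is as large as possible must be the whole
  field, as adjoining a translate would double it. The exponent is the one that
  \<open>abs_trace\<close> describes.\<close>

lemma CARD_power_of_2:
  assumes "(2 :: 'a::{finite,field}) = 0"
  obtains e where "CARD('a) = 2 ^ e"
proof -
  have add_self: "x + x = 0" for x :: 'a
    using assms by (metis mult_2 mult_zero_left)
  let ?P = "\<lambda>H :: 'a set. 0 \<in> H \<and> (\<forall>x\<in>H. \<forall>y\<in>H. x + y \<in> H) \<and> (\<exists>e. card H = 2 ^ e)"
  have "?P {0}" by (auto intro!: exI[of _ 0])
  then have "Collect ?P \<noteq> {}" by blast
  then have "Max (card ` Collect ?P) \<in> card ` Collect ?P"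
    by (intro Max_in) auto
  then obtain H where card_H: "Max (card ` Collect ?P) = card H" and "H \<in> Collect ?P"
    by (rule imageE)
  then have H: "?P H" by blast
  have max: "card H' \<le> card H" if "?P H'" for H'
    unfolding card_H[symmetric] by (rule Max_ge, rule finite_imageI, rule finite, rule imageI, use
        that in blast)
  have "H = UNIV"
  proof (rule ccontr)
    assume "H \<noteq> UNIV"
    then obtain z where z: "z \<notin> H" by blast
    let ?H = "H \<union> (\<lambda>x. z + x) ` H"
    have "(z + x) + x = z" for x
      using add_self by (simp add: add.assoc)
    then have "x \<notin> H \<or> z + x \<notin> H" for x
      using H z by metis
    then have disj: "H \<inter> (\<lambda>x. z + x) ` H = {}"
      using H z by auto
    have c: "card ?H = 2 * card H"
      using card_Un_disjoint[OF _ _ disj] by (simp add: card_image mult_2)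
    have "?P ?H"
    proof (intro conjI ballI)
      fix x y assume "x \<in> ?H" "y \<in> ?H"
      then obtain u v where uv: "u \<in> H" "v \<in> H" "x = u \<or> x = z + u" "y = v \<or> y = z + v"
        by blast
      have "z + u + (z + v) = u + v" "z + u + v = z + (u + v)" "u + (z + v) = z + (u + v)"
        using add_self[of z] by (simp_all add: algebra_simps)
      moreover have "u + v \<in> H" using H uv by blast
      ultimately show "x + y \<in> ?H"
        using uv(3,4) by (metis UnI1 UnI2 imageI)
    next
      obtain e where "card H = 2 ^ e" using H by blast
      then show "\<exists>e. card ?H = 2 ^ e"
        using c by (intro exI[of _ "Suc e"]) simp
    qed (use H in auto)
    from max[OF this] show False
      using c H by auto
  qed
  then show ?thesis using H that by auto
qed

text \<open>Multiplication by a nonzero \<open>x\<close> permutes the nonzero elements, whose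
  product cancels.\<close>

lemma power_CARD_eq: "x ^ CARD('a) = x" for x :: "'a::{finite,field}"
proof (cases "x = 0")
  case False
  let ?U = "UNIV - {0 :: 'a}"
  have "bij_betw (\<lambda>y. x * y) ?U ?U"
    by (rule bij_betw_byWitness[where f' = "\<lambda>y. y / x"]) (use False in auto)
  then have "(\<Prod>y\<in>?U. y) = (\<Prod>y\<in>?U. x * y)"
    by (rule prod.reindex_bij_betw[symmetric])
  also have "\<dots> = x ^ card ?U * (\<Prod>y\<in>?U. y)"
    by (simp add: prod.distrib)
  finally have "x ^ card ?U = 1" by simp
  moreover have "CARD('a) = Suc (card ?U)"
    using card_Suc_Diff1[of UNIV "0 :: 'a"] by (metis UNIV_I finite)
  ultimately show ?thesis by (simp only: power_Suc mult_1_right)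
qed simp

text \<open>If \<open>\<lambda> = x\<^sup>2 + x\<close> in characteristic 2, then the trace of \<open>\<lambda>\<close> telescopes to \<open>x\<^sup>q + x = 0\<close>.\<close>

lemma trace_one_anisotropic:
  fixes lam :: "'a::{finite,field}"
  assumes 2: "(2 :: 'a) = 0" and lam: "abs_trace lam = 1" and 0: "x\<^sup>2 + x * y + lam * y\<^sup>2 = 0"
  shows "x = 0 \<and> y = 0"
proof -
  have neg: "- z = z" for z :: 'a using 2 two_eq_0_iff_uminus by blast
  have no_root: "z\<^sup>2 + z + lam \<noteq> 0" for z
  proof
    assume "z\<^sup>2 + z + lam = 0"
    then have l: "lam = z\<^sup>2 - z" using neg by (metis add.commute add_eq_0_iff diff_conv_add_uminus
        minus_diff_eq)
    have char: "CHAR('a) = 2" using CHAR_eq_2[OF 2] .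
    obtain e where e: "CARD('a) = 2 ^ e" using CARD_power_of_2[OF 2] .
    then have "(THE e. CARD('a) = CHAR('a) ^ e) = e"
      by (intro the_equality) (simp_all add: char)
    then have "abs_trace lam = (\<Sum>i<e. lam ^ (2 ^ i))"
      by (simp add: abs_trace_def char)
    also have "\<dots> = (\<Sum>i<e. z ^ (2 ^ Suc i) - z ^ (2 ^ i))"
    proof (intro sum.cong refl)
      fix i
      show "lam ^ (2 ^ i) = z ^ (2 ^ Suc i) - z ^ (2 ^ i)"
      proof (induction i)
        case (Suc i)
        have sq: "w ^ (2 ^ Suc j) = (w ^ (2 ^ j))\<^sup>2" for w :: 'a and j
          by (simp only: power_Suc mult.commute[of 2] power_mult)
        have "lam ^ (2 ^ Suc i) = (z ^ (2 ^ Suc i) - z ^ (2 ^ i))\<^sup>2"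
          unfolding sq[of lam] Suc ..
        also have "\<dots> = (z ^ (2 ^ Suc i))\<^sup>2 + (z ^ (2 ^ i))\<^sup>2"
          using 2 by (simp add: power2_diff)
        also have "\<dots> = (z ^ (2 ^ Suc i))\<^sup>2 - (z ^ (2 ^ i))\<^sup>2"
          using neg[of "(z ^ (2 ^ i))\<^sup>2"] by (metis diff_conv_add_uminus)
        finally show ?case by (simp only: sq[symmetric])
      qed (simp add: l)
    qed
    also have "\<dots> = z ^ (2 ^ e) - z"
      by (subst sum_lessThan_telescope) simp
    also have "\<dots> = 0"
      using power_CARD_eq[of z] e by simp
    finally show False using lam by simp
  qed
  have "y = 0"
  proof (rule ccontr)
    assume "y \<noteq> 0"
    then have "(x / y)\<^sup>2 + x / y + lam = (x\<^sup>2 + x * y + lam * y\<^sup>2) / y\<^sup>2"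
      by (simp add: field_simps power2_eq_square)
    then show False using no_root 0 by simp
  qed
  then show ?thesis using 0 by simp
qed

text \<open>The symmetric matrix with rows (\<alpha>, \<beta>) and (\<beta>, \<gamma>), built by two
  borderings so that the rank criteria for bordered matrices apply.\<close>

definition mat2 :: "'a::zero \<Rightarrow> 'a \<Rightarrow> 'a \<Rightarrow> nat \<Rightarrow> nat \<Rightarrow> 'a" where
  "mat2 \<alpha> \<beta> \<gamma> = border 1 (border 0 (\<lambda>_ _. 0) (\<lambda>_. 0) \<alpha>) ((\<lambda>_. 0)(1 := \<beta>)) \<gamma>"

lemma sum_sym_mats_1: "(\<Sum>B\<in>sym_mats 1. f B) = (\<Sum>\<alpha>\<in>UNIV. f (border 0 (\<lambda>_ _. 0) (\<lambda>_. 0) \<alpha>))"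
  using sum_sym_mats_Suc[of f 0] by (simp add: sym_mats_0 vecs_0)

lemma sum_vecs_1: "(\<Sum>b\<in>vecs 1. f b) = (\<Sum>\<beta>\<in>UNIV. f ((\<lambda>_. 0)(1 := \<beta>)))"
  using sum_vecs_Suc[of f 0] by (simp add: vecs_0 fun_upd_def)

lemma sum_sym_mats_2: "(\<Sum>B\<in>sym_mats 2. f B) = (\<Sum>\<alpha>\<in>UNIV. \<Sum>\<beta>\<in>UNIV. \<Sum>\<gamma>\<in>UNIV. f (mat2 \<alpha> \<beta> \<gamma>))"
proof -
  have "(\<Sum>B\<in>sym_mats (Suc 1). f B)
      = (\<Sum>\<alpha>\<in>UNIV. \<Sum>\<beta>\<in>UNIV. \<Sum>\<gamma>\<in>UNIV. f (mat2 \<alpha> \<beta> \<gamma>))"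
    unfolding sum_sym_mats_Suc sum_sym_mats_1 sum_vecs_1 mat2_def ..
  then show ?thesis by (simp add: numeral_2_eq_2)
qed

lemma border_0_in_sym_mats: "border 0 (\<lambda>_ _. 0) (\<lambda>_. 0) \<alpha> \<in> sym_mats 1"
  using border_in_sym_mats[of "\<lambda>_ _. 0" 0 "\<lambda>_. 0" \<alpha>] by (simp add: sym_mats_0 vecs_0)

lemma zero_in_rank_mats_0_iff:
  "(\<lambda>_ _. 0 :: 'a::{finite,field}) \<in> rank_mats 0 k \<longleftrightarrow> k = 0"
proof -
  have "{x \<in> vecs 0. mat_vec 0 (\<lambda>_ _. 0 :: 'a) x = (\<lambda>_. 0)} = {\<lambda>_. 0}"
    by (auto simp: vecs_0)
  then have "ker_card 0 (\<lambda>_ _. 0 :: 'a) = 1"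
    by (simp add: ker_card_def)
  moreover have "real CARD('a) powi k = 1 \<longleftrightarrow> k = 0"
  proof
    assume *: "real CARD('a) powi k = 1"
    have q: "real CARD('a) > 1"
      using CARD_ge_2[where 'a = 'a] by simp
    show "k = 0"
    proof (rule ccontr)
      assume "k \<noteq> 0"
      then consider "0 < k" | "k < 0" by linarith
      then show False
      proof cases
        case 1
        then show False using power_int_strict_increasing[OF 1 q] * by simp
      next
        case 2
        then show False using power_int_strict_increasing[OF 2 q] * by simp
      qed
    qed
  qed simp
  ultimately show ?thesis
    by (simp add: rank_mats_def sym_mats_0)
qed

lemma mat_vec_border_0:
  "mat_vec 1 (border 0 (\<lambda>_ _. 0) (\<lambda>_. 0) \<alpha>) x = (\<lambda>_. 0)(1 := \<alpha> * x 1)"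
  by (auto simp: mat_vec_def dot_def border_def fun_eq_iff)

lemma border_0_in_rank_mats_iff:
  "border 0 (\<lambda>_ _. 0) (\<lambda>_. 0) \<alpha> \<in> rank_mats 1 k \<longleftrightarrow> k = (if \<alpha> = 0 then 0 else 1)"
  for \<alpha> :: "'a::{finite,field}"
  using border_in_rank_mats_col[of "\<lambda>_ _. 0" 0 "\<lambda>_. 0" \<alpha> k]
  by (simp add: sym_mats_0 vecs_0 zero_in_rank_mats_0_iff dot_def)

definition rank2 :: "'a::field \<Rightarrow> 'a \<Rightarrow> 'a \<Rightarrow> int" where
  "rank2 \<alpha> \<beta> \<gamma> = (if \<alpha> \<noteq> 0 then (if \<gamma> = \<beta>\<^sup>2 / \<alpha> then 1 else 2)
                 else if \<beta> = 0 then (if \<gamma> = 0 then 0 else 1) else 2)"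

text \<open>The matrices of rank 1 are the nonzero multiples of those with rows (1, y), (y, y^2) and
  of the one with rows (0, 0), (0, 1): one line for each point of the projective line. Rank 2 is
  reached as the difference from the total.\<close>

lemma sum_rank2:
  fixes W :: "'a::{finite,field} \<Rightarrow> 'a \<Rightarrow> 'a \<Rightarrow> 'b::comm_ring_1"
  defines "S \<equiv> \<lambda>k. \<Sum>\<alpha>\<in>UNIV. \<Sum>\<beta>\<in>UNIV. \<Sum>\<gamma>\<in>UNIV. if k = rank2 \<alpha> \<beta> \<gamma> then W \<alpha> \<beta> \<gamma> else 0"
  shows "S 0 = W 0 0 0"
    and "S 1 = (\<Sum>\<alpha>\<in>UNIV - {0}. \<Sum>y\<in>UNIV. W \<alpha> (\<alpha> * y) (\<alpha> * y\<^sup>2)) + (\<Sum>\<gamma>\<in>UNIV - {0}. W 0 0 \<gamma>)"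
    and "S 0 + S 1 + S 2 = (\<Sum>\<alpha>\<in>UNIV. \<Sum>\<beta>\<in>UNIV. \<Sum>\<gamma>\<in>UNIV. W \<alpha> \<beta> \<gamma>)"
    and "k \<notin> {0, 1, 2} \<Longrightarrow> S k = 0"
proof -
  have 0: "(if 0 = rank2 \<alpha> \<beta> \<gamma> then W \<alpha> \<beta> \<gamma> else 0)
      = (if \<gamma> = 0 then if \<beta> = 0 then if \<alpha> = 0 then W 0 0 0 else 0 else 0 else 0)" for \<alpha> \<beta> \<gamma>
    by (simp add: rank2_def)
  show "S 0 = W 0 0 0"
    unfolding S_def 0 by simp
  have a: "(\<Sum>\<beta>\<in>UNIV. \<Sum>\<gamma>\<in>UNIV. if 1 = rank2 \<alpha> \<beta> \<gamma> then W \<alpha> \<beta> \<gamma> else 0)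
      = (\<Sum>y\<in>UNIV. W \<alpha> (\<alpha> * y) (\<alpha> * y\<^sup>2))" if \<alpha>: "\<alpha> \<noteq> 0" for \<alpha>
  proof -
    have "(\<Sum>\<beta>\<in>UNIV. \<Sum>\<gamma>\<in>UNIV. if 1 = rank2 \<alpha> \<beta> \<gamma> then W \<alpha> \<beta> \<gamma> else 0)
        = (\<Sum>\<beta>\<in>UNIV. \<Sum>\<gamma>\<in>UNIV. if \<gamma> = \<beta>\<^sup>2 / \<alpha> then W \<alpha> \<beta> (\<beta>\<^sup>2 / \<alpha>) else 0)"
      using \<alpha> by (intro sum.cong refl) (simp add: rank2_def)
    also have "\<dots> = (\<Sum>\<beta>\<in>UNIV. W \<alpha> \<beta> (\<beta>\<^sup>2 / \<alpha>))"
      by simp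
    also have "\<dots> = (\<Sum>y\<in>UNIV. W \<alpha> (\<alpha> * y) ((\<alpha> * y)\<^sup>2 / \<alpha>))"
    proof (rule sum.reindex_bij_betw[symmetric])
      show "bij (\<lambda>y. \<alpha> * y)"
        by (rule bij_betw_byWitness[where f' = "\<lambda>y. y / \<alpha>"]) (use \<alpha> in auto)
    qed
    also have "\<dots> = (\<Sum>y\<in>UNIV. W \<alpha> (\<alpha> * y) (\<alpha> * y\<^sup>2))"
      using \<alpha> by (simp add: power2_eq_square mult_ac)
    finally show ?thesis .
  qed
  have "(\<Sum>\<gamma>\<in>UNIV. if 1 = rank2 0 \<beta> \<gamma> then W 0 \<beta> \<gamma> else 0)
      = (if \<beta> = 0 then \<Sum>\<gamma>\<in>UNIV - {0}. W 0 0 \<gamma> else 0)" for \<beta>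
  proof (cases "\<beta> = 0")
    case True
    have "(\<Sum>\<gamma>\<in>UNIV. if 1 = rank2 0 \<beta> \<gamma> then W 0 \<beta> \<gamma> else 0)
        = (\<Sum>\<gamma>\<in>UNIV - {0}. if 1 = rank2 0 \<beta> \<gamma> then W 0 \<beta> \<gamma> else 0)"
      using True by (subst sum.remove[of UNIV 0]) (simp_all add: rank2_def)
    then show ?thesis
      using True by (simp add: rank2_def cong: sum.cong_simp)
  qed (simp add: rank2_def)
  then have b: "(\<Sum>\<beta>\<in>UNIV. \<Sum>\<gamma>\<in>UNIV. if 1 = rank2 0 \<beta> \<gamma> then W 0 \<beta> \<gamma> else 0)
      = (\<Sum>\<gamma>\<in>UNIV - {0}. W 0 0 \<gamma>)"
    by simp
  have "S 1 = (\<Sum>\<gamma>\<in>UNIV - {0}. W 0 0 \<gamma>)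
      + (\<Sum>\<alpha>\<in>UNIV - {0}. \<Sum>\<beta>\<in>UNIV. \<Sum>\<gamma>\<in>UNIV. if 1 = rank2 \<alpha> \<beta> \<gamma> then W \<alpha> \<beta> \<gamma> else 0)"
    unfolding S_def b[symmetric] by (rule sum.remove) auto
  then show "S 1 = (\<Sum>\<alpha>\<in>UNIV - {0}. \<Sum>y\<in>UNIV. W \<alpha> (\<alpha> * y) (\<alpha> * y\<^sup>2)) + (\<Sum>\<gamma>\<in>UNIV - {0}. W 0 0 \<gamma>)"
    using a by (simp add: add.commute cong: sum.cong_simp)
  have r: "rank2 \<alpha> \<beta> \<gamma> \<in> {0, 1, 2}" for \<alpha> \<beta> \<gamma> :: 'a
    by (simp add: rank2_def)
  have "W \<alpha> \<beta> \<gamma> = (if 0 = rank2 \<alpha> \<beta> \<gamma> then W \<alpha> \<beta> \<gamma> else 0)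
      + (if 1 = rank2 \<alpha> \<beta> \<gamma> then W \<alpha> \<beta> \<gamma> else 0)
      + (if 2 = rank2 \<alpha> \<beta> \<gamma> then W \<alpha> \<beta> \<gamma> else 0)" for \<alpha> \<beta> \<gamma>
    using r[of \<alpha> \<beta> \<gamma>] by auto
  then show "S 0 + S 1 + S 2 = (\<Sum>\<alpha>\<in>UNIV. \<Sum>\<beta>\<in>UNIV. \<Sum>\<gamma>\<in>UNIV. W \<alpha> \<beta> \<gamma>)"
    unfolding S_def by (simp only: sum.distrib[symmetric])
  show "S k = 0" if "k \<notin> {0, 1, 2}"
  proof -
    have "k \<noteq> rank2 \<alpha> \<beta> \<gamma>" for \<alpha> \<beta> \<gamma> :: 'a
      using r[of \<alpha> \<beta> \<gamma>] that by metis
    then show ?thesis by (simp add: S_def)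
  qed
qed

lemma sum_swap_inner:
  fixes f :: "'a \<Rightarrow> 'b \<Rightarrow> 'c \<Rightarrow> 'd \<Rightarrow> 'e::comm_monoid_add"
  shows "(\<Sum>a\<in>A. \<Sum>b\<in>B. \<Sum>c\<in>C. \<Sum>d\<in>D. f a b c d) = (\<Sum>d\<in>D. \<Sum>a\<in>A. \<Sum>b\<in>B. \<Sum>c\<in>C. f a b c d)"
  by (simp only: sum.swap[where B = D])

section \<open>Character sums over symmetric matrices of size 2\<close>

context nontrivial_character
begin

lemma mat2_in_rank_mats_iff: "mat2 \<alpha> \<beta> \<gamma> \<in> rank_mats 2 k \<longleftrightarrow> k = rank2 \<alpha> \<beta> \<gamma>"
  for \<alpha> :: 'a
proof -
  let ?B = "border 0 (\<lambda>_ _. 0) (\<lambda>_. 0) \<alpha>"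
  let ?b = "\<lambda>\<beta>. (\<lambda>_ :: nat. 0 :: 'a)(1 := \<beta>)"
  have v: "?b y \<in> vecs 1" for y by (auto simp: vecs_def)
  note col = border_in_rank_mats_col[OF border_0_in_sym_mats v, of \<alpha> _ \<gamma> k]
  have 2: "2 = Suc 1" by simp
  show ?thesis
  proof (cases "\<alpha> = 0 \<and> \<beta> \<noteq> 0")
    case True
    have "?b \<beta> \<notin> col_space 1 ?B"
    proof
      assume "?b \<beta> \<in> col_space 1 ?B"
      then obtain x where "?b \<beta> = mat_vec 1 ?B x"
        by (auto simp: col_space_def)
      then have "?b \<beta> = ?b (\<alpha> * x 1)"
        by (simp only: mat_vec_border_0)
      from fun_cong[OF this, of 1] show False using True by simp
    qed
    from border_in_rank_mats_not_col[OF border_0_in_sym_mats v this, of \<gamma> k]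
    show ?thesis
      using True unfolding mat2_def 2 border_0_in_rank_mats_iff by (auto simp: rank2_def)
  next
    case False
    define y where "y = (if \<alpha> = 0 then 0 else \<beta> / \<alpha>)"
    have *: "mat_vec 1 ?B (?b y) = ?b \<beta>"
      unfolding mat_vec_border_0 using False by (simp add: y_def)
    have "dot 1 (?b \<beta>) (?b y) = (if \<alpha> = 0 then 0 else \<beta>\<^sup>2 / \<alpha>)"
      by (simp add: dot_def y_def power2_eq_square)
    then show ?thesis
      using col[of y] False unfolding mat2_def 2 * border_0_in_rank_mats_iff
      by (auto simp: rank2_def power2_eq_square)
  qed
qed

lemma trace_prod_mat2: "trace_prod 2 A (mat2 \<alpha> \<beta> \<gamma>) = A 1 1 * \<alpha> + (A 1 2 + A 2 1) * \<beta> + A 2 2 * \<gamma>"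
  for \<alpha> :: 'a
proof -
  have "trace_prod (Suc 1) A (mat2 \<alpha> \<beta> \<gamma>) = A 1 1 * \<alpha> + (A 1 2 + A 2 1) * \<beta> + A 2 2 * \<gamma>"
    unfolding mat2_def trace_prod_border
    by (simp add: trace_prod_def border_def dot_def numeral_2_eq_2)
  then show ?thesis by (simp add: numeral_2_eq_2)
qed

lemma avg_chi_mat2:
  "avg_chi 2 (mat2 \<alpha> \<beta> \<gamma>)
     = (\<Sum>x\<in>UNIV. \<Sum>t\<in>UNIV. \<chi> (x\<^sup>2 * \<alpha> + 2 * x * t * \<beta> + t\<^sup>2 * \<gamma>)) / q\<^sup>2"
proof -
  have "avg_chi (Suc 1) (mat2 \<alpha> \<beta> \<gamma>)
     = (\<Sum>x\<in>UNIV. \<Sum>t\<in>UNIV. \<chi> (x\<^sup>2 * \<alpha> + 2 * x * t * \<beta> + t\<^sup>2 * \<gamma>)) / q\<^sup>2"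
    unfolding avg_chi_def sum_vecs_Suc mat2_def dot_mat_vec_border sum_vecs_1 mat_vec_border_0
    by (simp add: dot_def power2_eq_square algebra_simps)
  then show ?thesis by (simp add: numeral_2_eq_2)
qed

lemma sum_chi_nonzero: "(\<Sum>\<alpha>\<in>UNIV - {0}. \<chi> (a * \<alpha>)) = (if a = 0 then q else 0) - 1"
  using sum_chi_mult[of a] by (simp add: sum_diff1)

lemma rank_sum_2:
  "rank_sum 2 k A = (\<Sum>\<alpha>\<in>UNIV. \<Sum>\<beta>\<in>UNIV. \<Sum>\<gamma>\<in>UNIV. if k = rank2 \<alpha> \<beta> \<gamma>
     then \<chi> (A 1 1 * \<alpha> + (A 1 2 + A 2 1) * \<beta> + A 2 2 * \<gamma>) else 0)"
  unfolding rank_sum_def sum_rank_mats sum_sym_mats_2 mat2_in_rank_mats_iff trace_prod_mat2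
  by (intro sum.cong refl) simp

lemma avg_sum_2:
  "avg_sum 2 k A = (\<Sum>\<alpha>\<in>UNIV. \<Sum>\<beta>\<in>UNIV. \<Sum>\<gamma>\<in>UNIV. if k = rank2 \<alpha> \<beta> \<gamma>
     then avg_chi 2 (mat2 \<alpha> \<beta> \<gamma>) * \<chi> (A 1 1 * \<alpha> + (A 1 2 + A 2 1) * \<beta> + A 2 2 * \<gamma>) else 0)"
  unfolding avg_sum_def sum_rank_mats sum_sym_mats_2 mat2_in_rank_mats_iff trace_prod_mat2
  by (intro sum.cong refl) simp

lemma sum_chi_triple:
  "(\<Sum>\<alpha>\<in>UNIV. \<Sum>\<beta>\<in>UNIV. \<Sum>\<gamma>\<in>UNIV. \<chi> (a * \<alpha> + b * \<beta> + d * \<gamma>))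
     = (if a = 0 \<and> b = 0 \<and> d = 0 then q ^ 3 else 0)"
proof -
  have "(\<Sum>\<alpha>\<in>UNIV. \<Sum>\<beta>\<in>UNIV. \<Sum>\<gamma>\<in>UNIV. \<chi> (a * \<alpha> + b * \<beta> + d * \<gamma>))
      = (\<Sum>\<alpha>\<in>UNIV. \<chi> (a * \<alpha>)) * (\<Sum>\<beta>\<in>UNIV. \<chi> (b * \<beta>)) * (\<Sum>\<gamma>\<in>UNIV. \<chi> (d * \<gamma>))"
    by (simp add: chi_add mult.assoc flip: sum_distrib_left sum_distrib_right)
  then show ?thesis
    by (simp add: sum_chi_mult power3_eq_cube)
qed

text \<open>The form is nonzero at each of the q + 1 points of the projective line, so each line of
  rank 1 matrices contributes -1. The sum over all ranks is 0 because \<open>A 1 1\<close> is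
  nonzero.\<close>

lemma rank_sum_anisotropic:
  assumes A: "A 2 1 = 0"
    and an: "\<And>x y. A 1 1 * x\<^sup>2 + A 1 2 * (x * y) + A 2 2 * y\<^sup>2 = 0 \<Longrightarrow> x = 0 \<and> y = 0"
  shows "rank_sum 2 k A = (if k = 0 then 1 else if k = 1 then - (q + 1) else
      if k = 2 then q else 0)"
proof -
  note S = sum_rank2[where W = "\<lambda>\<alpha> \<beta> \<gamma>. \<chi> (A 1 1 * \<alpha> + (A 1 2 + A 2 1) * \<beta> + A 2 2 * \<gamma>)",
    folded rank_sum_2]
  have 0: "rank_sum 2 0 A = 1"
    unfolding S(1) by simp
  have "(\<Sum>\<alpha>\<in>UNIV - {0}. \<Sum>y\<in>UNIV. \<chi> (A 1 1 * \<alpha> + (A 1 2 + A 2 1) * (\<alpha> * y) + A 2 2 * (\<alpha> * y\<^sup>2)))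
      = (\<Sum>y\<in>UNIV. \<Sum>\<alpha>\<in>UNIV - {0}. \<chi> ((A 1 1 * 1\<^sup>2 + A 1 2 * (1 * y) + A 2 2 * y\<^sup>2) * \<alpha>))"
    by (subst sum.swap) (simp add: A[unfolded One_nat_def] algebra_simps)
  also have "\<dots> = (\<Sum>y\<in>(UNIV :: 'a set). - 1)"
    unfolding sum_chi_nonzero using an[of 1] by (intro sum.cong refl) auto
  also have "\<dots> = - q" by simp
  finally have a: "(\<Sum>\<alpha>\<in>UNIV - {0}. \<Sum>y\<in>UNIV. \<chi>
      (A 1 1 * \<alpha> + (A 1 2 + A 2 1) * (\<alpha> * y) + A 2 2 * (\<alpha> * y\<^sup>2)))
      = - q" .
  have 1: "rank_sum 2 1 A = - (q + 1)"
    unfolding S(2) a using an[of 0 1] by (auto simp: sum_chi_nonzero)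
  have "rank_sum 2 0 A + rank_sum 2 1 A + rank_sum 2 2 A = 0"
    unfolding S(3) sum_chi_triple using an[of 1 0] by auto
  then have "rank_sum 2 2 A = q"
    using 0 1 by (simp add: algebra_simps)
  then show ?thesis
    using 0 1 S(4)[of k] by auto
qed

text \<open>At a projective point where the form has value t, the rank 1 matrices contribute the
  number of roots of \<open>x\<^sup>2 + t = 0\<close> minus 1. So \<open>count\<close>, which says
  that a conic has q + 1 points, makes rank 1 disappear. By \<open>nonzero\<close> the form is not
  minus the square of a linear form, which makes the sum over all ranks 0.\<close>

lemma avg_sum_anisotropic:
  assumes A: "A 2 1 = 0"
    and nonzero: "\<And>x y. \<not> (A 1 1 + x\<^sup>2 = 0 \<and> A 1 2 + 2 * x * y = 0 \<and> A 2 2 + y\<^sup>2 = 0)"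
    and count: "(\<Sum>y\<in>UNIV. of_nat (card {x. x\<^sup>2 + (A 1 1 + A 1 2 * y + A 2 2 * y\<^sup>2) = 0}))
      + of_nat (card {x. x\<^sup>2 + A 2 2 = 0}) = q + 1"
  shows "avg_sum 2 k A = (if k = 0 then 1 else if k = 2 then - 1 else 0)"
proof -
  note S = sum_rank2[where W = "\<lambda>\<alpha> \<beta> \<gamma>. avg_chi 2 (mat2 \<alpha> \<beta> \<gamma>)
      * \<chi> (A 1 1 * \<alpha> + (A 1 2 + A 2 1) * \<beta> + A 2 2 * \<gamma>)", folded avg_sum_2]
  have 0: "avg_sum 2 0 A = 1"
    unfolding S(1) by (simp add: avg_chi_mat2 power2_eq_square)
  \<comment> \<open>On a matrix of rank 1 the shear \<open>x + t * y\<close> reduces \<Omega> to an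
    average over one variable.\<close>
  have square: "avg_chi 2 (mat2 \<alpha> (\<alpha> * y) (\<alpha> * y\<^sup>2)) = (\<Sum>x\<in>UNIV. \<chi> (x\<^sup>2 * \<alpha>)) / q" for \<alpha> y
  proof -
    have "(\<Sum>x\<in>UNIV. \<Sum>t\<in>UNIV. \<chi> (x\<^sup>2 * \<alpha> + 2 * x * t * (\<alpha> * y) + t\<^sup>2 * (\<alpha> * y\<^sup>2)))
        = (\<Sum>t\<in>UNIV. \<Sum>x\<in>UNIV. \<chi> ((x + t * y)\<^sup>2 * \<alpha>))"
      by (subst sum.swap) (simp add: power2_eq_square algebra_simps)
    also have "\<dots> = (\<Sum>t\<in>(UNIV :: 'a set). \<Sum>x\<in>UNIV. \<chi> (x\<^sup>2 * \<alpha>))"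
    proof (rule sum.cong[OF refl], rule sum.reindex_bij_betw)
      show "bij (\<lambda>x. x + t * y)" for t
        by (rule bij_betw_byWitness[where f' = "\<lambda>x. x - t * y"]) auto
    qed
    finally show ?thesis
      by (simp add: avg_chi_mat2 power2_eq_square)
  qed
  have square0: "avg_chi 2 (mat2 0 0 \<gamma>) = (\<Sum>x\<in>UNIV. \<chi> (x\<^sup>2 * \<gamma>)) / q" for \<gamma>
    by (simp add: avg_chi_mat2 power2_eq_square)
  have line: "(\<Sum>\<alpha>\<in>UNIV - {0}. (\<Sum>x\<in>UNIV. \<chi> (x\<^sup>2 * \<alpha>)) / q * \<chi> (t * \<alpha>))
      = of_nat (card {x. x\<^sup>2 + t = 0}) - 1" for t
  proof -
    have "(\<Sum>\<alpha>\<in>UNIV - {0}. (\<Sum>x\<in>UNIV. \<chi> (x\<^sup>2 * \<alpha>)) / q * \<chi> (t * \<alpha>))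
        = (\<Sum>\<alpha>\<in>UNIV - {0}. \<Sum>x\<in>UNIV. \<chi> ((x\<^sup>2 + t) * \<alpha>)) / q"
      by (simp add: sum_divide_distrib sum_distrib_right chi_add distrib_right)
    also have "\<dots> = (\<Sum>x\<in>UNIV. (if x\<^sup>2 + t = 0 then q else 0) - 1) / q"
      by (subst sum.swap) (simp only: sum_chi_nonzero)
    also have "\<dots> = of_nat (card {x. x\<^sup>2 + t = 0}) - 1"
      by (simp add: sum_subtractf sum.If_cases diff_divide_distrib)
    finally show ?thesis .
  qed
  have "avg_sum 2 1 A = (\<Sum>y\<in>UNIV. \<Sum>\<alpha>\<in>UNIV - {0}. (\<Sum>x\<in>UNIV. \<chi> (x\<^sup>2 * \<alpha>)) / q
        * \<chi> ((A 1 1 + A 1 2 * y + A 2 2 * y\<^sup>2) * \<alpha>))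
      + (\<Sum>\<gamma>\<in>UNIV - {0}. (\<Sum>x\<in>UNIV. \<chi> (x\<^sup>2 * \<gamma>)) / q * \<chi> (A 2 2 * \<gamma>))"
    unfolding S(2) square square0
    by (subst sum.swap) (simp add: A[unfolded One_nat_def] algebra_simps)
  also have "\<dots> = 0"
    unfolding line using count by (simp add: sum_subtractf algebra_simps)
  finally have 1: "avg_sum 2 1 A = 0" .
  \<comment> \<open>Written out, \<Omega> adds to the form given by A the square of the linear form
    with coefficients (x, t), and \<open>sum_chi_triple\<close> applies for each (x, t).\<close>
  have "(\<Sum>\<alpha>\<in>UNIV. \<Sum>\<beta>\<in>UNIV. \<Sum>\<gamma>\<in>UNIV. avg_chi 2 (mat2 \<alpha> \<beta> \<gamma>)
          * \<chi> (A 1 1 * \<alpha> + (A 1 2 + A 2 1) * \<beta> + A 2 2 * \<gamma>))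
      = (\<Sum>\<alpha>\<in>UNIV. \<Sum>\<beta>\<in>UNIV. \<Sum>\<gamma>\<in>UNIV. \<Sum>x\<in>UNIV. \<Sum>t\<in>UNIV.
          \<chi> ((A 1 1 + x\<^sup>2) * \<alpha> + (A 1 2 + 2 * x * t) * \<beta> + (A 2 2 + t\<^sup>2) * \<gamma>)) / q\<^sup>2"
  proof -
    have "avg_chi 2 (mat2 \<alpha> \<beta> \<gamma>) * \<chi> (A 1 1 * \<alpha> + (A 1 2 + A 2 1) * \<beta> + A 2 2 * \<gamma>)
        = (\<Sum>x\<in>UNIV. \<Sum>t\<in>UNIV.
            \<chi> ((A 1 1 + x\<^sup>2) * \<alpha> + (A 1 2 + 2 * x * t) * \<beta> + (A 2 2 + t\<^sup>2) * \<gamma>)) / q\<^sup>2"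
      for \<alpha> \<beta> \<gamma>
      unfolding avg_chi_mat2 times_divide_eq_left sum_distrib_right chi_add[symmetric] A
      by (simp add: algebra_simps)
    then show ?thesis
      by (simp only: sum_divide_distrib)
  qed
  also have "(\<Sum>\<alpha>\<in>UNIV. \<Sum>\<beta>\<in>UNIV. \<Sum>\<gamma>\<in>UNIV. \<Sum>x\<in>UNIV. \<Sum>t\<in>UNIV.
          \<chi> ((A 1 1 + x\<^sup>2) * \<alpha> + (A 1 2 + 2 * x * t) * \<beta> + (A 2 2 + t\<^sup>2) * \<gamma>))
      = (\<Sum>x\<in>UNIV. \<Sum>t\<in>UNIV. \<Sum>\<alpha>\<in>UNIV. \<Sum>\<beta>\<in>UNIV. \<Sum>\<gamma>\<in>UNIV.
          \<chi> ((A 1 1 + x\<^sup>2) * \<alpha> + (A 1 2 + 2 * x * t) * \<beta> + (A 2 2 + t\<^sup>2) * \<gamma>))"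
    by (subst sum_swap_inner, rule sum.cong[OF refl], rule sum_swap_inner)
  also have "\<dots> = 0"
    unfolding sum_chi_triple by (intro sum.neutral ballI if_not_P nonzero)
  finally have "avg_sum 2 0 A + avg_sum 2 1 A + avg_sum 2 2 A = 0"
    unfolding S(3) by simp
  then have "avg_sum 2 2 A = - 1"
    using 0 1 by (simp add: add_eq_0_iff)
  then show ?thesis
    using 0 1 S(4)[of k] by auto
qed

end

section \<open>Rank sums at the normal forms\<close>

text \<open>The values of \<open>rank_sum\<close> at a form with an anisotropic part of dimension 1 and \<open>s\<close> hyperbolic
  planes in dimension \<open>M + 1\<close>, respectively at a form of type \<open>\<tau>\<close> and rank \<open>2s + 2\<close> in dimension
  \<open>M + 2\<close>.\<close>

definition odd_value :: "nat \<Rightarrow> nat \<Rightarrow> nat \<Rightarrow> int \<Rightarrow> real" where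
  "odd_value q M s k = (if even k then 1 else - 1)
      * (real q powi (2 * (k div 2)) * F_number q (int M) (k div 2) (int s))"

definition even_value :: "nat \<Rightarrow> int \<Rightarrow> nat \<Rightarrow> nat \<Rightarrow> int \<Rightarrow> real" where
  "even_value q \<tau> M s k = (if even k
     then real q powi (2 * (k div 2)) * F_number q (int M + 1) (k div 2) (int s)
       - of_int \<tau> * real q powi (int M + 1 - int s + 2 * (k div 2) - 2)
           * F_number q (int M) (k div 2 - 1) (int s)
     else - (real q powi (2 * (k div 2)) * F_number q (int M + 1) (k div 2) (int s))
       + of_int \<tau> * real q powi (int M + 1 - int s + 2 * (k div 2))
           * F_number q (int M) (k div 2) (int s))"

lemma value_simps:
  "odd_value q M s (2 * r) = real q powi (2 * r) * F_number q (int M) r (int s)"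
  "odd_value q M s (2 * r + 1) = - (real q powi (2 * r) * F_number q (int M) r (int s))"
  "even_value q \<tau> M s (2 * r) = real q powi (2 * r) * F_number q (int M + 1) r (int s)
       - of_int \<tau> * real q powi (int M + 1 - int s + 2 * r - 2)
           * F_number q (int M) (r - 1) (int s)"
  "even_value q \<tau> M s (2 * r + 1) = - (real q powi (2 * r) * F_number q (int M + 1) r (int s))
       + of_int \<tau> * real q powi (int M + 1 - int s + 2 * r) * F_number q (int M) r (int s)"
  by (simp_all add: odd_value_def even_value_def)

text \<open>This is the recursion of \<open>hyperbolic_step\<close>. The values at 2r and 2r + 1 are
  opposite, so in either parity two of the three terms merge and the recursion of F remains.\<close>

lemma odd_value_hyperbolic:
  assumes q: "q \<ge> 2" and s: "s \<le> M div 2"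
  shows "odd_value q (M + 2) (s + 1) (k) = real q powi k * odd_value q M s (k)
    + (real q - 1) * real q powi (k - 1) * odd_value q M s (k - 1)
    - real q powi (k - 1) * odd_value q M s (k - 2)"
proof -
  have q0: "real q \<noteq> 0" using q by simp
  have F: "F_number q (int (M + 2)) r (int (s + 1))
      = real q powi (2 * r) * F_number q (int M) r (int s)
      - real q powi (2 * r - 2) * F_number q (int M) (r - 1) (int s)" for r
    using F_number_hyperbolic[OF q, of "int s" M r] s by (simp add: add.commute)
  \<comment> \<open>Every power of q involving r becomes \<open>Y r\<close> times a fixed power,
    leaving an identity that is linear in the values of F.\<close>
  define Y E where "Y r = real q powi (2 * r)" and "E = real q powi (int M + 1 - int s)" for r
  have Y: "real q powi (2 * r) = Y r" "real q powi (2 * r - 2) = Y r / (real q)\<^sup>2"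
    "real q powi (2 * r - 1) = Y r / real q" "real q powi (2 * r + 1) = Y r * real q"
    "Y (r - 1) = Y r / (real q)\<^sup>2" for r
    using q0 by (simp_all add: Y_def power_int_diff power_int_add right_diff_distrib)
  show ?thesis
  proof (cases "even k")
    case True
    then obtain r where k: "k = 2 * r" by blast
    have k': "2 * r - 1 = 2 * (r - 1) + 1" "2 * r - 2 = 2 * (r - 1)" by simp_all
    have v: "odd_value q M s (2 * r - 1) = odd_value q M s (2 * (r - 1) + 1)"
      "odd_value q M s (2 * r - 2) = odd_value q M s (2 * (r - 1))"
      by (simp_all only: k')
    have r2: "r - 1 - 1 = r - 2" by simp
    show ?thesis
      unfolding k v value_simps F Y r2
      using q0 by (simp add: field_simps power2_eq_square power_add)
  next
    case False
    then obtain r where k: "k = 2 * r + 1" by (elim oddE)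
    have k': "2 * r + 1 - 1 = 2 * r" "2 * r + 1 - 2 = 2 * (r - 1) + 1" by simp_all
    have r2: "r - 1 - 1 = r - 2" by simp
    show ?thesis
      unfolding k k' value_simps F Y r2
      using q0 by (simp add: field_simps power2_eq_square power_add)
  qed
qed

text \<open>The recursion of \<open>radical_step\<close> at n = M + 1, hence the exponent
  \<open>M + 1 + 1\<close>.\<close>

lemma odd_value_radical:
  assumes q: "q \<ge> 2" and s: "s \<le> M div 2"
  shows "odd_value q (M + 1) s (k) = real q powi k * odd_value q M s (k)
    + (real q - 1) * real q powi (k - 1) * odd_value q M s (k - 1)
    + (real q ^ (M + 1 + 1) - real q powi (k - 1)) * odd_value q M s (k - 2)"
proof -
  have q0: "real q \<noteq> 0" using q by simp
  have F: "F_number q (int (M + 1)) r (int s) = real q powi (2 * r) * F_number q (int M) r (int s)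
      + (real q ^ M - real q powi (2 * r - 2)) * F_number q (int M) (r - 1) (int s)" for r
    using F_number_radical[OF q, of "int s" M r] s by (simp add: add.commute)
  define Y E where "Y r = real q powi (2 * r)" and "E = real q powi (int M + 1 - int s)" for r
  have Y: "real q powi (2 * r) = Y r" "real q powi (2 * r - 2) = Y r / (real q)\<^sup>2"
    "real q powi (2 * r - 1) = Y r / real q" "real q powi (2 * r + 1) = Y r * real q"
    "Y (r - 1) = Y r / (real q)\<^sup>2" for r
    using q0 by (simp_all add: Y_def power_int_diff power_int_add right_diff_distrib)
  show ?thesis
  proof (cases "even k")
    case True
    then obtain r where k: "k = 2 * r" by blast
    have k': "2 * r - 1 = 2 * (r - 1) + 1" "2 * r - 2 = 2 * (r - 1)" by simp_all
    have v: "odd_value q M s (2 * r - 1) = odd_value q M s (2 * (r - 1) + 1)"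
      "odd_value q M s (2 * r - 2) = odd_value q M s (2 * (r - 1))"
      by (simp_all only: k')
    have r2: "r - 1 - 1 = r - 2" by simp
    show ?thesis
      unfolding k v value_simps F Y r2
      using q0 by (simp add: field_simps power2_eq_square power_add)
  next
    case False
    then obtain r where k: "k = 2 * r + 1" by (elim oddE)
    have k': "2 * r + 1 - 1 = 2 * r" "2 * r + 1 - 2 = 2 * (r - 1) + 1" by simp_all
    have r2: "r - 1 - 1 = r - 2" by simp
    show ?thesis
      unfolding k k' value_simps F Y r2
      using q0 by (simp add: field_simps power2_eq_square power_add)
  qed
qed

text \<open>The recursion of \<open>hyperbolic_step\<close> again. The part with \<tau> and the part
  without satisfy it separately, by the recursions of F with upper index M and M + 1.\<close>

lemma even_value_hyperbolic:
  assumes q: "q \<ge> 2" and s: "s \<le> M div 2"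
  shows "even_value q \<tau> (M + 2) (s + 1) (k) = real q powi k * even_value q \<tau> M s (k)
    + (real q - 1) * real q powi (k - 1) * even_value q \<tau> M s (k - 1)
    - real q powi (k - 1) * even_value q \<tau> M s (k - 2)"
proof -
  have q0: "real q \<noteq> 0" using q by simp
  have F: "F_number q (int (M + 2)) r (int (s + 1))
      = real q powi (2 * r) * F_number q (int M) r (int s)
      - real q powi (2 * r - 2) * F_number q (int M) (r - 1) (int s)" for r
    using F_number_hyperbolic[OF q, of "int s" M r] s by (simp add: add.commute)
  have F': "F_number q (int (M + 2) + 1) r (int (s + 1))
      = real q powi (2 * r) * F_number q (int M + 1) r (int s)
      - real q powi (2 * r - 2) * F_number q (int M + 1) (r - 1) (int s)" for r
    using F_number_hyperbolic[OF q, of "int s" "M + 1" r] s by (simp add: add_ac)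
  \<comment> \<open>\<open>E\<close> collects the power depending on M and s; raising M by 2 and s
    by 1 multiplies it by q.\<close>
  define Y E where "Y r = real q powi (2 * r)" and "E = real q powi (int M + 1 - int s)" for r
  have Y: "real q powi (2 * r) = Y r" "real q powi (2 * r - 2) = Y r / (real q)\<^sup>2"
    "real q powi (2 * r - 1) = Y r / real q" "real q powi (2 * r + 1) = Y r * real q"
    "Y (r - 1) = Y r / (real q)\<^sup>2" for r
    using q0 by (simp_all add: Y_def power_int_diff power_int_add right_diff_distrib)
  have E: "real q powi (int M + 1 - int s + 2 * r) = E * Y r" for r
    using q0 by (simp add: E_def Y_def power_int_add)
  have E2: "real q powi (int M + 1 - int s + 2 * r - 2) = E * Y r / (real q)\<^sup>2" for r
    using q0 by (simp add: E_def Y_def power_int_add power_int_diff power2_eq_square)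
  have "int (M + 2) + 1 - int (s + 1) + 2 * r = (int M + 1 - int s + 2 * r) + 1" for r by simp
  then have E': "real q powi (int (M + 2) + 1 - int (s + 1) + 2 * r) = E * Y r * real q" for r
    using q0 by (simp only: power_int_add E simp_thms) simp
  have "int (M + 2) + 1 - int (s + 1) + 2 * r - 2 = (int M + 1 - int s + 2 * r) - 1" for r by simp
  then have E'2: "real q powi (int (M + 2) + 1 - int (s + 1) + 2 * r - 2) = E * Y r / real q" for r
    using q0 by (simp only: power_int_diff E simp_thms) simp
  show ?thesis
  proof (cases "even k")
    case True
    then obtain r where k: "k = 2 * r" by blast
    have k': "2 * r - 1 = 2 * (r - 1) + 1" "2 * r - 2 = 2 * (r - 1)" by simp_all
    have v: "even_value q \<tau> M s (2 * r - 1) = even_value q \<tau> M s (2 * (r - 1) + 1)"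
      "even_value q \<tau> M s (2 * r - 2) = even_value q \<tau> M s (2 * (r - 1))"
      by (simp_all only: k')
    have r2: "r - 1 - 1 = r - 2" by simp
    show ?thesis
      unfolding k v value_simps F F' Y E E2 E' E'2 r2
      using q0 by (simp add: field_simps power2_eq_square power_add)
  next
    case False
    then obtain r where k: "k = 2 * r + 1" by (elim oddE)
    have k': "2 * r + 1 - 1 = 2 * r" "2 * r + 1 - 2 = 2 * (r - 1) + 1" by simp_all
    have r2: "r - 1 - 1 = r - 2" by simp
    show ?thesis
      unfolding k k' value_simps F F' Y E E2 E' E'2 r2
      using q0 by (simp add: field_simps power2_eq_square power_add)
  qed
qed

text \<open>The recursion of \<open>radical_step\<close> at n = M + 2; the dimension of the space
  exceeds M by the initial plane.\<close>

lemma even_value_radical: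
  assumes q: "q \<ge> 2" and s: "s \<le> M div 2"
  shows "even_value q \<tau> (M + 1) s (k) = real q powi k * even_value q \<tau> M s (k)
    + (real q - 1) * real q powi (k - 1) * even_value q \<tau> M s (k - 1)
    + (real q ^ (M + 2 + 1) - real q powi (k - 1)) * even_value q \<tau> M s (k - 2)"
proof -
  have q0: "real q \<noteq> 0" using q by simp
  have F: "F_number q (int (M + 1)) r (int s) = real q powi (2 * r) * F_number q (int M) r (int s)
      + (real q ^ M - real q powi (2 * r - 2)) * F_number q (int M) (r - 1) (int s)" for r
    using F_number_radical[OF q, of "int s" M r] s by (simp add: add.commute)
  have F': "F_number q (int (M + 1) + 1) r (int s)
      = real q powi (2 * r) * F_number q (int M + 1) r (int s)
      + (real q * real q ^ M - real q powi (2 * r - 2))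
          * F_number q (int M + 1) (r - 1) (int s)" for r
    using F_number_radical[OF q, of "int s" "M + 1" r] s by (simp add: add_ac)
  define Y E where "Y r = real q powi (2 * r)" and "E = real q powi (int M + 1 - int s)" for r
  have Y: "real q powi (2 * r) = Y r" "real q powi (2 * r - 2) = Y r / (real q)\<^sup>2"
    "real q powi (2 * r - 1) = Y r / real q" "real q powi (2 * r + 1) = Y r * real q"
    "Y (r - 1) = Y r / (real q)\<^sup>2" for r
    using q0 by (simp_all add: Y_def power_int_diff power_int_add right_diff_distrib)
  have E: "real q powi (int M + 1 - int s + 2 * r) = E * Y r" for r
    using q0 by (simp add: E_def Y_def power_int_add)
  have E2: "real q powi (int M + 1 - int s + 2 * r - 2) = E * Y r / (real q)\<^sup>2" for r
    using q0 by (simp add: E_def Y_def power_int_add power_int_diff power2_eq_square)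
  have "int (M + 1) + 1 - int s + 2 * r = (int M + 1 - int s + 2 * r) + 1" for r by simp
  then have E': "real q powi (int (M + 1) + 1 - int s + 2 * r) = E * Y r * real q" for r
    using q0 by (simp only: power_int_add E simp_thms) simp
  have "int (M + 1) + 1 - int s + 2 * r - 2 = (int M + 1 - int s + 2 * r) - 1" for r by simp
  then have E'2: "real q powi (int (M + 1) + 1 - int s + 2 * r - 2) = E * Y r / real q" for r
    using q0 by (simp only: power_int_diff E simp_thms) simp
  show ?thesis
  proof (cases "even k")
    case True
    then obtain r where k: "k = 2 * r" by blast
    have k': "2 * r - 1 = 2 * (r - 1) + 1" "2 * r - 2 = 2 * (r - 1)" by simp_all
    have v: "even_value q \<tau> M s (2 * r - 1) = even_value q \<tau> M s (2 * (r - 1) + 1)"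
      "even_value q \<tau> M s (2 * r - 2) = even_value q \<tau> M s (2 * (r - 1))"
      by (simp_all only: k')
    have r2: "r - 1 - 1 = r - 2" by simp
    show ?thesis
      unfolding k v value_simps F F' Y E E2 E' E'2 r2
      using q0 by (simp add: field_simps power2_eq_square power_add)
  next
    case False
    then obtain r where k: "k = 2 * r + 1" by (elim oddE)
    have k': "2 * r + 1 - 1 = 2 * r" "2 * r + 1 - 2 = 2 * (r - 1) + 1" by simp_all
    have r2: "r - 1 - 1 = r - 2" by simp
    show ?thesis
      unfolding k k' value_simps F F' Y E E2 E' E'2 r2
      using q0 by (simp add: field_simps power2_eq_square power_add)
  qed
qed

text \<open>The block \<open>A\<close> on \<open>{1..\<kappa>}\<close>, followed by \<open>s\<close> upper triangular hyperbolic planes with entry \<open>c\<close>.\<close>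

fun std_mat :: "nat \<Rightarrow> (nat \<Rightarrow> nat \<Rightarrow> 'a::zero) \<Rightarrow> 'a \<Rightarrow> nat \<Rightarrow> nat \<Rightarrow> nat \<Rightarrow> 'a" where
  "std_mat \<kappa> A c 0 = (\<lambda>i j. if i \<le> \<kappa> \<and> j \<le> \<kappa> then A i j else 0)"
| "std_mat \<kappa> A c (Suc s) =
     (\<lambda>i j. if i = \<kappa> + 2 * s + 1 \<and> j = \<kappa> + 2 * s + 2 then c else std_mat \<kappa> A c s i j)"

lemma std_mat_eq_0: "i > \<kappa> + 2 * s \<or> j > \<kappa> + 2 * s \<Longrightarrow> std_mat \<kappa> A c s i j = 0"
  by (induction s) auto

context nontrivial_character
begin

lemma q_eq: "q = of_real (real CARD('a))"
  by simp

lemma rank_sum_cong: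
  assumes "\<And>i j. i \<in> {1..n} \<Longrightarrow> j \<in> {1..n} \<Longrightarrow> A i j = A' i j"
  shows "rank_sum n k A = rank_sum n k A'" "avg_sum n k A = avg_sum n k A'"
proof -
  have "trace_prod n A B = trace_prod n A' B" for B
    unfolding trace_prod_def using assms by (intro sum.cong refl) auto
  then show "rank_sum n k A = rank_sum n k A'" "avg_sum n k A = avg_sum n k A'"
    unfolding rank_sum_def avg_sum_def by simp_all
qed

text \<open>Planes are adjoined first, radical vectors last. The rule \<open>cong\<close> enters
  because \<open>std_mat\<close> with one more plane agrees with the previous matrix only on the old
  indices.\<close>

lemma std_mat_induct:
  fixes P :: "nat \<Rightarrow> nat \<Rightarrow> (nat \<Rightarrow> nat \<Rightarrow> 'a) \<Rightarrow> bool"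
  assumes "c \<noteq> 0" and "\<kappa> + 2 * s \<le> m"
    and base: "P \<kappa> 0 A"
    and cong: "\<And>n s A A'. P n s A \<Longrightarrow> (\<And>i j. i \<in> {1..n} \<Longrightarrow> j \<in> {1..n} \<Longrightarrow> A i j = A' i j) \<Longrightarrow> P n s A'"
    and hyp: "\<And>n s A. P n s A \<Longrightarrow> n = \<kappa> + 2 * s \<Longrightarrow>
      (\<And>i. i \<le> n \<Longrightarrow> A i (Suc (Suc n)) = 0) \<Longrightarrow> A (Suc n) (Suc (Suc n)) = c \<Longrightarrow>
      (\<And>i. i \<le> Suc (Suc n) \<Longrightarrow> A (Suc (Suc n)) i = 0) \<Longrightarrow> P (Suc (Suc n)) (Suc s) A"
    and rad: "\<And>n s A. P n s A \<Longrightarrow> n \<ge> \<kappa> + 2 * s \<Longrightarrow>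
      (\<And>i. i \<le> Suc n \<Longrightarrow> A i (Suc n) = 0) \<Longrightarrow> (\<And>i. i \<le> Suc n \<Longrightarrow> A (Suc n) i = 0) \<Longrightarrow> P (Suc n) s A"
  shows "P m s (std_mat \<kappa> A c s)"
  using assms(2)
proof (induction m rule: dec_induct)
  case base
  show ?case
  proof (induction s)
    case 0
    then show ?case
      using cong[OF assms(3)] by simp
  next
    case (Suc s)
    have "P (Suc (Suc (\<kappa> + 2 * s))) (Suc s) (std_mat \<kappa> A c (Suc s))"
    proof (rule hyp[OF cong[OF Suc] refl])
      show "std_mat \<kappa> A c (Suc s) (Suc (Suc (\<kappa> + 2 * s))) i = 0" for i
        using std_mat_eq_0[of \<kappa> s "Suc (Suc (\<kappa> + 2 * s))" i A c] by simp
      show "std_mat \<kappa> A c (Suc s) i (Suc (Suc (\<kappa> + 2 * s))) = 0" if "i \<le> \<kappa> + 2 * s" for i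
        using that std_mat_eq_0[of \<kappa> s i "Suc (Suc (\<kappa> + 2 * s))" A c] by simp
    qed simp_all
    then show ?case by simp
  qed
next
  case (step n)
  show ?case
    by (rule rad[OF step.IH step.hyps(1)]) (use step.hyps(1) in \<open>auto intro!: std_mat_eq_0\<close>)
qed

lemma rank_sum_odd:
  assumes c: "c \<noteq> 0" and A: "A 1 1 \<noteq> 0" and m: "1 + 2 * s \<le> m"
  shows "rank_sum m k (std_mat 1 A c s) = of_real (odd_value CARD('a) (m - 1) s k)"
proof -
  let ?P = "\<lambda>m s A. \<forall>k. rank_sum m k A = of_real (odd_value CARD('a) (m - 1) s k)"
  have q2: "CARD('a) \<ge> 2" by (rule CARD_ge_2)
  have "?P m s (std_mat 1 A c s)"
  proof (rule std_mat_induct[OF c m])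
    show "?P 1 0 A"
    proof
      fix k
      have 1: "rank_sum 1 k A = (\<Sum>\<alpha>\<in>UNIV. if k
          = (if \<alpha> = 0 then 0 else 1) then \<chi> (A 1 1 * \<alpha>) else 0)"
        unfolding rank_sum_def sum_rank_mats sum_sym_mats_1 border_0_in_rank_mats_iff
        by (intro sum.cong refl) (simp add: trace_prod_def border_def)
      also have "\<dots> = (if k = 0 then 1 else 0) + (\<Sum>\<alpha>\<in>UNIV - {0}. if k = 1 then \<chi> (A 1 1 * \<alpha>) else 0)"
        by (subst sum.remove[of UNIV 0]) (auto intro!: sum.cong)
      also have "\<dots> = (if k = 0 then 1 else if k = 1 then - 1 else 0)"
        using sum_chi_nonzero[of "A 1 1"] A by auto
      also have "\<dots> = of_real (odd_value CARD('a) 0 0 k)"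
        using q2 by (auto simp: odd_value_def elim!: evenE oddE)
      finally show "rank_sum 1 k A = of_real (odd_value CARD('a) (1 - 1) 0 k)" by simp
    qed
  next
    fix n s and A :: "nat \<Rightarrow> nat \<Rightarrow> 'a"
    assume P: "?P n s A" and n: "n = 1 + 2 * s"
      and *: "\<And>i. i \<le> n \<Longrightarrow> A i (Suc (Suc n)) = 0" "A (Suc n) (Suc (Suc n)) = c"
        "\<And>i. i \<le> Suc (Suc n) \<Longrightarrow> A (Suc (Suc n)) i = 0"
    have "Suc (Suc n) - 1 = (n - 1) + 2" "Suc s = s + 1" "s \<le> (n - 1) div 2" using n by simp_all
    then show "?P (Suc (Suc n)) (Suc s) A"
      using hyperbolic_step(1)[where n = n and A = A, OF *(1,2) c *(3) *(3)[OF order.refl]] P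
          odd_value_hyperbolic[OF q2, of s "n - 1"]
      by (simp add: q_eq del: of_nat_CARD)
  next
    fix n s and A :: "nat \<Rightarrow> nat \<Rightarrow> 'a"
    assume P: "?P n s A" and n: "n \<ge> 1 + 2 * s"
      and *: "\<And>i. i \<le> Suc n \<Longrightarrow> A i (Suc n) = 0" "\<And>i. i \<le> Suc n \<Longrightarrow> A (Suc n) i = 0"
    have "Suc n - 1 = (n - 1) + 1" "n - 1 + 1 + 1 = Suc n" "s \<le> (n - 1) div 2" using n by simp_all
    then show "?P (Suc n) s A"
      using radical_step(1)[where n = n and A = A, OF *] P odd_value_radical[OF q2, of s "n - 1"]
      by (simp add: q_eq del: of_nat_CARD)
  qed (use rank_sum_cong(1) in metis)
  then show ?thesis by blast
qed

text \<open>The assumed values are those of the hyperbolic plane for \<tau> = 1 and of the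
  anisotropic plane for \<tau> = -1, so one induction treats both types.\<close>

lemma rank_sum_even:
  assumes c: "c \<noteq> 0" and m: "2 + 2 * s \<le> m"
    and A: "\<And>k. rank_sum 2 k A = (if k = 0 then 1 else if k = 1 then of_int \<tau> * q - 1
              else if k = 2 then - (of_int \<tau> * q) else 0)"
  shows "rank_sum m k (std_mat 2 A c s) = of_real (even_value CARD('a) \<tau> (m - 2) s k)"
proof -
  let ?P = "\<lambda>m s A. \<forall>k. rank_sum m k A = of_real (even_value CARD('a) \<tau> (m - 2) s k)"
  have q2: "CARD('a) \<ge> 2" by (rule CARD_ge_2)
  have "?P m s (std_mat 2 A c s)"
  proof (rule std_mat_induct[OF c m])
    show "?P 2 0 A"
    proof
      fix k
      have "(if k = 0 then 1 else if k = 1 then of_int \<tau> * real CARD('a) - 1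
              else if k = 2 then - (of_int \<tau> * real CARD('a)) else 0)
          = even_value CARD('a) \<tau> 0 0 k"
        using q2 by (auto simp: even_value_def elim!: evenE oddE)
      then have "of_real (even_value CARD('a) \<tau> 0 0 k)
          = of_real (if k = 0 then 1 else if k = 1 then of_int \<tau> * real CARD('a) - 1
              else if k = 2 then - (of_int \<tau> * real CARD('a)) else 0)"
        by simp
      then show "rank_sum 2 k A = of_real (even_value CARD('a) \<tau> (2 - 2) 0 k)"
        unfolding A by simp
    qed
  next
    fix n s and A :: "nat \<Rightarrow> nat \<Rightarrow> 'a"
    assume P: "?P n s A" and n: "n = 2 + 2 * s"
      and *: "\<And>i. i \<le> n \<Longrightarrow> A i (Suc (Suc n)) = 0" "A (Suc n) (Suc (Suc n)) = c"
        "\<And>i. i \<le> Suc (Suc n) \<Longrightarrow> A (Suc (Suc n)) i = 0"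
    have "Suc (Suc n) - 2 = (n - 2) + 2" "Suc s = s + 1" "s \<le> (n - 2) div 2" using n by simp_all
    then show "?P (Suc (Suc n)) (Suc s) A"
      using hyperbolic_step(1)[where n = n and A = A, OF *(1,2) c *(3) *(3)[OF order.refl]] P
          even_value_hyperbolic[OF q2, of s "n - 2"]
      by (simp add: q_eq del: of_nat_CARD)
  next
    fix n s and A :: "nat \<Rightarrow> nat \<Rightarrow> 'a"
    assume P: "?P n s A" and n: "n \<ge> 2 + 2 * s"
      and *: "\<And>i. i \<le> Suc n \<Longrightarrow> A i (Suc n) = 0" "\<And>i. i \<le> Suc n \<Longrightarrow> A (Suc n) i = 0"
    have "Suc n - 2 = (n - 2) + 1" "n - 2 + 2 + 1 = Suc n" "s \<le> (n - 2) div 2" using n by simp_all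
    then show "?P (Suc n) s A"
      using radical_step(1)[where n = n and A = A, OF *] P even_value_radical[OF q2, of s "n - 2"]
      by (simp add: q_eq del: of_nat_CARD)
  qed (use rank_sum_cong(1) in metis)
  then show ?thesis by blast
qed

text \<open>\<open>s0\<close> is the number of planes for which the initial block counts: 0 in
  dimension 1, and 1 in dimension 2 for both types, because the weighted sums do not see the type of
  the quadratic form.\<close>

lemma avg_sum_std_mat:
  assumes c: "c \<noteq> 0" and m: "\<kappa> + 2 * s \<le> m" and s0: "2 * s0 \<le> \<kappa>"
    and A: "\<And>r. avg_sum \<kappa> (2 * r) A = of_real (F_number CARD('a) (int \<kappa>) r (int s0))"
  shows "avg_sum m (2 * r) (std_mat \<kappa> A c s) = of_real (F_number CARD('a) (int m) r (int (s + s0)))"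
proof -
  let ?P = "\<lambda>m s A. \<forall>r. avg_sum m (2 * r) A = of_real (F_number CARD('a) (int m) r (int (s + s0)))"
  have q2: "CARD('a) \<ge> 2" by (rule CARD_ge_2)
  have "?P m s (std_mat \<kappa> A c s)"
  proof (rule std_mat_induct[OF c m])
    show "?P \<kappa> 0 A" using A by simp
  next
    fix n s and A :: "nat \<Rightarrow> nat \<Rightarrow> 'a"
    assume P: "?P n s A" and n: "n = \<kappa> + 2 * s"
      and *: "\<And>i. i \<le> n \<Longrightarrow> A i (Suc (Suc n)) = 0" "A (Suc n) (Suc (Suc n)) = c"
        "\<And>i. i \<le> Suc (Suc n) \<Longrightarrow> A (Suc (Suc n)) i = 0"
    have s: "int (s + s0) \<le> int (n div 2)" using n s0 by linarith
    show "?P (Suc (Suc n)) (Suc s) A"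
    proof
      fix r
      have "avg_sum (Suc (Suc n)) (2 * r) A = of_real
          (F_number CARD('a) (int n + 2) r (int (s + s0) + 1))"
        using P[rule_format, of r] P[rule_format, of "r - 1"]
          hyperbolic_step(2)[where n = n and A = A
              and k = "2 * r", OF *(1,2) c *(3) *(3)[OF order.refl]]
        unfolding F_number_hyperbolic[OF q2 of_nat_0_le_iff s]
        by (simp add: q_eq right_diff_distrib del: of_nat_CARD)
      then show "avg_sum (Suc (Suc n)) (2 * r) A
          = of_real (F_number CARD('a) (int (Suc (Suc n))) r (int (Suc s + s0)))"
        by (simp add: add_ac)
    qed
  next
    fix n s and A :: "nat \<Rightarrow> nat \<Rightarrow> 'a"
    assume P: "?P n s A" and n: "n \<ge> \<kappa> + 2 * s"
      and *: "\<And>i. i \<le> Suc n \<Longrightarrow> A i (Suc n) = 0" "\<And>i. i \<le> Suc n \<Longrightarrow> A (Suc n) i = 0"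
    have s: "int (s + s0) \<le> int (n div 2)" using n s0 by linarith
    show "?P (Suc n) s A"
    proof
      fix r
      have "avg_sum (Suc n) (2 * r) A = of_real (F_number CARD('a) (int n + 1) r (int (s + s0)))"
        using P[rule_format, of r] P[rule_format, of "r - 1"]
          radical_step(2)[where n = n and A = A and k = "2 * r", OF *]
        unfolding F_number_radical[OF q2 of_nat_0_le_iff s]
        by (simp add: q_eq right_diff_distrib del: of_nat_CARD)
      then show "avg_sum (Suc n) (2 * r) A = of_real
          (F_number CARD('a) (int (Suc n)) r (int (s + s0)))"
        by (simp add: add_ac)
    qed
  qed (use rank_sum_cong(2) in metis)
  then show ?thesis by blast
qed

end

section \<open>Initial blocks of dimension 1 and 2\<close>

context nontrivial_character
begin

text \<open>In size 1 only the zero matrix has even rank.\<close>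

lemma avg_sum_1: "avg_sum 1 (2 * r) A = of_real (F_number CARD('a) 1 r 0)"
proof -
  have *: "2 * r = (if \<alpha> = 0 then 0 else 1) \<longleftrightarrow> r = 0 \<and> \<alpha> = 0" for \<alpha> :: 'a
    by (auto, presburger)
  have "avg_sum 1 (2 * r) A = (\<Sum>\<alpha>\<in>(UNIV :: 'a set). if \<alpha> = 0 then of_bool (r = 0) else 0)"
    unfolding avg_sum_def sum_rank_mats sum_sym_mats_1 border_0_in_rank_mats_iff *
  proof (intro sum.cong refl)
    fix \<alpha> :: 'a
    have "avg_chi 1 (border 0 (\<lambda>_ _. 0) (\<lambda>_. 0) 0) = 1"
      by (simp add: avg_chi_def card_vecs border_def mat_vec_def [abs_def])
    moreover have "trace_prod 1 A (border 0 (\<lambda>_ _. 0) (\<lambda>_. 0) 0) = 0"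
      by (simp add: trace_prod_def border_def)
    ultimately show "of_bool (r = 0 \<and> \<alpha> = 0) * (avg_chi 1 (border 0 (\<lambda>_ _. 0) (\<lambda>_. 0) \<alpha>) *
        \<chi> (trace_prod 1 A (border 0 (\<lambda>_ _. 0) (\<lambda>_. 0) \<alpha>))) = (if \<alpha> = 0 then of_bool (r = 0) else 0)"
      by simp
  qed
  then show ?thesis
    using CARD_ge_2[where 'a = 'a] by simp
qed

lemma F_number_2_1: "F_number CARD('a) 2 r 1 = (if r = 0 then 1 else if r = 1 then - 1 else 0)"
  using F_number_hyperbolic[OF CARD_ge_2[where 'a = 'a], of 0 0 r] CARD_ge_2[where 'a = 'a] by simp

lemma hyperbolic_base:
  assumes A: "A 1 1 = 0" "A 2 1 = 0" "A 2 2 = 0" "A 1 2 \<noteq> 0"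
  shows "rank_sum 2 k A = (if k = 0 then 1 else if k = 1 then of_int 1 * q - 1
              else if k = 2 then - (of_int 1 * q) else 0)"
    and "avg_sum 2 (2 * r) A = of_real (F_number CARD('a) 2 r 1)"
proof -
  \<comment> \<open>\<open>hyperbolic_step\<close> starts from size 0 and also constrains entries
    with index 0. Clearing them changes no trace.\<close>
  define A' where "A' = (\<lambda>i j. if i = 0 \<or> j = 0 then 0 else A i j)"
  have A': "\<And>i. i \<le> 0 \<Longrightarrow> A' i (Suc (Suc 0)) = 0" "A' (Suc 0) (Suc (Suc 0)) = A 1 2"
    "\<And>i. i \<le> Suc (Suc 0) \<Longrightarrow> A' (Suc (Suc 0)) i = 0" "A' (Suc (Suc 0)) (Suc (Suc 0)) = 0"
    using A by (auto simp: A'_def numeral_2_eq_2 le_Suc_eq)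
  have eq: "rank_sum 2 k A = rank_sum 2 k A'" "avg_sum 2 k A = avg_sum 2 k A'" for k
    by (auto intro!: rank_sum_cong simp: A'_def)
  have 0: "rank_sum 0 k A' = (if k = 0 then 1 else 0)" "avg_sum 0 k A' = (if k = 0 then 1 else 0)"
      for k
  proof -
    have "(rank_mats 0 k :: (nat \<Rightarrow> nat \<Rightarrow> 'a) set) \<subseteq> {\<lambda>_ _. 0}" for k
      by (auto simp: rank_mats_def sym_mats_0)
    then have "rank_mats 0 k = (if k = 0 then {\<lambda>_ _. 0 :: 'a} else {})" for k
      using zero_in_rank_mats_0_iff[of k, where 'a = 'a] by auto
    then show "rank_sum 0 k A' = (if k = 0 then 1 else 0)"
        "avg_sum 0 k A' = (if k = 0 then 1 else 0)"
      by (simp_all add: rank_sum_def avg_sum_def trace_prod_def avg_chi_def vecs_0 dot_def)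
  qed
  have 2: "rank_sum 2 k A' = q powi k * rank_sum 0 k A' + (q - 1) * q powi (k - 1)
      * rank_sum 0 (k - 1) A'
      - q powi (k - 1) * rank_sum 0 (k - 2) A'"
    "avg_sum 2 k A' = q powi k * avg_sum 0 k A' - q powi (k - 2) * avg_sum 0 (k - 2) A'" for k
    using hyperbolic_step[where n = 0 and A = A' and k = k, OF A'(1,2) A(4) A'(3,4)]
    by (simp_all add: numeral_2_eq_2)
  show "rank_sum 2 k A = (if k = 0 then 1 else if k = 1 then of_int 1 * q - 1
              else if k = 2 then - (of_int 1 * q) else 0)"
    unfolding eq 2 0 by auto
  show "avg_sum 2 (2 * r) A = of_real (F_number CARD('a) 2 r 1)"
    unfolding eq 2 0 F_number_2_1 by auto
qed

definition elliptic_base :: "'a \<Rightarrow> 'a \<Rightarrow> 'a \<Rightarrow> nat \<Rightarrow> nat \<Rightarrow> 'a" where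
  "elliptic_base lam eta c i j = (if i = 1 \<and> j = 1 then c
     else if i = 1 \<and> j = 2 then (if even CARD('a) then c else 0)
     else if i = 2 \<and> j = 2 then (if even CARD('a) then c * lam else - (c * eta)) else 0)"

text \<open>Anisotropy comes from the trace condition or from the nonsquare. The point count is
  \<open>conic_count_odd\<close> for odd q, while for even q each of the q + 1 equations has exactly
  one root.\<close>

lemma elliptic_base:
  assumes c: "c \<noteq> 0" and lam: "even CARD('a) \<Longrightarrow> abs_trace lam = 1"
    and eta: "odd CARD('a) \<Longrightarrow> \<nexists>x. eta = x\<^sup>2"
  shows "rank_sum 2 k (elliptic_base lam eta c)
      = (if k = 0 then 1 else if k = 1 then of_int (- 1) * q - 1
              else if k = 2 then - (of_int (- 1) * q) else 0)"
    and "avg_sum 2 (2 * r) (elliptic_base lam eta c) = of_real (F_number CARD('a) 2 r 1)"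
proof -
  let ?A = "elliptic_base lam eta c"
  have A: "?A 1 1 = c" "?A 2 1 = 0" "?A 1 2 = (if even CARD('a) then c else 0)"
    "?A 2 2 = (if even CARD('a) then c * lam else - (c * eta))"
    by (simp_all add: elliptic_base_def)
  have "x = 0 \<and> y = 0" if 0: "?A 1 1 * x\<^sup>2 + ?A 1 2 * (x * y) + ?A 2 2 * y\<^sup>2 = 0" for x y
  proof (cases "even CARD('a)")
    case True
    then have "c * (x\<^sup>2 + x * y + lam * y\<^sup>2) = 0"
      using 0 A by (simp add: algebra_simps)
    then show ?thesis
      using trace_one_anisotropic[of lam x y] lam True c by (simp add: even_CARD_iff)
  next
    case False
    then have "c * (x\<^sup>2 - eta * y\<^sup>2) = 0"
      using 0 A by (simp add: algebra_simps)
    then show ?thesis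
      using norm_anisotropic[of eta x y] eta False c by simp
  qed
  from rank_sum_anisotropic[where A = ?A, OF A(2) this]
  show "rank_sum 2 k ?A = (if k = 0 then 1 else if k = 1 then of_int (- 1) * q - 1
              else if k = 2 then - (of_int (- 1) * q) else 0)"
    by simp
  have nz: "\<not> (?A 1 1 + x\<^sup>2 = 0 \<and> ?A 1 2 + 2 * x * y = 0 \<and> ?A 2 2 + y\<^sup>2 = 0)" for x y
  proof (cases "even CARD('a)")
    case True
    then show ?thesis using A c by (simp add: even_CARD_iff)
  next
    case False
    then have "eta \<noteq> 0" using eta by (metis zero_power2)
    then show ?thesis using A c False by (auto simp: even_CARD_iff)
  qed
  have cnt: "(\<Sum>y\<in>UNIV. of_nat (card {x. x\<^sup>2 + (?A 1 1 + ?A 1 2 * y + ?A 2 2 * y\<^sup>2) = 0}))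
      + of_nat (card {x. x\<^sup>2 + ?A 2 2 = 0}) = q + 1"
  proof (cases "even CARD('a)")
    case True
    then show ?thesis by (simp add: card_square_eq_char_2 even_CARD_iff)
  next
    case False
    have e: "?A 2 2 = c * (- eta)" "?A 1 1 + ?A 1 2 * y + c * (- eta) * y\<^sup>2 = c * (1 - eta * y\<^sup>2)"
        for y
      using A False by (simp_all add: algebra_simps)
    show ?thesis
      unfolding e(1) e(2) using conic_count_odd[of eta c] eta c False by (simp add: even_CARD_iff)
  qed
  show "avg_sum 2 (2 * r) ?A = of_real (F_number CARD('a) 2 r 1)"
    unfolding avg_sum_anisotropic[where A = ?A, OF A(2) nz cnt] F_number_2_1 by auto
qed

end

lemma CARD_powi_eq_iff:
  "real CARD('a::{finite,field}) powi i = real CARD('a) powi j \<longleftrightarrow> i = j"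
proof -
  have "real CARD('a) > 1" using CARD_ge_2[where 'a = 'a] by simp
  then show ?thesis
    using power_int_strict_increasing[of i j "real CARD('a)"]
        power_int_strict_increasing[of j i "real CARD('a)"]
    by (cases i j rule: linorder_cases) auto
qed

section \<open>Forms and matrices\<close>

lemma bilinear_formD:
  assumes "bilinear_form scale S"
  shows "S (x + y) z = S x z + S y z" "S (scale c x) z = c * S x z"
    and "S z (x + y) = S z x + S z y" "S z (scale c x) = c * S z x"
  using assms by (auto simp: bilinear_form_def Vector_Spaces.linear_iff)

lemma bilinear_form_zero [simp]:
  assumes "bilinear_form scale S"
  shows "S 0 z = 0" "S z 0 = 0"
  using bilinear_formD(1)[OF assms, of 0 0 z] bilinear_formD(3)[OF assms, of z 0 0]
  by (metis add_0_left add_cancel_right_right)+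

lemma bilinear_form_sum:
  assumes "bilinear_form scale S"
  shows "S (\<Sum>i\<in>I. scale (x i) (b i)) z = (\<Sum>i\<in>I. x i * S (b i) z)"
    and "S z (\<Sum>i\<in>I. scale (x i) (b i)) = (\<Sum>i\<in>I. x i * S z (b i))"
  by (induction I rule: infinite_finite_induct)
     (simp_all add: bilinear_formD[OF assms] bilinear_form_zero[OF assms])

lemma bilinear_formI:
  assumes "vector_space scale"
    and "\<And>x y z. S (x + y) z = S x z + S y z" "\<And>c x z. S (scale c x) z = c * S x z"
    and "\<And>x y z. S z (x + y) = S z x + S z y" "\<And>c x z. S z (scale c x) = c * S z x"
  shows "bilinear_form scale S"
proof -
  have "vector_space ((*) :: 'a::field \<Rightarrow> 'a \<Rightarrow> 'a)"
    by unfold_locales (simp_all add: algebra_simps)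
  then show ?thesis
    using assms by (simp add: bilinear_form_def Vector_Spaces.linear_iff)
qed

lemma lincomb_cong:
  "(\<And>i. i \<in> {1..vdim scale} \<Longrightarrow> x i = y i) \<Longrightarrow> lincomb scale b x = lincomb scale b y"
  by (simp add: lincomb_def)

locale form_space = finite_dimensional_vector_space scale Basis
  for scale :: "'a::{finite,field} \<Rightarrow> 'v::ab_group_add \<Rightarrow> 'v" and Basis
begin

abbreviation "m \<equiv> vdim scale"

lemma lincomb_add_scale:
  "lincomb scale b (\<lambda>i. x i + c * y i) = lincomb scale b x + scale c (lincomb scale b y)"
  by (simp add: lincomb_def scale_left_distrib sum.distrib scale_sum_right)

text \<open>A spanning family of length m is injective and independent, since otherwise fewer than m
  vectors would span.\<close>

lemma is_basisI:
  assumes "\<And>x. \<exists>c. x = lincomb scale b c"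
  shows "is_basis scale b"
proof -
  let ?B = "b ` {1..m}"
  have span: "x \<in> span ?B" for x
  proof -
    obtain c where "x = lincomb scale b c" using assms by blast
    then show ?thesis
      by (simp only: lincomb_def) (intro span_sum span_scale span_base imageI)
  qed
  have card: "card ?B \<le> m"
    using card_image_le[of "{1..m}" b] by simp
  then have ind: "independent ?B"
  proof (intro card_le_dim_spanning[of ?B UNIV])
    show "UNIV \<subseteq> span ?B" using span by blast
    show "card ?B \<le> dim UNIV" using card by (simp only: vdim_def)
  qed simp_all
  have "m \<le> card ?B"
  proof -
    have "dim UNIV \<le> card ?B"
      by (rule dim_le_card) (use span in blast, simp)
    then show ?thesis by (simp only: vdim_def)
  qed
  then have "card ?B = card {1..m}" using card by simp
  then have "inj_on b {1..m}"
    by (intro eq_card_imp_inj_on) auto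
  then show ?thesis
    using span ind by (auto simp: is_basis_def)
qed

context
  fixes b assumes b: "is_basis scale b"
begin

lemma lincomb_ex: "\<exists>c\<in>vecs m. x = lincomb scale b c"
proof -
  have inj: "inj_on b {1..m}" and "x \<in> span (b ` {1..m})"
    using b by (auto simp: is_basis_def)
  then obtain u where "x = (\<Sum>v\<in>b ` {1..m}. scale (u v) v)"
    using span_finite[of "b ` {1..m}"] by auto
  also have "\<dots> = lincomb scale b (\<lambda>i. u (b i))"
    unfolding lincomb_def sum.reindex[OF inj] by (simp only: comp_def)
  also have "\<dots> = lincomb scale b (\<lambda>i. if i \<in> {1..m} then u (b i) else 0)"
    by (rule lincomb_cong) simp
  finally show ?thesis
    by (rule bexI[of _ "\<lambda>i. if i \<in> {1..m} then u (b i) else 0"]) (simp add: vecs_def)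
qed

lemma lincomb_inj:
  assumes "lincomb scale b c = lincomb scale b d" "i \<in> {1..m}"
  shows "c i = d i"
proof -
  have inj: "inj_on b {1..m}" and ind: "independent (b ` {1..m})"
    using b by (auto simp: is_basis_def)
  let ?u = "\<lambda>v. c (the_inv_into {1..m} b v) - d (the_inv_into {1..m} b v)"
  have "(\<Sum>v\<in>b ` {1..m}. scale (?u v) v) = lincomb scale b c - lincomb scale b d"
    unfolding lincomb_def sum_subtractf[symmetric] sum.reindex[OF inj]
    by (intro sum.cong refl) (simp only: comp_def the_inv_into_f_f[OF inj] scale_left_diff_distrib)
  then have "?u (b i) = 0"
    using assms ind by (intro independentD[of "b ` {1..m}" "b ` {1..m}" ?u]) auto
  then show ?thesis
    by (simp only: the_inv_into_f_f[OF inj assms(2)] right_minus_eq)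
qed

lemma bij_lincomb: "bij_betw (lincomb scale b) (vecs m) UNIV"
  unfolding bij_betw_def
proof
  show "inj_on (lincomb scale b) (vecs m)"
  proof (rule inj_onI)
    fix x y assume *: "x \<in> vecs m" "y \<in> vecs m" "lincomb scale b x = lincomb scale b y"
    have "x i = y i" for i
      using lincomb_inj[OF *(3), of i] *(1,2) by (cases "i \<in> {1..m}") (auto simp: vecs_def)
    then show "x = y" by blast
  qed
  show "lincomb scale b ` vecs m = UNIV"
    using lincomb_ex by blast
qed

definition gram :: "('v \<Rightarrow> 'v \<Rightarrow> 'a) \<Rightarrow> nat \<Rightarrow> nat \<Rightarrow> 'a" where
  "gram S i j = (if i \<in> {1..m} \<and> j \<in> {1..m} then S (b i) (b j) else 0)"

lemma gram_in_sym_mats: "S \<in> sym_forms scale \<Longrightarrow> gram S \<in> sym_mats m"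
  by (auto simp: sym_forms_def sym_mats_def gram_def)

lemma form_lincomb:
  assumes "S \<in> sym_forms scale"
  shows "S (lincomb scale b x) (lincomb scale b y) = dot m x (mat_vec m (gram S) y)"
proof -
  have S: "bilinear_form scale S" using assms by (simp add: sym_forms_def)
  have "S (lincomb scale b x) (lincomb scale b y)
      = (\<Sum>i = 1..m. x i * (\<Sum>j = 1..m. y j * S (b i) (b j)))"
    unfolding lincomb_def bilinear_form_sum(1)[OF S]
    unfolding bilinear_form_sum(2)[OF S] ..
  also have "\<dots> = dot m x (mat_vec m (gram S) y)"
    unfolding dot_def mat_vec_def
    by (rule sum.cong[OF refl], rule arg_cong2[where f = "(*)", OF refl], rule sum.cong[OF refl])
       (simp add: gram_def mult.commute)
  finally show ?thesis .
qed

lemma gram_bij: "bij_betw gram (sym_forms scale) (sym_mats m)"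
  unfolding bij_betw_def
proof
  show "inj_on gram (sym_forms scale)"
  proof (rule inj_onI, intro ext)
    fix S S' x y assume *: "S \<in> sym_forms scale" "S' \<in> sym_forms scale" "gram S = gram S'"
    obtain c d where "x = lincomb scale b c" "y = lincomb scale b d"
      using lincomb_ex by metis
    then show "S x y = S' x y"
      using * by (simp add: form_lincomb)
  qed
  show "gram ` sym_forms scale = sym_mats m"
  proof (intro subset_antisym subsetI)
    fix B :: "nat \<Rightarrow> nat \<Rightarrow> 'a" assume B: "B \<in> sym_mats m"
    \<comment> \<open>\<open>crd\<close> is the coordinate map of the basis \<open>b\<close>; the
      form with Gram matrix \<open>B\<close> is written down in these coordinates.\<close>
    define crd where "crd = the_inv_into (vecs m) (lincomb scale b)"
    have inj: "inj_on (lincomb scale b) (vecs m)"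
      using bij_lincomb by (simp add: bij_betw_def)
    have crd: "crd x \<in> vecs m" "lincomb scale b (crd x) = x" for x
      using the_inv_into_into[OF inj, of x] f_the_inv_into_f[OF inj, of x] bij_lincomb
      unfolding crd_def bij_betw_def by blast+
    have crdI: "crd (lincomb scale b c) = c" if "c \<in> vecs m" for c
      unfolding crd_def using that by (rule the_inv_into_f_f[OF inj])
    have add: "crd (x + scale c y) = (\<lambda>i. crd x i + c * crd y i)" for x y c
      using crdI[OF vecs_add_scale[OF crd(1) crd(1)]] by (simp add: lincomb_add_scale crd)
    have add1: "crd (x + y) = (\<lambda>i. crd x i + 1 * crd y i)" for x y
      using add[of x 1 y] by simp
    have "crd 0 = (\<lambda>_. 0)"
      using crdI[OF zero_in_vecs] by (simp add: lincomb_def)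
    then have sc: "crd (scale c y) = (\<lambda>i. 0 + c * crd y i)" for y c
      using add[of 0 c y] by simp
    define S where "S x y = dot m (crd x) (mat_vec m B (crd y))" for x y
    have sym: "S x y = S y x" for x y
      unfolding S_def dot_mat_vec[OF B, of "crd x"] by (rule dot_commute)
    have l: "S z (x + y) = S z x + S z y" "S z (scale c x) = c * S z x" for x y z c
      unfolding S_def add1 sc mat_vec_add_scale dot_add_scale
          by (simp_all add: dot_scale mat_vec_zero)
    have "S \<in> sym_forms scale"
      unfolding sym_forms_def using sym l
      by (auto intro!: bilinear_formI vector_space_axioms)
    moreover have "gram S = B"
    proof (intro ext)
      fix i j
      have unit: "crd (b i) = (\<lambda>k. if k = i then 1 else 0)" if "i \<in> {1..m}" for i
      proof -
        have "lincomb scale b (\<lambda>k. if k = i then 1 else 0) = b i"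
          unfolding lincomb_def using that by
              (simp add: if_distrib[of "\<lambda>c. scale c _"] cong: if_cong)
        moreover have "(\<lambda>k. if k = i then 1 else 0) \<in> vecs m"
          using that by (auto simp: vecs_def)
        ultimately show ?thesis
          using crdI by metis
      qed
      have "B i j = 0" if "i \<notin> {1..m} \<or> j \<notin> {1..m}"
        using B that unfolding sym_mats_def mem_Collect_eq by metis
      then show "gram S i j = B i j"
        by (auto simp: gram_def S_def unit dot_def mat_vec_def if_distrib[of "\<lambda>c. c * _"]
              if_distrib[of "\<lambda>c. _ * c"] cong: if_cong)
    qed
    ultimately show "B \<in> gram ` sym_forms scale" by blast
  qed (auto intro: gram_in_sym_mats)
qed

lemma ker_card_gram:
  assumes S: "S \<in> sym_forms scale"
  shows "ker_card m (gram S) = card {x. \<forall>y. S x y = 0}"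
proof -
  have iff: "mat_vec m (gram S) z = (\<lambda>_. 0) \<longleftrightarrow> (\<forall>y. S (lincomb scale b z) y = 0)" for z
  proof
    assume *: "mat_vec m (gram S) z = (\<lambda>_. 0)"
    show "\<forall>y. S (lincomb scale b z) y = 0"
    proof
      fix y
      obtain c where "y = lincomb scale b c" using lincomb_ex by blast
      then have "S y (lincomb scale b z) = 0"
        using * by (simp add: form_lincomb[OF S])
      then show "S (lincomb scale b z) y = 0"
        using S by (simp add: sym_forms_def)
    qed
  next
    assume *: "\<forall>y. S (lincomb scale b z) y = 0"
    show "mat_vec m (gram S) z = (\<lambda>_. 0)"
    proof
      fix i
      show "mat_vec m (gram S) z i = 0"
      proof (cases "i \<in> {1..m}")
        case True
        have "dot m (\<lambda>k. if k = i then 1 else 0) (mat_vec m (gram S) z) = 0"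
          using * S unfolding form_lincomb[OF S, symmetric] sym_forms_def mem_Collect_eq by metis
        then show ?thesis
          using True by (simp add: dot_def if_distrib[of "\<lambda>c. c * _"] cong: if_cong)
      qed (auto simp: mat_vec_def gram_def dot_def intro!: sum.neutral)
    qed
  qed
  have "bij_betw (lincomb scale b) {z \<in> vecs m. mat_vec m (gram S) z = (\<lambda>_. 0)} {x. \<forall>y. S x y = 0}"
    unfolding bij_betw_def
  proof
    show "inj_on (lincomb scale b) {z \<in> vecs m. mat_vec m (gram S) z = (\<lambda>_. 0)}"
      using bij_lincomb by (auto simp: bij_betw_def inj_on_def)
    show "lincomb scale b ` {z \<in> vecs m. mat_vec m (gram S) z = (\<lambda>_. 0)} = {x. \<forall>y. S x y = 0}"
    proof (intro subset_antisym subsetI)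
      fix x assume x: "x \<in> {x. \<forall>y. S x y = 0}"
      obtain z where "z \<in> vecs m" "x = lincomb scale b z" using lincomb_ex by blast
      then show "x \<in> lincomb scale b ` {z \<in> vecs m. mat_vec m (gram S) z = (\<lambda>_. 0)}"
        using x by (auto simp: iff)
    qed (auto simp: iff)
  qed
  then show ?thesis
    unfolding ker_card_def by (rule bij_betw_same_card)
qed

end

lemma card_span_independent:
  "finite B \<Longrightarrow> independent B \<Longrightarrow> card (span B) = CARD('a) ^ card B"
proof (induction B rule: finite_induct)
  case (insert a B)
  have a: "a \<notin> span B" and B: "independent B"
    using insert.prems insert.hyps by (auto simp: independent_insert)
  have "bij_betw (\<lambda>(k, x). scale k a + x) (UNIV \<times> span B) (span (insert a B))"
    unfolding bij_betw_def
  proof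
    show "inj_on (\<lambda>(k, x). scale k a + x) (UNIV \<times> span B)"
    proof (rule inj_onI, clarify)
      fix k l x y assume *: "x \<in> span B" "y \<in> span B" "scale k a + x = scale l a + y"
      have e: "scale (k - l) a = y - x"
        using *(3) by (simp add: scale_left_diff_distrib algebra_simps)
      have "k = l"
      proof (rule ccontr)
        assume "k \<noteq> l"
        then have "a = scale (inverse (k - l)) (y - x)"
          unfolding e[symmetric] by simp
        moreover have "scale (inverse (k - l)) (y - x) \<in> span B"
          using * by (intro span_scale span_diff)
        ultimately show False using a by metis
      qed
      then show "k = l \<and> x = y" using * by simp
    qed
    show "(\<lambda>(k, x). scale k a + x) ` (UNIV \<times> span B) = span (insert a B)"
    proof (intro subset_antisym subsetI)
      fix x assume "x \<in> span (insert a B)"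
      then obtain k where "x - scale k a \<in> span B" by (auto simp: span_breakdown_eq)
      then show "x \<in> (\<lambda>(k, x). scale k a + x) ` (UNIV \<times> span B)"
        by (intro image_eqI[of _ _ "(k, x - scale k a)"]) auto
    next
      fix y assume "y \<in> (\<lambda>(k, x). scale k a + x) ` (UNIV \<times> span B)"
      then obtain k x where "x \<in> span B" "y = scale k a + x" by auto
      then show "y \<in> span (insert a B)"
        unfolding span_breakdown_eq by (intro exI[of _ k]) simp
    qed
  qed
  from bij_betw_same_card[OF this] show ?case
    using insert.IH[OF B] insert.hyps by (simp add: card_cartesian_product)
qed simp

lemma card_subspace:
  assumes "subspace W"
  shows "card W = CARD('a) ^ dim W"
proof -
  obtain B where B: "B \<subseteq> W" "independent B" "W \<subseteq> span B" "card B = dim W"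
    using basis_exists by blast
  then have "span B = W"
    using assms by (metis span_subspace)
  moreover have "finite B"
    using B(2) by (rule finiteI_independent)
  ultimately show ?thesis
    using card_span_independent[of B] B by simp
qed

lemma subspace_radical:
  assumes "S \<in> sym_forms scale"
  shows "subspace {x. \<forall>y. S x y = 0}"
  using assms by (auto simp: subspace_def sym_forms_def bilinear_formD bilinear_form_zero)

text \<open>The kernel of the Gram matrix is the radical in coordinates, and exponents of q may be
  compared.\<close>

lemma gram_in_rank_mats_iff:
  assumes b: "is_basis scale b" and S: "S \<in> sym_forms scale"
  shows "gram b S \<in> rank_mats m k \<longleftrightarrow> int (sym_rank scale S) = k"
proof -
  let ?R = "{x. \<forall>y. S x y = 0}"
  have le: "dim ?R \<le> m" unfolding vdim_def by (intro dim_subset) auto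
  have q: "real CARD('a) > 1" using CARD_ge_2[where 'a = 'a] by simp
  have "gram b S \<in> rank_mats m k \<longleftrightarrow> real CARD('a) powi (int (dim ?R) + k)
      = real CARD('a) powi (int m)"
    using gram_in_sym_mats[OF b S] q
    by (simp add: rank_mats_def ker_card_gram[OF b S] card_subspace[OF subspace_radical[OF S]]
        power_int_add)
  also have "\<dots> \<longleftrightarrow> int (dim ?R) + k = int m"
    by (rule CARD_powi_eq_iff)
  also have "\<dots> \<longleftrightarrow> int (sym_rank scale S) = k"
    unfolding sym_rank_def codimension_def using le by auto
  finally show ?thesis .
qed

end

section \<open>The pairing under change of matrix and bases\<close>

lemma sum_Times: "(\<Sum>p\<in>X \<times> Y. g p) = (\<Sum>x\<in>X. \<Sum>y\<in>Y. g (x, y))"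
  by (simp add: sum.cartesian_product case_prod_unfold)

lemma sum_swap_pairs:
  "(\<Sum>a\<in>A. \<Sum>b\<in>B. \<Sum>c\<in>C. \<Sum>d\<in>D. f a b c d) = (\<Sum>c\<in>C. \<Sum>d\<in>D. \<Sum>a\<in>A. \<Sum>b\<in>B. f a b c d)"
  using sum.swap[of "\<lambda>p r. f (fst p) (snd p) (fst r) (snd r)" "C \<times> D" "A \<times> B"]
  by (simp only: sum_Times fst_conv snd_conv)

text \<open>Off the diagonal the terms for (i, j) and (j, i) cancel because \<open>T\<close> is
  symmetric.\<close>

lemma trace_prod_alternating:
  fixes D T :: "nat \<Rightarrow> nat \<Rightarrow> 'a::comm_ring_1"
  assumes "\<And>i. i \<in> {1..n} \<Longrightarrow> D i i = 0" "\<And>i j. i \<in> {1..n} \<Longrightarrow> j \<in> {1..n} \<Longrightarrow> i \<noteq> j \<Longrightarrow> D i j + D j i = 0"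
    and T: "\<And>i j. T i j = T j i"
  shows "trace_prod n D T = 0"
  using assms(1,2)
proof (induction n)
  case (Suc n)
  have "trace_prod (Suc n) D T = trace_prod n D T + ((\<Sum>i = 1..n. D i (Suc n) * T (Suc n) i)
      + (\<Sum>i = 1..n. D (Suc n) i * T i (Suc n))) + D (Suc n) (Suc n) * T (Suc n) (Suc n)"
    by (simp add: trace_prod_def sum.distrib)
  also have "(\<Sum>i = 1..n. D i (Suc n) * T (Suc n) i) + (\<Sum>i = 1..n. D (Suc n) i * T i (Suc n))
      = (\<Sum>i = 1..n. (D i (Suc n) + D (Suc n) i) * T (Suc n) i)"
    by (simp add: sum.distrib distrib_right T[of _ "Suc n"])
  also have "\<dots> = 0"
    using Suc.prems(2)[of _ "Suc n"] by (intro sum.neutral) auto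
  finally have "trace_prod (Suc n) D T = trace_prod n D T + D (Suc n) (Suc n) * T (Suc n) (Suc n)"
    by simp
  moreover have "trace_prod n D T = 0"
    using Suc.prems by (intro Suc.IH) auto
  ultimately show ?case
    using Suc.prems(1)[of "Suc n"] by simp
qed (simp add: trace_prod_def)

text \<open>The difference of the matrices represents the zero form: unit vectors show that its
  diagonal is 0, sums of two of them that it is alternating. Hence the choice of matrix in
  \<open>pairing\<close> is harmless.\<close>

lemma trace_prod_quad_eq:
  fixes A A' T :: "nat \<Rightarrow> nat \<Rightarrow> 'a::comm_ring_1"
  assumes eq: "\<And>x. (\<Sum>i = 1..n. \<Sum>j = 1..n. A i j * x i * x j)
      = (\<Sum>i = 1..n. \<Sum>j = 1..n. A' i j * x i * x j)"
    and T: "\<And>i j. T i j = T j i"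
  shows "trace_prod n A T = trace_prod n A' T"
proof -
  define D where "D i j = A i j - A' i j" for i j
  let ?e = "\<lambda>i k. if k = i then 1 else (0 :: 'a)"
  have quad: "dot n x (mat_vec n D x) = 0" for x
  proof -
    have "dot n x (mat_vec n C x) = (\<Sum>i = 1..n. \<Sum>j = 1..n. C i j * x i * x j)" for C
      by (simp add: dot_def mat_vec_def sum_distrib_left mult_ac)
    moreover have "(\<Sum>i = 1..n. \<Sum>j = 1..n. D i j * x i * x j) = 0"
      using eq[of x] by (simp add: D_def left_diff_distrib sum_subtractf)
    ultimately show ?thesis by simp
  qed
  have e: "dot n (?e i) v = v i" "mat_vec n D (?e i) k = D k i" if "i \<in> {1..n}" for i k v
    using that by (simp_all add: dot_def mat_vec_def if_distrib[of "\<lambda>c. c * _"]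
        if_distrib[of "\<lambda>c. _ * c"] cong: if_cong)
  have 1: "D i i = 0" if "i \<in> {1..n}" for i
    using quad[of "?e i"] e[OF that] by simp
  have "D i j + D j i = 0" if ij: "i \<in> {1..n}" "j \<in> {1..n}" for i j
  proof -
    have d: "dot n (\<lambda>k. x k + 1 * y k) z = dot n x z + 1 * dot n y z" for x y z :: "nat \<Rightarrow> 'a"
      using dot_add_scale[of n z x 1 y] by (simp add: dot_commute)
    show ?thesis
      using quad[of "\<lambda>k. ?e i k + 1 * ?e j k"] 1[OF ij(1)] 1[OF ij(2)]
      unfolding mat_vec_add_scale dot_add_scale d e(1)[OF ij(1)] e(1)[OF ij(2)] e(2)[OF ij(1)]
          e(2)[OF ij(2)]
      by (simp add: add.commute)
  qed
  then have "trace_prod n D T = 0"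
    by (intro trace_prod_alternating 1 T)
  then show ?thesis
    by (simp add: D_def trace_prod_def left_diff_distrib sum_subtractf)
qed

context form_space
begin

lemma lincomb_lincomb:
  "(\<Sum>j = 1..m. scale (c j) (lincomb scale b (P j))) = lincomb scale b (\<lambda>k. \<Sum>j = 1..m. c j * P j k)"
proof -
  have "(\<Sum>j = 1..m. scale (c j) (lincomb scale b (P j)))
      = (\<Sum>j = 1..m. \<Sum>k = 1..m. scale (c j * P j k) (b k))"
    by (simp add: lincomb_def scale_sum_right)
  also have "\<dots> = (\<Sum>k = 1..m. \<Sum>j = 1..m. scale (c j * P j k) (b k))"
    by (rule sum.swap)
  finally show ?thesis
    by (simp add: lincomb_def scale_sum_left)
qed

lemma lincomb_unit: "i \<in> {1..m} \<Longrightarrow> lincomb scale b (\<lambda>k. if k = i then 1 else 0) = b i"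
  unfolding lincomb_def by (simp add: if_distrib[of "\<lambda>c. scale c _"] cong: if_cong)

text \<open>The pairing refers to the bases \<open>u\<close> and \<open>w\<close>; passing from \<open>u\<close> to a basis \<open>b\<close> adapted to the
  quadratic form is compensated by the contragredient change of \<open>w\<close>.\<close>

lemma pairing_basis_change:
  assumes u: "is_basis scale u" and w: "is_basis scale w" and b: "is_basis scale b"
  obtains b' where "is_basis scale b'"
    "\<And>Q A S \<chi>. matrix_of_quad scale b Q A \<Longrightarrow> S \<in> sym_forms scale \<Longrightarrow>
       pairing scale \<chi> u w Q S = \<chi> (trace_prod m A (gram b' S))"
proof -
  have "\<exists>c. u i = lincomb scale b c" "\<exists>c. b i = lincomb scale u c" for i
    using lincomb_ex[OF b] lincomb_ex[OF u] by blast+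
  then obtain R P where R: "\<And>i. u i = lincomb scale b (R i)"
      and P: "\<And>j. b j = lincomb scale u (P j)"
    by metis
  have RP: "(\<Sum>j = 1..m. R i j * P j k) = (if k = i then 1 else 0)" if "i \<in> {1..m}" "k \<in> {1..m}"
      for i k
  proof (rule lincomb_inj[OF u _ that(2)])
    have "lincomb scale u (\<lambda>k. \<Sum>j = 1..m. R i j * P j k) = (\<Sum>j = 1..m. scale (R i j) (b j))"
      unfolding P by (rule lincomb_lincomb[symmetric])
    also have "\<dots> = u i"
      unfolding R[of i] by (simp add: lincomb_def)
    finally show "lincomb scale u (\<lambda>k. \<Sum>j = 1..m. R i j * P j k)
        = lincomb scale u (\<lambda>k. if k = i then 1 else 0)"
      using that by (simp add: lincomb_unit)
  qed
  \<comment> \<open>In the basis \<open>u\<close> the form has matrix R A R^T; moving R across the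
    trace turns the Gram matrix at \<open>w\<close> into the one at R^T w, which is
    \<open>b'\<close>.\<close>
  define b' where "b' j = lincomb scale w (\<lambda>i. R i j)" for j
  have "is_basis scale b'"
  proof (rule is_basisI)
    fix x
    obtain c where c: "x = lincomb scale w c" using lincomb_ex[OF w] by blast
    \<comment> \<open>The inverse matrix \<open>P\<close> expresses each \<open>w k\<close> through
      \<open>b'\<close>, so \<open>b'\<close> spans.\<close>
    have wk: "w k = lincomb scale b' (\<lambda>j. P j k)" if k: "k \<in> {1..m}" for k
    proof -
      have "lincomb scale b' (\<lambda>j. P j k) = (\<Sum>j = 1..m. scale (P j k) (lincomb scale w (\<lambda>i. R i j)))"
        by (simp add: lincomb_def[of scale b'] b'_def)
      also have "\<dots> = lincomb scale w (\<lambda>i. \<Sum>j = 1..m. P j k * R i j)"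
        by (rule lincomb_lincomb)
      also have "\<dots> = lincomb scale w (\<lambda>i. if i = k then 1 else 0)"
        using RP[OF _ k] by (intro lincomb_cong) (auto simp: mult.commute)
      finally show ?thesis using k by (simp add: lincomb_unit)
    qed
    have "x = (\<Sum>k = 1..m. scale (c k) (lincomb scale b' (\<lambda>j. P j k)))"
      unfolding c lincomb_def[of scale w] using wk by (intro sum.cong refl) simp
    then show "\<exists>d. x = lincomb scale b' d"
      unfolding lincomb_lincomb by blast
  qed
  moreover have "pairing scale \<chi> u w Q S = \<chi> (trace_prod m A (gram b' S))"
    if A: "matrix_of_quad scale b Q A" and S: "S \<in> sym_forms scale" for Q A S
        and \<chi> :: "'a \<Rightarrow> complex"
  proof -
    define A'' where "A'' i k = (\<Sum>j = 1..m. \<Sum>l = 1..m. A j l * R i j * R k l)" for i k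
    have A'': "matrix_of_quad scale u Q A''"
      unfolding matrix_of_quad_def
    proof
      fix x
      have "lincomb scale u x = lincomb scale b (\<lambda>j. \<Sum>i = 1..m. x i * R i j)"
        unfolding lincomb_def[of scale u] R by (rule lincomb_lincomb)
      then have "Q (lincomb scale u x) = (\<Sum>j = 1..m. \<Sum>l
          = 1..m. A j l * (\<Sum>i = 1..m. x i * R i j) * (\<Sum>k = 1..m. x k * R k l))"
        using A by (simp add: matrix_of_quad_def)
      also have "\<dots> = (\<Sum>j = 1..m. \<Sum>l = 1..m. \<Sum>i = 1..m. \<Sum>k
          = 1..m. A j l * R i j * R k l * x i * x k)"
        by (intro sum.cong refl) (simp add: sum_distrib_left sum_distrib_right mult_ac)
      also have "\<dots> = (\<Sum>i = 1..m. \<Sum>k = 1..m. \<Sum>j = 1..m. \<Sum>l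
          = 1..m. A j l * R i j * R k l * x i * x k)"
        by (rule sum_swap_pairs)
      finally show "Q (lincomb scale u x) = (\<Sum>i = 1..m. \<Sum>k = 1..m. A'' i k * x i * x k)"
        by (simp add: A''_def sum_distrib_right)
    qed
    define A0 where "A0 = (SOME A. matrix_of_quad scale u Q A)"
    have "matrix_of_quad scale u Q A0"
      unfolding A0_def by (rule someI[of "matrix_of_quad scale u Q", OF A''])
    then have quad: "(\<Sum>i = 1..m. \<Sum>j = 1..m. A0 i j * x i * x j)
        = (\<Sum>i = 1..m. \<Sum>j = 1..m. A'' i j * x i * x j)" for x
      using A'' unfolding matrix_of_quad_def by metis
    have sym: "S x y = S y x" and bil: "bilinear_form scale S" for x y
      using S by (auto simp: sym_forms_def)
    have "pairing scale \<chi> u w Q S = \<chi> (trace_prod m A0 (\<lambda>i j. S (w i) (w j)))"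
      by (simp add: pairing_def trace_prod_def A0_def)
    also have "trace_prod m A0 (\<lambda>i j. S (w i) (w j)) = trace_prod m A'' (\<lambda>i j. S (w i) (w j))"
      using quad sym by (rule trace_prod_quad_eq)
    also have "\<dots> = (\<Sum>i = 1..m. \<Sum>k = 1..m. \<Sum>j = 1..m. \<Sum>l
        = 1..m. A j l * R i j * R k l * S (w k) (w i))"
      by (simp add: trace_prod_def A''_def sum_distrib_right)
    also have "\<dots> = (\<Sum>j = 1..m. \<Sum>l = 1..m. \<Sum>i = 1..m. \<Sum>k
        = 1..m. A j l * R i j * R k l * S (w k) (w i))"
      by (rule sum_swap_pairs)
    also have "\<dots> = (\<Sum>j = 1..m. \<Sum>l = 1..m. A j l * S (b' l) (b' j))"
    proof (rule sum.cong[OF refl], rule sum.cong[OF refl])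
      fix j l
      have "S (b' l) (b' j) = S (b' j) (b' l)" by (rule sym)
      also have "\<dots> = (\<Sum>i = 1..m. R i j * (\<Sum>k = 1..m. R k l * S (w i) (w k)))"
        unfolding b'_def lincomb_def bilinear_form_sum(1)[OF bil]
        unfolding bilinear_form_sum(2)[OF bil] ..
      finally show "(\<Sum>i = 1..m. \<Sum>k = 1..m. A j l * R i j * R k l * S (w k) (w i))
          = A j l * S (b' l) (b' j)"
        by (simp add: sum_distrib_left mult_ac sym[of "w _" "w _"])
    qed
    also have "\<dots> = trace_prod m A (gram b' S)"
      unfolding trace_prod_def using \<open>is_basis scale b'\<close>
          by (intro sum.cong refl) (simp add: gram_def)
    finally show ?thesis .
  qed
  ultimately show ?thesis using that by blast
qed

end

section \<open>Detecting the type\<close>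

locale form_char = form_space scale Basis + nontrivial_character \<chi> q
  for scale :: "'a::{finite,field} \<Rightarrow> 'v::ab_group_add \<Rightarrow> 'v" and Basis
    and \<chi> :: "'a \<Rightarrow> complex" and q
begin

definition avg_form :: "('v \<Rightarrow> 'v \<Rightarrow> 'a) \<Rightarrow> complex" where
  "avg_form S = (\<Sum>v\<in>UNIV. \<chi> (S v v)) / q ^ m"

lemma avg_chi_gram:
  assumes b: "is_basis scale b" and S: "S \<in> sym_forms scale"
  shows "avg_chi m (gram b S) = avg_form S"
  unfolding avg_chi_def avg_form_def form_lincomb[OF b S, symmetric]
  using sum.reindex_bij_betw[OF bij_lincomb[OF b], of "\<lambda>v. \<chi> (S v v)"] by simp

text \<open>The bijection \<open>L\<close> only permutes the summands. The factor \<open>c\<close>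
  left over from the equivalence will not influence the sums over the normal forms.\<close>

lemma avg_form_equiv_coord:
  assumes "sym_equiv_coord scale f S"
  obtains c where "c \<noteq> 0" "avg_form S = (\<Sum>x\<in>vecs m. \<chi> (c * f x x)) / q ^ m"
proof -
  obtain S' b a L where b: "is_basis scale b"
    and f: "\<And>x y. S' (lincomb scale b x) (lincomb scale b y) = f x y"
    and a: "a \<noteq> 0" and L: "L \<in> general_linear scale" and S': "\<And>x y. S' x y = a * S (L x) (L y)"
    using assms unfolding sym_equiv_coord_def sym_equiv_def by metis
  have "bij L" using L by (simp add: general_linear_def)
  then have "(\<Sum>v\<in>UNIV. \<chi> (S v v)) = (\<Sum>v\<in>UNIV. \<chi> (S (L v) (L v)))"
    by (rule sum.reindex_bij_betw[symmetric])
  also have "\<dots> = (\<Sum>v\<in>UNIV. \<chi> (inverse a * S' v v))"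
    using a by (simp add: S' flip: mult.assoc)
  also have "\<dots> = (\<Sum>x\<in>vecs m. \<chi> (inverse a * S' (lincomb scale b x) (lincomb scale b x)))"
    by (rule sum.reindex_bij_betw[OF bij_lincomb[OF b], symmetric])
  finally show ?thesis
    using a by (intro that[of "inverse a"]) (simp_all add: avg_form_def f)
qed

text \<open>A coordinate that \<open>g\<close> ignores contributes a factor q, which the denominator
  cancels.\<close>

lemma sum_vecs_insensitive:
  fixes g :: "(nat \<Rightarrow> 'a) \<Rightarrow> 'a"
  assumes "n \<le> k" "\<And>x i t. i > n \<Longrightarrow> g (x(i := t)) = g x"
  shows "(\<Sum>x\<in>vecs k. \<chi> (g x)) / q ^ k = (\<Sum>x\<in>vecs n. \<chi> (g x)) / q ^ n"
  using assms(1)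
proof (induction k rule: dec_induct)
  case (step j)
  then show ?case
    by (simp add: sum_vecs_Suc assms(2) flip: sum_distrib_left)
qed simp

lemma sum_vecs_pair:
  fixes g :: "(nat \<Rightarrow> 'a) \<Rightarrow> 'a"
  assumes "\<And>x i t. i > n \<Longrightarrow> g (x(i := t)) = g x"
  shows "(\<Sum>x\<in>vecs (Suc (Suc n)). \<chi> (g x + h (x (Suc n)) (x (Suc (Suc n)))))
    = (\<Sum>x\<in>vecs n. \<chi> (g x)) * (\<Sum>s\<in>UNIV. \<Sum>t\<in>UNIV. \<chi> (h s t))"
  by (simp add: sum_vecs_Suc assms chi_add sum_distrib_right flip: sum_distrib_left)

lemma sym_hyp_upd: "i > 2 * s \<Longrightarrow> sym_hyp s (x(i := t)) (x(i := t)) = sym_hyp s x x"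
  for x :: "nat \<Rightarrow> 'a"
  unfolding sym_hyp_def by (intro sum.cong refl) auto

lemma sum_chi_2_mult:
  "c \<noteq> 0 \<Longrightarrow> (\<Sum>s\<in>UNIV. \<Sum>t\<in>UNIV. \<chi> (c * (2 * s * t))) = (if even CARD('a) then q\<^sup>2 else q)"
proof -
  assume c: "c \<noteq> 0"
  have "(\<Sum>s\<in>UNIV. \<Sum>t\<in>UNIV. \<chi> (c * (2 * s * t))) = (\<Sum>s\<in>(UNIV :: 'a set). if 2 * s = 0 then q else 0)"
    using c sum_chi_mult[of "c * (2 * _)"] by (simp add: mult.assoc)
  also have "\<dots> = (if even CARD('a) then q\<^sup>2 else q)"
    by (simp add: even_CARD_iff power2_eq_square)
  finally show ?thesis .
qed

text \<open>A plane contributes the sum of \<open>\<chi> (c * (2 * s * t))\<close>: this is q for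
  odd q, and q^2 for even q, where the form is alternating.\<close>

lemma sum_sym_hyp:
  assumes c: "c \<noteq> 0"
  shows "(\<Sum>x\<in>vecs (2 * s). \<chi> (c * sym_hyp s x x)) / q ^ (2 * s)
      = (if even CARD('a) then 1 else 1 / q ^ s)"
proof (induction s)
  case 0
  then show ?case by (simp add: vecs_0 sym_hyp_def)
next
  case (Suc s)
  have "(\<Sum>x\<in>vecs (Suc (Suc (2 * s))). \<chi> (c * sym_hyp (Suc s) x x))
      = (\<Sum>x\<in>vecs (Suc (Suc (2 * s))). \<chi> (c * sym_hyp s x x + c
          * (2 * x (Suc (2 * s)) * x (Suc (Suc (2 * s))))))"
    by (intro sum.cong refl arg_cong[where f = \<chi>]) (simp add: sym_hyp_def algebra_simps)
  also have "\<dots> = (\<Sum>x\<in>vecs (2 * s). \<chi> (c * sym_hyp s x x)) * (\<Sum>a\<in>UNIV. \<Sum>t\<in>UNIV. \<chi> (c * (2 * a * t)))"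
    by (rule sum_vecs_pair[where h = "\<lambda>a t. c * (2 * a * t)"]) (simp add: sym_hyp_upd)
  finally show ?case
    unfolding sum_chi_2_mult[OF c] using Suc by
        (simp add: field_simps power2_eq_square split: if_splits)
qed

text \<open>The last plane decides. For odd q its sum is 1 - (q + 1) = -q by
  \<open>sum_norm_values\<close>; for even q only \<open>c * t\<^sup>2\<close> remains in the
  exponent, which runs through the whole field and gives 0.\<close>

lemma sum_sym_ell:
  assumes c: "c \<noteq> 0" and eta: "odd CARD('a) \<Longrightarrow> \<nexists>x. eta = x\<^sup>2" and s: "s \<ge> 1"
  shows "(\<Sum>x\<in>vecs (2 * s). \<chi> (c * sym_ell eta s x x)) / q ^ (2 * s)
      = (if even CARD('a) then 0 else - 1 / q ^ s)"
proof -
  obtain s' where s': "s = Suc s'" using s by (cases s) auto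
  define h where "h a t = c * (if even CARD('a) then t\<^sup>2 else a\<^sup>2 - eta * t\<^sup>2)" for a t
  have h: "(\<Sum>a\<in>UNIV. \<Sum>t\<in>UNIV. \<chi> (h a t)) = (if even CARD('a) then 0 else - q)"
  proof (cases "even CARD('a)")
    case True
    then have "(\<Sum>t\<in>UNIV. \<chi> (c * t\<^sup>2)) = (\<Sum>t\<in>UNIV. \<chi> (c * t))"
      by (intro sum.reindex_bij_betw bij_square) (simp add: even_CARD_iff)
    then show ?thesis
      using True c by (simp add: h_def sum_chi_mult)
  next
    case False
    have "(\<Sum>a\<in>UNIV. \<Sum>t\<in>UNIV. \<chi> (c * (a\<^sup>2 - eta * t\<^sup>2))) = - q"
      using sum_norm_values[of eta "\<lambda>z. \<chi> (c * z)"] False eta c sum_chi_nonzero[of c]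
      by (simp add: even_CARD_iff)
    then show ?thesis using False by (simp add: h_def)
  qed
  have "(\<Sum>x\<in>vecs (Suc (Suc (2 * s'))). \<chi> (c * sym_ell eta s x x))
      = (\<Sum>x\<in>vecs (Suc (Suc (2 * s'))). \<chi> (c * sym_hyp s' x x
          + h (x (Suc (2 * s'))) (x (Suc (Suc (2 * s'))))))"
  proof (intro sum.cong refl arg_cong[where f = \<chi>])
    fix x :: "nat \<Rightarrow> 'a"
    have "a * b + b * a = 0" if "even CARD('a)" for a b :: 'a
      using that even_CARD_iff[where 'a = 'a] by (metis mult.commute mult_2 mult_zero_left)
    then show "c * sym_ell eta s x x = c * sym_hyp s' x x
        + h (x (Suc (2 * s'))) (x (Suc (Suc (2 * s'))))"
      by (simp add: s' sym_ell_def h_def power2_eq_square algebra_simps even_CARD_iff)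
  qed
  also have "\<dots> = (\<Sum>x\<in>vecs (2 * s'). \<chi> (c * sym_hyp s' x x)) * (\<Sum>a\<in>UNIV. \<Sum>t\<in>UNIV. \<chi> (h a t))"
    by (rule sum_vecs_pair) (simp add: sym_hyp_upd)
  finally show ?thesis
    unfolding h using sum_sym_hyp[OF c, of s']
        by (simp add: s' field_simps power2_eq_square split: if_splits)
qed

lemma sym_ell_upd: "i > 2 * s \<Longrightarrow> sym_ell eta s (x(i := t)) (x(i := t)) = sym_ell eta s x x"
  for x :: "nat \<Rightarrow> 'a"
  unfolding sym_ell_def by (auto simp: sym_hyp_upd)

lemma sym_rank_le: "sym_rank scale S \<le> m"
  by (simp add: sym_rank_def codimension_def)

lemma avg_form_type:
  assumes "sym_has_type scale eta S \<tau>" and rank: "sym_rank scale S = 2 * s" and s: "s \<ge> 1"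
    and eta: "odd CARD('a) \<Longrightarrow> \<nexists>x. eta = x\<^sup>2"
  shows "avg_form S = (if even CARD('a) then (if \<tau> = 1 then 1 else 0) else of_int \<tau> / q ^ s)"
proof -
  have s2: "2 * s \<le> m" using sym_rank_le[of S] rank by simp
  consider "\<tau> = 1" "sym_equiv_coord scale (sym_hyp s) S" | "\<tau> = - 1"
      "sym_equiv_coord scale (sym_ell eta s) S"
    using assms(1) rank s unfolding sym_has_type_def by auto
  then show ?thesis
  proof cases
    case 1
    obtain c where c: "c \<noteq> 0" "avg_form S = (\<Sum>x\<in>vecs m. \<chi> (c * sym_hyp s x x)) / q ^ m"
      using avg_form_equiv_coord[OF 1(2)] .
    have "avg_form S = (\<Sum>x\<in>vecs (2 * s). \<chi> (c * sym_hyp s x x)) / q ^ (2 * s)"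
      unfolding c(2) by (rule sum_vecs_insensitive[OF s2]) (simp add: sym_hyp_upd)
    then show ?thesis
      using 1 by (simp add: sum_sym_hyp[OF c(1)])
  next
    case 2
    obtain c where c: "c \<noteq> 0" "avg_form S = (\<Sum>x\<in>vecs m. \<chi> (c * sym_ell eta s x x)) / q ^ m"
      using avg_form_equiv_coord[OF 2(2)] .
    have "avg_form S = (\<Sum>x\<in>vecs (2 * s). \<chi> (c * sym_ell eta s x x)) / q ^ (2 * s)"
      unfolding c(2) by (rule sum_vecs_insensitive[OF s2]) (simp add: sym_ell_upd)
    then show ?thesis
      using 2 by (simp add: sum_sym_ell[OF c(1) eta s])
  qed
qed

end

text \<open>The multiples of \<open>b\<close> by nonzero squares are nonsquares, and by
  \<open>card_squares\<close> there are as many of them as there are nonsquares.\<close>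

lemma nonsquare_ratio:
  fixes a b :: "'a::{finite,field}"
  assumes 2: "(2 :: 'a) \<noteq> 0" and a: "\<nexists>x. a = x\<^sup>2" and b: "\<nexists>x. b = x\<^sup>2"
  obtains t where "t \<noteq> 0" "a = b * t\<^sup>2"
proof -
  let ?S = "range (\<lambda>x :: 'a. x\<^sup>2)"
  have b0: "b \<noteq> 0" using b by (metis zero_power2)
  have sub: "(\<lambda>z. b * z) ` (?S - {0}) \<subseteq> UNIV - ?S"
  proof (rule image_subsetI)
    fix z assume "z \<in> ?S - {0}"
    then obtain x where x: "z = x\<^sup>2" "x \<noteq> 0" by auto
    have False if "b * z = y\<^sup>2" for y
    proof -
      have "b = (y / x)\<^sup>2" using that x by (simp add: power_divide field_simps)
      then show False using b by blast
    qed
    then show "b * z \<in> UNIV - ?S" by blast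
  qed
  have "card ((\<lambda>z. b * z) ` (?S - {0})) = card (?S - {0})"
    using b0 by (intro card_image inj_onI) simp
  also have "\<dots> = card ?S - 1"
    by (intro card_Diff_singleton) (auto intro: image_eqI[of _ _ 0])
  also have "\<dots> = CARD('a) - card ?S"
    using card_squares[OF 2] by simp
  also have "\<dots> = card (UNIV - ?S)"
    by (simp add: card_Diff_subset)
  finally have "(\<lambda>z. b * z) ` (?S - {0}) = UNIV - ?S"
    using sub by (intro card_subset_eq) auto
  moreover have "a \<in> UNIV - ?S" using a by auto
  ultimately have "a \<in> (\<lambda>z. b * z) ` (?S - {0})" by simp
  then obtain z where z: "a = b * z" "z \<in> ?S - {0}" by (rule imageE)
  then obtain t where "z = t\<^sup>2" "t \<noteq> 0" by auto
  then show ?thesis using that[of t] z by simp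
qed

section \<open>Classification\<close>

context form_space
begin

definition comb :: "nat \<Rightarrow> (nat \<Rightarrow> 'v) \<Rightarrow> (nat \<Rightarrow> 'a) \<Rightarrow> 'v" where
  "comb n b c = (\<Sum>i = 1..n. scale (c i) (b i))"

text \<open>Used with n the dimension of \<open>W\<close>. Independence is recovered by
  \<open>is_basisI\<close>, after completion to m vectors.\<close>

definition spanning :: "'v set \<Rightarrow> nat \<Rightarrow> (nat \<Rightarrow> 'v) \<Rightarrow> bool" where
  "spanning W n b \<longleftrightarrow> (\<forall>i\<in>{1..n}. b i \<in> W) \<and> (\<forall>x\<in>W. \<exists>c. x = comb n b c)"

lemma comb_in_subspace: "subspace W \<Longrightarrow> (\<And>i. i \<in> {1..n} \<Longrightarrow> b i \<in> W) \<Longrightarrow> comb n b c \<in> W"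
  unfolding comb_def by (intro subspace_sum subspace_scale) auto

lemma comb_cong: "(\<And>i. i \<in> {1..n} \<Longrightarrow> b i = b' i) \<Longrightarrow> (\<And>i. i \<in> {1..n} \<Longrightarrow> c i = c' i) \<Longrightarrow> comb n b c
    = comb n b' c'"
  by (simp add: comb_def)

lemma comb_append: "comb (n + k) (\<lambda>i. if i \<le> n then b i else r (i - n)) c
    = comb n b c + comb k r (\<lambda>i. c (i + n))"
proof (induction k)
  case 0
  then show ?case by (auto simp: comb_def intro: sum.cong)
next
  case (Suc k)
  then show ?case by (simp add: comb_def add.assoc add.commute[of k n])
qed

lemma comb_2: "comb 2 b c = scale (c 1) (b 1) + scale (c 2) (b 2)"
  by (simp add: comb_def numeral_2_eq_2)

lemma spanning_appendI:
  assumes b: "spanning U n b" and r: "\<And>i. i \<in> {1..k} \<Longrightarrow> r i \<in> W" and U: "U \<subseteq> W"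
    and split: "\<And>x. x \<in> W \<Longrightarrow> \<exists>u\<in>U. \<exists>c. x = u + comb k r c"
  shows "spanning W (n + k) (\<lambda>i. if i \<le> n then b i else r (i - n))"
  unfolding spanning_def
proof (intro conjI ballI)
  fix i assume "i \<in> {1..n + k}"
  then have "i \<in> {1..n} \<or> i - n \<in> {1..k} \<and> \<not> i \<le> n" by auto
  then show "(if i \<le> n then b i else r (i - n)) \<in> W"
    using b U r by (auto simp: spanning_def)
next
  fix x assume "x \<in> W"
  then obtain u c where u: "u \<in> U" "x = u + comb k r c" using split by blast
  obtain d where d: "u = comb n b d" using u b by (auto simp: spanning_def)
  have "comb (n + k) (\<lambda>i. if i \<le> n then b i else r (i - n)) (\<lambda>i. if i \<le> n then d i else c (i - n))
      = comb n b d + comb k r c"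
    unfolding comb_append by (intro arg_cong2[where f = "(+)"] comb_cong) auto
  then show "\<exists>c. x = comb (n + k) (\<lambda>i. if i \<le> n then b i else r (i - n)) c"
    using u d by metis
qed

text \<open>The order of the vectors matters, because \<open>sym_ell\<close> has its exceptional
  plane in the last two coordinates.\<close>

lemma spanning_prependI:
  assumes b: "spanning U n b" and r: "\<And>i. i \<in> {1..k} \<Longrightarrow> r i \<in> W" and U: "U \<subseteq> W"
    and split: "\<And>x. x \<in> W \<Longrightarrow> \<exists>u\<in>U. \<exists>c. x = u + comb k r c"
  shows "spanning W (k + n) (\<lambda>i. if i \<le> k then r i else b (i - k))"
  unfolding spanning_def
proof (intro conjI ballI)
  fix i assume "i \<in> {1..k + n}"
  then have "i \<in> {1..k} \<or> i - k \<in> {1..n} \<and> \<not> i \<le> k" by auto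
  then show "(if i \<le> k then r i else b (i - k)) \<in> W"
    using b U r by (auto simp: spanning_def)
next
  fix x assume "x \<in> W"
  then obtain u c where u: "u \<in> U" "x = u + comb k r c" using split by blast
  obtain d where d: "u = comb n b d" using u b by (auto simp: spanning_def)
  have "comb (k + n) (\<lambda>i. if i \<le> k then r i else b (i - k)) (\<lambda>i. if i \<le> k then c i else d (i - k))
      = comb k r c + comb n b d"
    unfolding comb_append by (intro arg_cong2[where f = "(+)"] comb_cong) auto
  also have "\<dots> = x"
    using u d by (simp add: add.commute)
  finally show "\<exists>c. x = comb (k + n) (\<lambda>i. if i \<le> k then r i else b (i - k)) c"
    by (intro exI) (rule sym)
qed

lemma finite_space: "finite (W :: 'v set)"
proof -
  have "card (UNIV :: 'v set) = CARD('a) ^ dim UNIV"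
    by (rule card_subspace) simp
  then have "card (UNIV :: 'v set) > 0" by simp
  then show ?thesis by (metis card_gt_0_iff finite_subset subset_UNIV)
qed

lemma exists_nonzero: "subspace W \<Longrightarrow> card W > 1 \<Longrightarrow> \<exists>v\<in>W. v \<noteq> 0"
proof (rule ccontr)
  assume "card W > 1" "\<not> (\<exists>v\<in>W. v \<noteq> 0)"
  then have "W \<subseteq> {0}" by blast
  then have "card W \<le> card {0 :: 'v}" by (intro card_mono) auto
  then show False using \<open>card W > 1\<close> by simp
qed

lemma exists_not_in_line:
  assumes "card W > CARD('a)"
  shows "\<exists>w\<in>W. \<forall>t. w \<noteq> scale t v"
proof (rule ccontr)
  assume "\<not> (\<exists>w\<in>W. \<forall>t. w \<noteq> scale t v)"
  then have "W \<subseteq> range (\<lambda>t. scale t v)" by blast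
  then have "card W \<le> card (range (\<lambda>t. scale t v))" by (intro card_mono) auto
  also have "\<dots> \<le> CARD('a)" by (rule card_image_le) simp
  finally show False using assms by simp
qed

lemma line_eq:
  assumes W: "subspace W" and card: "card W = CARD('a)" and v: "v \<in> W" "v \<noteq> 0"
  shows "W = range (\<lambda>t. scale t v)"
proof -
  have "card (range (\<lambda>t. scale t v)) = CARD('a)"
    using v by (intro card_image inj_onI) simp
  moreover have "range (\<lambda>t. scale t v) \<subseteq> W"
    using W v by (auto intro: subspace_scale)
  ultimately show ?thesis
    using card card_subset_eq[OF finite_space] by metis
qed

text \<open>Subtracting a fixed point of a nonempty fibre embeds that fibre in the kernel. This
  replaces dimension counts for orthogonal complements.\<close>

lemma card_le_kernel:
  fixes \<phi> :: "'v \<Rightarrow> 'a"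
  assumes W: "subspace W" and \<phi>: "\<And>x y. \<phi> (x + y) = \<phi> x + \<phi> y"
  shows "card W \<le> CARD('a) * card {x \<in> W. \<phi> x = 0}"
proof -
  have fin: "finite W" by (rule finite_space)
  have le: "card {x \<in> W. \<phi> x = t} \<le> card {x \<in> W. \<phi> x = 0}" for t
  proof (cases "{x \<in> W. \<phi> x = t} = {}")
    case True
    then show ?thesis by (simp only: card.empty le0)
  next
    case False
    then obtain z where z: "z \<in> W" "\<phi> z = t" by blast
    have "\<phi> (x - z) + \<phi> z = \<phi> x" for x using \<phi>[of "x - z" z] by simp
    then have "\<phi> (x - z) = 0" if "\<phi> x = t" for x using that z
        by (metis add_cancel_right_left add.commute)
    then have "(\<lambda>x. x - z) ` {x \<in> W. \<phi> x = t} \<subseteq> {x \<in> W. \<phi> x = 0}"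
      using z W by (auto intro: subspace_diff)
    then show ?thesis
      using fin by (intro card_inj_on_le[of "\<lambda>x. x - z"]) (auto intro: inj_onI)
  qed
  have "card W = (\<Sum>x\<in>W. 1)" by simp
  also have "\<dots> = (\<Sum>t\<in>UNIV. \<Sum>x\<in>{x \<in> W. \<phi> x = t}. 1)"
    by (rule sum.group[symmetric]) (auto simp: fin)
  also have "\<dots> \<le> (\<Sum>t\<in>(UNIV :: 'a set). card {x \<in> W. \<phi> x = 0})"
    using le by (intro sum_mono) simp
  finally show ?thesis by simp
qed

section \<open>Splitting off planes from a symmetric form\<close>

context
  fixes S assumes S: "S \<in> sym_forms scale"
begin

lemma form_simps:
  "S (x + y) z = S x z + S y z" "S (scale c x) z = c * S x z"
  "S z (x + y) = S z x + S z y" "S z (scale c x) = c * S z x"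
  "S 0 z = 0" "S z 0 = 0"
  using S by (auto simp: sym_forms_def bilinear_formD bilinear_form_zero)

lemma form_sym: "S x y = S y x"
  using S by (simp add: sym_forms_def)

lemma form_diff: "S (x - y) z = S x z - S y z" "S z (x - y) = S z x - S z y"
  using form_simps(1)[of "x - y" y z] form_simps(3)[of z "x - y" y] by simp_all

lemma subspace_perp: "subspace W \<Longrightarrow> subspace {x \<in> W. S x v = 0}"
  by (auto simp: subspace_def form_simps)

definition nondegenerate :: "'v set \<Rightarrow> bool" where
  "nondegenerate W \<longleftrightarrow> (\<forall>x\<in>W. (\<forall>y\<in>W. S x y = 0) \<longrightarrow> x = 0)"

text \<open>A pair \<open>e\<close>, \<open>f\<close> with Gram matrix \<open>(0, 1; 1, c)\<close> splits off as an orthogonal summand.\<close>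

lemma pair_split:
  assumes W: "subspace W" and ef: "e \<in> W" "f \<in> W" "S e e = 0" "S e f = 1"
  defines "U \<equiv> {x \<in> W. S x e = 0 \<and> S x f = 0}"
  shows "subspace U" "card W = CARD('a)\<^sup>2 * card U"
    and "\<And>x. x \<in> W \<Longrightarrow> \<exists>u\<in>U. \<exists>\<alpha> \<beta>. x = u + (scale \<alpha> e + scale \<beta> f)"
    and "nondegenerate W \<Longrightarrow> nondegenerate U"
proof -
  have fe: "S f e = 1" using ef form_sym by metis
  show U: "subspace U"
    using W by (auto simp: U_def subspace_def form_simps)
  define \<beta> where "\<beta> x = S x e" for x
  define \<alpha> where "\<alpha> x = S x f - S f f * S x e" for x
  have coef: "\<alpha> (u + (scale a e + scale b f)) = a" "\<beta> (u + (scale a e + scale b f)) = b" if "u \<in> U"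
      for u a b
    using that ef fe by (simp_all add: \<alpha>_def \<beta>_def U_def form_simps algebra_simps)
  have dec: "x - (scale (\<alpha> x) e + scale (\<beta> x) f) \<in> U" if "x \<in> W" for x
    using that W ef fe
    by (simp add: U_def form_simps form_diff \<alpha>_def \<beta>_def subspace_diff subspace_add subspace_scale
        algebra_simps)
  show split: "\<exists>u\<in>U. \<exists>\<alpha> \<beta>. x = u + (scale \<alpha> e + scale \<beta> f)" if "x \<in> W" for x
    using dec[OF that] by (metis diff_add_cancel)
  have UW: "U \<subseteq> W" by (auto simp: U_def)
  have "bij_betw (\<lambda>(u, a, b). u + (scale a e + scale b f)) (U \<times> UNIV \<times> UNIV) W"
  proof (rule bij_betw_byWitness[where f' = "\<lambda>x. (x - (scale (\<alpha> x) e + scale (\<beta> x) f), \<alpha> x, \<beta> x)"])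
    show "(\<lambda>(u, a, b). u + (scale a e + scale b f)) ` (U \<times> UNIV \<times> UNIV) \<subseteq> W"
      using UW W ef by (auto intro!: subspace_add subspace_scale)
    show "(\<lambda>x. (x - (scale (\<alpha> x) e + scale (\<beta> x) f), \<alpha> x, \<beta> x)) ` W \<subseteq> U \<times> UNIV \<times> UNIV"
      using dec by auto
  qed (auto simp: coef)
  from bij_betw_same_card[OF this] show "card W = CARD('a)\<^sup>2 * card U"
    by (simp add: card_cartesian_product power2_eq_square mult_ac)
  show "nondegenerate U" if nd: "nondegenerate W"
    unfolding nondegenerate_def
  proof (intro ballI impI)
    fix x assume x: "x \<in> U" "\<forall>y\<in>U. S x y = 0"
    have "S x y = 0" if y: "y \<in> W" for y
      using split[OF y] x by (auto simp: form_simps U_def)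
    then show "x = 0" using nd x UW unfolding nondegenerate_def by blast
  qed
qed

lemma nondegenerate_partner:
  assumes W: "subspace W" and nd: "nondegenerate W" and e: "e \<in> W" "e \<noteq> 0"
  obtains g where "g \<in> W" "S e g = 1"
proof -
  obtain y where y: "y \<in> W" "S e y \<noteq> 0" using nd e unfolding nondegenerate_def by blast
  have "S e (scale (inverse (S e y)) y) = 1" using y by (simp add: form_simps)
  moreover have "scale (inverse (S e y)) y \<in> W" using y W by (intro subspace_scale)
  ultimately show ?thesis using that by blast
qed

text \<open>Repeated use of \<open>card_le_kernel\<close> yields three mutually orthogonal nonzero
  vectors. If none is isotropic, \<open>ex_sum_two_squares\<close> makes a combination of the first
  two cancel the value at the third.\<close>

lemma isotropic_exists_odd:
  assumes 2: "(2 :: 'a) \<noteq> 0" and W: "subspace W" and card: "card W \<ge> CARD('a) ^ 3"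
  obtains v where "v \<in> W" "v \<noteq> 0" "S v v = 0"
proof -
  have q: "CARD('a) > 1" using CARD_ge_2[where 'a = 'a] by simp
  have "CARD('a) ^ 0 < CARD('a) ^ 3" using q by (intro power_strict_increasing) auto
  then have "card W > 1" using card by simp
  then obtain v1 where v1: "v1 \<in> W" "v1 \<noteq> 0" using exists_nonzero[OF W] by blast
  let ?W1 = "{x \<in> W. S x v1 = 0}"
  have W1: "subspace ?W1" using subspace_perp[OF W] .
  have "CARD('a) * CARD('a)\<^sup>2 \<le> card W"
    using card by (simp add: power3_eq_cube power2_eq_square mult_ac)
  also have "\<dots> \<le> CARD('a) * card ?W1"
    by (rule card_le_kernel[OF W]) (simp add: form_simps)
  finally have c1: "card ?W1 \<ge> CARD('a)\<^sup>2" using q by simp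
  moreover have "CARD('a) ^ 0 < CARD('a)\<^sup>2" using q by (intro power_strict_increasing) auto
  ultimately have "card ?W1 > 1" by simp
  then obtain v2 where v2: "v2 \<in> ?W1" "v2 \<noteq> 0" using exists_nonzero[OF W1] by blast
  let ?W2 = "{x \<in> ?W1. S x v2 = 0}"
  have W2: "subspace ?W2" using subspace_perp[OF W1] .
  have "CARD('a) * CARD('a) \<le> card ?W1"
    using c1 by (simp add: power2_eq_square)
  also have "\<dots> \<le> CARD('a) * card ?W2"
    by (rule card_le_kernel[OF W1]) (simp add: form_simps)
  finally have "card ?W2 > 1" using q by simp
  then obtain v3 where v3: "v3 \<in> ?W2" "v3 \<noteq> 0" using exists_nonzero[OF W2] by blast
  show ?thesis
  proof (cases "S v1 v1 = 0 \<or> S v2 v2 = 0 \<or> S v3 v3 = 0")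
    case True
    then show ?thesis using that v1 v2 v3 by blast
  next
    case False
    then obtain x y where xy: "S v1 v1 * x\<^sup>2 + S v2 v2 * y\<^sup>2 = - S v3 v3"
      using ex_sum_two_squares[OF 2] by metis
    let ?v = "scale x v1 + scale y v2 + v3"
    have o: "S v2 v1 = 0" "S v1 v2 = 0" "S v3 v1 = 0" "S v1 v3 = 0" "S v3 v2 = 0" "S v2 v3 = 0"
      using v2 v3 form_sym by auto
    have "S ?v ?v = S v1 v1 * x\<^sup>2 + S v2 v2 * y\<^sup>2 + S v3 v3"
      by (simp add: form_simps o power2_eq_square algebra_simps)
    then have "S ?v ?v = 0" using xy by simp
    moreover have "S ?v v3 = S v3 v3" by (simp add: form_simps o)
    then have "?v \<noteq> 0" using False form_simps(5)[of v3] by metis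
    moreover have "?v \<in> W" using v1 v2 v3 W by (auto intro!: subspace_add subspace_scale)
    ultimately show ?thesis using that by blast
  qed
qed

end

end

lemma sum_shift_1: "(\<Sum>i = 1..Suc s. f i) = f 1 + (\<Sum>i = 1..s. f (Suc i))"
  for f :: "nat \<Rightarrow> 'a::comm_monoid_add"
  by (simp add: sum.atLeast_Suc_atMost sum.shift_bounds_cl_Suc_ivl del: sum.cl_ivl_Suc)

lemma sym_hyp_Suc:
  "sym_hyp (Suc s) x y = x 1 * y 2 + x 2 * y 1 + sym_hyp s (\<lambda>i. x (i + 2)) (\<lambda>i. y (i + 2))"
proof -
  have "(\<Sum>i = 1..s. x (2 * Suc i - 1) * y (2 * Suc i) + x (2 * Suc i) * y (2 * Suc i - 1))
      = (\<Sum>i = 1..s. x (2 * i - 1 + 2) * y (2 * i + 2) + x (2 * i + 2) * y (2 * i - 1 + 2))"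
  proof (intro sum.cong refl)
    fix i assume "i \<in> {1..s}"
    then have "2 * Suc i - 1 = 2 * i - 1 + 2" "2 * Suc i = 2 * i + 2" by auto
    then show "x (2 * Suc i - 1) * y (2 * Suc i) + x (2 * Suc i) * y (2 * Suc i - 1)
      = x (2 * i - 1 + 2) * y (2 * i + 2) + x (2 * i + 2) * y (2 * i - 1 + 2)" by (simp only:)
  qed
  then show ?thesis
    unfolding sym_hyp_def sum_shift_1 by (simp add: numeral_2_eq_2)
qed

lemma sym_ell_Suc:
  assumes "s \<ge> 1"
  shows "sym_ell eta (Suc s) x y = x 1 * y 2 + x 2 * y 1
      + sym_ell eta s (\<lambda>i. x (i + 2)) (\<lambda>i. y (i + 2))"
proof -
  obtain t where t: "s = Suc t" using assms by (cases s) auto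
  have "sym_hyp s x y = x 1 * y 2 + x 2 * y 1 + sym_hyp (s - 1) (\<lambda>i. x (i + 2)) (\<lambda>i. y (i + 2))"
    unfolding t by (simp add: sym_hyp_Suc)
  moreover have "2 * Suc s - 1 = 2 * s - 1 + 2" "2 * Suc s = 2 * s + 2" using assms by auto
  ultimately show ?thesis
    unfolding sym_ell_def by (simp add: add.assoc)
qed

context form_space
begin

context
  fixes S assumes S: "S \<in> sym_forms scale"
begin

text \<open>\<open>S f f\<close> stays arbitrary here, as is required for the last plane of
  \<open>sym_ell\<close> in characteristic 2.\<close>

lemma pair_append:
  assumes W: "subspace W" and ef: "e \<in> W" "f \<in> W" "S e e = 0" "S e f = 1"
    and b: "spanning {x \<in> W. S x e = 0 \<and> S x f = 0} n b"
  defines "b' \<equiv> \<lambda>i. if i \<le> n then b i else if i - n = 1 then e else f"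
  shows "spanning W (n + 2) b'"
    and "comb (n + 2) b' x = comb n b x + (scale (x (n + 1)) e + scale (x (n + 2)) f)"
    and "S (comb (n + 2) b' x) (comb (n + 2) b' y) = S (comb n b x) (comb n b y)
      + (x (n + 1) * y (n + 2) + x (n + 2) * y (n + 1) + S f f * (x (n + 2) * y (n + 2)))"
proof -
  let ?U = "{x \<in> W. S x e = 0 \<and> S x f = 0}"
  let ?r = "\<lambda>i. if i = (1 :: nat) then e else f"
  have r: "comb 2 ?r c = scale (c 1) e + scale (c 2) f" for c by (simp add: comb_2)
  show "spanning W (n + 2) b'"
    unfolding b'_def
  proof (rule spanning_appendI[OF b, where r = ?r])
    fix x assume "x \<in> W"
    then obtain u \<alpha> \<beta> where "u \<in> ?U" "x = u + (scale \<alpha> e + scale \<beta> f)"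
      using pair_split(3)[OF S W ef] by blast
    then show "\<exists>u\<in>?U. \<exists>c. x = u + comb 2 ?r c"
      unfolding r by (intro bexI[of _ u] exI[of _ "\<lambda>i. if i = 1 then \<alpha> else \<beta>"]) auto
  qed (use ef in auto)
  have comb: "comb (n + 2) b' x = comb n b x + (scale (x (n + 1)) e + scale (x (n + 2)) f)" for x
    unfolding b'_def comb_append[of n 2 b ?r] r by (simp add: add.commute)
  then show "comb (n + 2) b' x = comb n b x + (scale (x (n + 1)) e + scale (x (n + 2)) f)" .
  have "comb n b c \<in> ?U" for c
    using b by (intro comb_in_subspace pair_split(1)[OF S W ef]) (auto simp: spanning_def)
  then have o: "S (comb n b c) e = 0" "S (comb n b c) f = 0" "S e (comb n b c) = 0"
      "S f (comb n b c) = 0" for c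
    using form_sym[OF S] by auto
  have fe: "S f e = 1" using ef form_sym[OF S] by metis
  show "S (comb (n + 2) b' x) (comb (n + 2) b' y) = S (comb n b x) (comb n b y)
      + (x (n + 1) * y (n + 2) + x (n + 2) * y (n + 1) + S f f * (x (n + 2) * y (n + 2)))"
    unfolding comb by (simp add: form_simps[OF S] o ef fe algebra_simps)
qed

text \<open>A hyperbolic pair goes in front, where both normal forms can lose a hyperbolic plane
  (\<open>sym_hyp_Suc\<close>, \<open>sym_ell_Suc\<close>).\<close>

lemma pair_prepend:
  assumes W: "subspace W" and ef: "e \<in> W" "f \<in> W" "S e e = 0" "S e f = 1" "S f f = 0"
    and b: "spanning {x \<in> W. S x e = 0 \<and> S x f = 0} n b"
  defines "b' \<equiv> \<lambda>i. if i \<le> 2 then if i = 1 then e else f else b (i - 2)"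
  shows "spanning W (2 + n) b'"
    and "S (comb (2 + n) b' x) (comb (2 + n) b' y) = x 1 * y 2 + x 2 * y 1
      + S (comb n b (\<lambda>i. x (i + 2))) (comb n b (\<lambda>i. y (i + 2)))"
proof -
  let ?U = "{x \<in> W. S x e = 0 \<and> S x f = 0}"
  let ?r = "\<lambda>i. if i = (1 :: nat) then e else f"
  have r: "comb 2 ?r c = scale (c 1) e + scale (c 2) f" for c by (simp add: comb_2)
  show "spanning W (2 + n) b'"
    unfolding b'_def
  proof (rule spanning_prependI[OF b, where r = ?r])
    fix x assume "x \<in> W"
    then obtain u \<alpha> \<beta> where "u \<in> ?U" "x = u + (scale \<alpha> e + scale \<beta> f)"
      using pair_split(3)[OF S W ef(1-4)] by blast
    then show "\<exists>u\<in>?U. \<exists>c. x = u + comb 2 ?r c"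
      unfolding r by (intro bexI[of _ u] exI[of _ "\<lambda>i. if i = 1 then \<alpha> else \<beta>"]) auto
  qed (use ef in auto)
  have comb: "comb (2 + n) b' x = (scale (x 1) e + scale (x 2) f) + comb n b (\<lambda>i. x (i + 2))" for x
    unfolding b'_def comb_append[of 2 n ?r b] r ..
  have "comb n b c \<in> ?U" for c
    using b by (intro comb_in_subspace pair_split(1)[OF S W ef(1-4)]) (auto simp: spanning_def)
  then have o: "S (comb n b c) e = 0" "S (comb n b c) f = 0" "S e (comb n b c) = 0"
      "S f (comb n b c) = 0" for c
    using form_sym[OF S] by auto
  have fe: "S f e = 1" using ef form_sym[OF S] by metis
  show "S (comb (2 + n) b' x) (comb (2 + n) b' y) = x 1 * y 2 + x 2 * y 1
      + S (comb n b (\<lambda>i. x (i + 2))) (comb n b (\<lambda>i. y (i + 2)))"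
    unfolding comb by (simp add: form_simps[OF S] o ef fe algebra_simps)
qed

lemma spanning_0: "subspace W \<Longrightarrow> card W = 1 \<Longrightarrow> spanning W 0 b"
  using card_1_singletonE[of W] by (auto simp: spanning_def comb_def dest: subspace_0)

lemma pair_card:
  assumes W: "subspace W" and ef: "e \<in> W" "f \<in> W" "S e e = 0" "S e f = 1"
    and "card W = CARD('a) ^ (2 * Suc s)"
  shows "card {x \<in> W. S x e = 0 \<and> S x f = 0} = CARD('a) ^ (2 * s)"
proof -
  have "CARD('a)\<^sup>2 * card {x \<in> W. S x e = 0 \<and> S x f = 0} = CARD('a)\<^sup>2 * CARD('a) ^ (2 * s)"
    using pair_split(2)[OF S W ef] assms(6) by (simp add: power_add power2_eq_square)
  then show ?thesis by simp
qed

lemma hyperbolic_pair_odd: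
  assumes 2: "(2 :: 'a) \<noteq> 0" and W: "subspace W" and nd: "nondegenerate S W"
    and e: "e \<in> W" "e \<noteq> 0" "S e e = 0"
  obtains f where "f \<in> W" "S e f = 1" "S f f = 0"
proof -
  obtain g where g: "g \<in> W" "S e g = 1"
    using nondegenerate_partner[OF S W nd e(1,2)] .
  have ge: "S g e = 1" using g form_sym[OF S] by metis
  \<comment> \<open>The value of the form at \<open>g + h e\<close> is \<open>S g g + 2 * h\<close>,
    which this choice makes 0.\<close>
  define h where "h = - (S g g / 2)"
  let ?f = "g + scale h e"
  have "S ?f ?f = S g g + 2 * h"
    by (simp add: form_simps[OF S] e g ge)
  then have "S ?f ?f = 0" using 2 by (simp add: h_def)
  moreover have "S e ?f = 1" by (simp add: form_simps[OF S] e g)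
  moreover have "?f \<in> W" using g e W by (intro subspace_add subspace_scale)
  ultimately show ?thesis using that by blast
qed

text \<open>Such a plane contains a vector \<open>e\<close> of value 1. On its complement the value
  is minus a nonsquare, as otherwise some \<open>t e + f0\<close> would be isotropic, and
  \<open>nonsquare_ratio\<close> permits scaling it to \<open>- eta\<close>.\<close>

lemma anisotropic_plane_odd:
  assumes 2: "(2 :: 'a) \<noteq> 0" and eta: "\<nexists>x. eta = x\<^sup>2" and W: "subspace W"
    and card: "card W = CARD('a)\<^sup>2" and an: "\<And>v. v \<in> W \<Longrightarrow> S v v = 0 \<Longrightarrow> v = 0"
  obtains b where "spanning W 2 b" "\<And>x y. S (comb 2 b x) (comb 2 b y)
      = x 1 * y 1 - eta * (x 2 * y 2)"
proof -
  have q: "CARD('a) > 1" using CARD_ge_2[where 'a = 'a] by simp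
  have nz: "\<exists>v2\<in>W. S v2 v = 0 \<and> v2 \<noteq> 0" for v
  proof -
    have "CARD('a) * CARD('a) \<le> card W" using card by (simp add: power2_eq_square)
    also have "\<dots> \<le> CARD('a) * card {x \<in> W. S x v = 0}"
      by (rule card_le_kernel[OF W]) (simp add: form_simps[OF S])
    finally have "card {x \<in> W. S x v = 0} > 1" using q by simp
    from exists_nonzero[OF subspace_perp[OF S W] this] show ?thesis by blast
  qed
  obtain v1 where v1: "v1 \<in> W" "v1 \<noteq> 0" using nz by blast
  obtain v2 where v2: "v2 \<in> W" "S v2 v1 = 0" "v2 \<noteq> 0" using nz by blast
  have "S v1 v1 \<noteq> 0" "S v2 v2 \<noteq> 0" using an v1 v2 by blast+
  then obtain x y where xy: "S v1 v1 * x\<^sup>2 + S v2 v2 * y\<^sup>2 = 1"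
    using ex_sum_two_squares[OF 2] by metis
  define e where "e = scale x v1 + scale y v2"
  have "S v1 v2 = 0" using v2 form_sym[OF S] by metis
  then have ee: "S e e = 1"
    using xy by (simp add: e_def form_simps[OF S] v2 power2_eq_square algebra_simps)
  have eW: "e \<in> W" using v1 v2 W by (simp add: e_def subspace_add subspace_scale)
  obtain f0 where f0: "f0 \<in> W" "S f0 e = 0" "f0 \<noteq> 0" using nz by blast
  have ef0: "S e f0 = 0" using f0 form_sym[OF S] by metis
  have ns: "\<nexists>t. - S f0 f0 = t\<^sup>2"
  proof
    assume "\<exists>t. - S f0 f0 = t\<^sup>2"
    then obtain t where t: "- S f0 f0 = t\<^sup>2" by blast
    let ?v = "scale t e + f0"
    have "S ?v ?v = t\<^sup>2 + S f0 f0" by (simp add: form_simps[OF S] ee f0 ef0 power2_eq_square)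
    then have "S ?v ?v = 0" by (simp flip: t)
    then have "?v = 0" using an[of ?v] eW f0 W by (simp add: subspace_add subspace_scale)
    moreover have "S ?v f0 = S f0 f0" by (simp add: form_simps[OF S] ef0)
    ultimately have "S f0 f0 = 0" by (simp add: form_simps[OF S])
    then show False using an f0 by blast
  qed
  obtain t where t: "t \<noteq> 0" "- S f0 f0 = eta * t\<^sup>2" using nonsquare_ratio[OF 2 ns eta] .
  define f where "f = scale (inverse t) f0"
  have "S f0 f0 = - (- S f0 f0)" by simp
  then have "S f0 f0 = - (eta * t\<^sup>2)" unfolding t(2) .
  moreover have "inverse t * (inverse t * (eta * t\<^sup>2)) = eta"
    using t(1) by (simp add: field_simps power2_eq_square)
  ultimately have ff: "S f f = - eta"
    by (simp add: f_def form_simps[OF S])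
  have ef: "S e f = 0" "S f e = 0" by (simp_all add: f_def form_simps[OF S] f0 ef0)
  have f: "f \<in> W" "f \<noteq> 0" using f0 W t by (simp_all add: f_def subspace_scale)
  let ?U = "{x \<in> W. S x e = 0}"
  let ?b = "\<lambda>i. if i = (1 :: nat) then e else f"
  have cardU: "card ?U = CARD('a)"
  proof -
    have "bij_betw (\<lambda>(u, a). u + scale a e) (?U \<times> UNIV) W"
    proof (rule bij_betw_byWitness[where f' = "\<lambda>x. (x - scale (S x e) e, S x e)"])
      show "(\<lambda>(u, a). u + scale a e) ` (?U \<times> UNIV) \<subseteq> W"
        using W eW by (auto intro: subspace_add subspace_scale)
      show "(\<lambda>x. (x - scale (S x e) e, S x e)) ` W \<subseteq> ?U \<times> UNIV"
        using W eW by (auto simp: form_diff[OF S] form_simps[OF S] ee intro: subspace_diff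
            subspace_scale)
    qed (auto simp: form_simps[OF S] ee)
    from bij_betw_same_card[OF this] have "CARD('a) * CARD('a) = card ?U * CARD('a)"
      using card by (simp add: card_cartesian_product power2_eq_square)
    then show ?thesis by simp
  qed
  have U: "?U = range (\<lambda>t. scale t f)"
    using f ef by (intro line_eq[OF subspace_perp[OF S W] cardU]) auto
  have comb: "comb 2 ?b c = scale (c 1) e + scale (c 2) f" for c by (simp add: comb_2)
  have "spanning W 2 ?b"
    unfolding spanning_def
  proof (intro conjI ballI)
    fix x assume x: "x \<in> W"
    have "x - scale (S x e) e \<in> ?U"
      using x W eW by (auto simp: form_diff[OF S] form_simps[OF S] ee intro: subspace_diff
          subspace_scale)
    then obtain t where "x - scale (S x e) e = scale t f" unfolding U by blast
    then have "x = scale (S x e) e + scale t f" by (metis add.commute diff_add_cancel)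
    then show "\<exists>c. x = comb 2 ?b c"
      unfolding comb by (intro exI[of _ "\<lambda>i. if i = 1 then S x e else t"]) simp
  qed (use eW f in auto)
  moreover have "S (comb 2 ?b x) (comb 2 ?b y) = x 1 * y 1 - eta * (x 2 * y 2)" for x y
    unfolding comb by (simp add: form_simps[OF S] ee ef ff algebra_simps)
  ultimately show ?thesis using that by blast
qed

text \<open>Hyperbolic planes are split off while there are isotropic vectors; by
  \<open>isotropic_exists_odd\<close> an anisotropic remainder has dimension at most 2.\<close>

lemma classification_odd:
  assumes 2: "(2 :: 'a) \<noteq> 0" and eta: "\<nexists>x. eta = x\<^sup>2"
    and "subspace W" "card W = CARD('a) ^ (2 * s)" "nondegenerate S W" "s \<ge> 1"
  shows "\<exists>b. spanning W (2 * s) b \<and> ((\<forall>x y. S (comb (2 * s) b x) (comb (2 * s) b y) = sym_hyp s x y)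
    \<or> (\<forall>x y. S (comb (2 * s) b x) (comb (2 * s) b y) = sym_ell eta s x y))"
  using assms(3-6)
proof (induction s arbitrary: W)
  case (Suc s)
  note W = Suc.prems(1) and nd = Suc.prems(3)
  have odd: "odd CARD('a)" using 2 by (simp add: even_CARD_iff)
  show ?case
  proof (cases "\<exists>e\<in>W. e \<noteq> 0 \<and> S e e = 0")
    case True
    then obtain e where e: "e \<in> W" "e \<noteq> 0" "S e e = 0" by blast
    obtain f where f: "f \<in> W" "S e f = 1" "S f f = 0"
      using hyperbolic_pair_odd[OF 2 W nd e] .
    let ?U = "{x \<in> W. S x e = 0 \<and> S x f = 0}"
    note split = pair_split[OF S W e(1) f(1) e(3) f(2)]
    have cU: "card ?U = CARD('a) ^ (2 * s)" using pair_card[OF W e(1) f(1) e(3) f(2) Suc.prems(2)] .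
    note pre = pair_prepend[OF W e(1) f(1) e(3) f(2,3)]
    have e2: "2 * Suc s = 2 + 2 * s" by simp
    show ?thesis
    proof (cases "s = 0")
      case True
      have "spanning ?U 0 (\<lambda>_. 0)" using cU True by (intro spanning_0 split(1)) simp
      from pre[OF this] True show ?thesis
        by (intro exI[of _ "\<lambda>i. if i \<le> 2 then if i = 1 then e else f else 0"])
           (simp add: sym_hyp_def comb_def form_simps[OF S] numeral_2_eq_2)
    next
      case False
      then obtain b where b: "spanning ?U (2 * s) b"
        "(\<forall>x y. S (comb (2 * s) b x) (comb (2 * s) b y) = sym_hyp s x y)
          \<or> (\<forall>x y. S (comb (2 * s) b x) (comb (2 * s) b y) = sym_ell eta s x y)"
        using Suc.IH[OF split(1) cU split(4)[OF nd]] by auto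
      have s1: "s \<ge> 1" using False by simp
      show ?thesis
        unfolding e2 using pre[OF b(1)] b(2) by (auto simp: sym_hyp_Suc sym_ell_Suc[OF s1])
    qed
  next
    case False
    have q: "CARD('a) > 1" using CARD_ge_2[where 'a = 'a] by simp
    have "s = 0"
    proof (rule ccontr)
      assume "s \<noteq> 0"
      then have "CARD('a) ^ 3 \<le> card W"
        unfolding Suc.prems(2) using q by (intro power_increasing) auto
      from isotropic_exists_odd[OF S 2 W this] False show False by blast
    qed
    then have "card W = CARD('a)\<^sup>2" using Suc.prems(2) by (simp add: numeral_2_eq_2)
    from anisotropic_plane_odd[OF 2 eta W this] False
    obtain b where "spanning W 2 b" "\<And>x y. S (comb 2 b x) (comb 2 b y)
        = x 1 * y 1 - eta * (x 2 * y 2)"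
      by blast
    then show ?thesis
      using \<open>s = 0\<close> odd by (intro exI[of _ b]) (simp add: sym_ell_def sym_hyp_def mult.assoc)
  qed
qed simp

text \<open>Any nonzero vector and a partner of it form a hyperbolic pair, whatever the
  characteristic.\<close>

lemma classification_alternating:
  assumes "\<And>v. v \<in> W \<Longrightarrow> S v v = 0"
    and "subspace W" "card W = CARD('a) ^ (2 * s)" "nondegenerate S W"
  shows "\<exists>b. spanning W (2 * s) b \<and> (\<forall>x y. S (comb (2 * s) b x) (comb (2 * s) b y) = sym_hyp s x y)"
  using assms
proof (induction s arbitrary: W)
  case 0
  then show ?case
    using spanning_0[of W "\<lambda>_. 0"] by (auto simp: comb_def sym_hyp_def form_simps[OF S])
next
  case (Suc s)
  note W = Suc.prems(2) and nd = Suc.prems(4)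
  have q: "CARD('a) > 1" using CARD_ge_2[where 'a = 'a] by simp
  have "card W > 1" unfolding Suc.prems(3) using q by (intro one_less_power) auto
  then obtain e where e: "e \<in> W" "e \<noteq> 0" using exists_nonzero[OF W] by blast
  obtain f where f: "f \<in> W" "S e f = 1" using nondegenerate_partner[OF S W nd e] .
  have ef: "S e e = 0" "S f f = 0" using Suc.prems(1) e f by auto
  let ?U = "{x \<in> W. S x e = 0 \<and> S x f = 0}"
  note split = pair_split[OF S W e(1) f(1) ef(1) f(2)]
  have "card ?U = CARD('a) ^ (2 * s)" using pair_card[OF W e(1) f(1) ef(1) f(2) Suc.prems(3)] .
  then obtain b where b: "spanning ?U (2 * s) b"
      "\<forall>x y. S (comb (2 * s) b x) (comb (2 * s) b y) = sym_hyp s x y"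
    using Suc.IH[of ?U] Suc.prems(1) split(1) split(4)[OF nd] by auto
  have e2: "2 * Suc s = 2 + 2 * s" by simp
  show ?case
    unfolding e2 using pair_prepend[OF W e(1) f(1) ef(1) f(2) ef(2) b(1)] b(2)
        by (auto simp: sym_hyp_Suc)
qed

text \<open>In characteristic 2 a pair with Gram matrix \<open>(0, 1; 1, c)\<close> and \<open>c \<noteq> 0\<close> is either scaled to
  \<open>c = 1\<close>, if its complement is alternating, or turned into a hyperbolic pair with the help of a
  vector of the complement.\<close>

lemma classification_even:
  assumes 2: "(2 :: 'a) = 0"
    and "subspace W" "card W = CARD('a) ^ (2 * s)" "nondegenerate S W" "\<exists>v\<in>W. S v v \<noteq> 0" "s \<ge> 1"
  shows "\<exists>b. spanning W (2 * s) b \<and> (\<forall>x y. S (comb (2 * s) b x) (comb (2 * s) b y)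
      = sym_ell eta s x y)"
  using assms(2-6)
proof (induction s arbitrary: W)
  case (Suc s)
  note W = Suc.prems(1) and nd = Suc.prems(3)
  have even: "even CARD('a)" using 2 by (simp add: even_CARD_iff)
  have q: "CARD('a) > 1" using CARD_ge_2[where 'a = 'a] by simp
  have add_self: "z + z = 0" for z :: 'a using 2 by (metis mult_2 mult_zero_left)
  have root: "\<exists>t. t\<^sup>2 = z" for z :: 'a using bij_square[OF 2] by (metis bij_pointE)
  \<comment> \<open>In characteristic 2 the map sending x to \<open>S x x\<close> is additive, and
    square roots exist; so a multiple of \<open>v\<close> with \<open>S v v \<noteq> 0\<close> can
    cancel the value at any \<open>w\<close>.\<close>
  have sq_add: "S (scale t v + w) (scale t v + w) = t\<^sup>2 * S v v + S w w" for t v w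
  proof -
    have "S (scale t v + w) (scale t v + w) = t\<^sup>2 * S v v + S w w + (t * S v w + t * S v w)"
      by (simp add: form_simps[OF S] form_sym[OF S, of w v] power2_eq_square algebra_simps)
    then show ?thesis by (simp add: add_self)
  qed
  have "card W > 1" unfolding Suc.prems(2) using q by (intro one_less_power) auto
  then obtain v where v: "v \<in> W" "v \<noteq> 0" using exists_nonzero[OF W] by blast
  have "\<exists>e\<in>W. e \<noteq> 0 \<and> S e e = 0"
  proof (cases "S v v = 0")
    case False
    have "CARD('a) ^ 1 < card W" unfolding Suc.prems(2) using q
        by (intro power_strict_increasing) auto
    then obtain w where w: "w \<in> W" "\<forall>t. w \<noteq> scale t v" using exists_not_in_line by fastforce
    obtain t where t: "t\<^sup>2 = S w w / S v v" using root by blast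
    have "S (scale t v + w) (scale t v + w) = 0"
      using False by (simp add: sq_add t add_self)
    moreover have "scale t v + w \<noteq> 0"
    proof
      assume "scale t v + w = 0"
      then have "w = scale (- t) v" by (simp add: eq_neg_iff_add_eq_0 add.commute)
      then show False using w by blast
    qed
    moreover have "scale t v + w \<in> W" using v w W by (intro subspace_add subspace_scale)
    ultimately show ?thesis by blast
  qed (use v in blast)
  then obtain e where e: "e \<in> W" "e \<noteq> 0" "S e e = 0" by blast
  obtain g where g: "g \<in> W" "S e g = 1" using nondegenerate_partner[OF S W nd e(1,2)] .
  let ?U = "\<lambda>f. {x \<in> W. S x e = 0 \<and> S x f = 0}"
  \<comment> \<open>The complement of a hyperbolic pair still has a vector with nonzero value, since
    the pair itself contributes none. So the induction hypothesis applies to it.\<close>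
  have hyp_case: ?case if f: "f \<in> W" "S e f = 1" "S f f = 0" for f
  proof -
    note split = pair_split[OF S W e(1) f(1) e(3) f(2)]
    have cU: "card (?U f) = CARD('a) ^ (2 * s)"
        using pair_card[OF W e(1) f(1) e(3) f(2) Suc.prems(2)] .
    have nalt: "\<exists>v\<in>?U f. S v v \<noteq> 0"
    proof (rule ccontr)
      assume *: "\<not> (\<exists>v\<in>?U f. S v v \<noteq> 0)"
      have "S x x = 0" if xW: "x \<in> W" for x
      proof -
        obtain u \<alpha> \<beta> where x: "u \<in> ?U f" "x = u + (scale \<alpha> e + scale \<beta> f)" using split(3)[OF xW]
            by blast
        have "x = scale \<alpha> e + (scale \<beta> f + u)" using x by (simp add: algebra_simps)
        then have "S x x = \<alpha>\<^sup>2 * S e e + (\<beta>\<^sup>2 * S f f + S u u)" by (simp only: sq_add)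
        then show ?thesis using * x e f by auto
      qed
      then show False using Suc.prems(4) by blast
    qed
    have s1: "s \<ge> 1"
    proof (rule ccontr)
      assume "\<not> s \<ge> 1"
      then have "card (?U f) = 1" using cU by simp
      then have "?U f = {0}" using subspace_0[OF split(1)] by (metis card_1_singletonE singletonD)
      then show False using nalt form_simps(5)[OF S] by auto
    qed
    obtain b where b: "spanning (?U f) (2 * s) b"
      "\<forall>x y. S (comb (2 * s) b x) (comb (2 * s) b y) = sym_ell eta s x y"
      using Suc.IH[OF split(1) cU split(4)[OF nd] nalt s1] by blast
    have e2: "2 * Suc s = 2 + 2 * s" by simp
    show ?thesis
      unfolding e2 using pair_prepend[OF W e(1) f(1) e(3) f(2,3) b(1)] b(2)
          by (auto simp: sym_ell_Suc[OF s1])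
  qed
  show ?case
  proof (cases "S g g = 0")
    case True
    then show ?thesis using hyp_case g by blast
  next
    case c: False
    note split = pair_split[OF S W e(1) g(1) e(3) g(2)]
    show ?thesis
    proof (cases "\<exists>u\<in>?U g. S u u \<noteq> 0")
      case True
      then obtain u where u: "u \<in> W" "S u e = 0" "S u u \<noteq> 0" by blast
      obtain t where t: "t\<^sup>2 = S g g / S u u" using root by blast
      have "S (scale t u + g) (scale t u + g) = 0"
        using u by (simp add: sq_add t add_self)
      moreover have "S e (scale t u + g) = 1"
        using u g form_sym[OF S, of e u] by (simp add: form_simps[OF S])
      moreover have "scale t u + g \<in> W" using u g W by (intro subspace_add subspace_scale)
      ultimately show ?thesis using hyp_case by blast
    next
      case alt: False
      obtain t where t: "t\<^sup>2 = S g g" using root by blast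
      have t0: "t \<noteq> 0" using t c by auto
      have it: "inverse t * (inverse t * t\<^sup>2) = 1"
        using t0 by (simp add: field_simps power2_eq_square)
      \<comment> \<open>Scaling by \<open>t\<close> and its inverse keeps the mutual product 1 and
        turns the value \<open>S g g\<close> into 1.\<close>
      define e' f where "e' = scale t e" and "f = scale (inverse t) g"
      have ef: "e' \<in> W" "f \<in> W" "S e' e' = 0" "S e' f = 1" "S f f = 1"
        using e g t0 W by (simp_all add: e'_def f_def form_simps[OF S] subspace_scale it flip: t)
      have eq: "{x \<in> W. S x e' = 0 \<and> S x f = 0} = ?U g"
        using t0 by (auto simp: e'_def f_def form_simps[OF S])
      have "card (?U g) = CARD('a) ^ (2 * s)"
          using pair_card[OF W e(1) g(1) e(3) g(2) Suc.prems(2)] .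
      then obtain b where b: "spanning (?U g) (2 * s) b"
        "\<forall>x y. S (comb (2 * s) b x) (comb (2 * s) b y) = sym_hyp s x y"
        using classification_alternating[of "?U g" s] alt split(1) split(4)[OF nd] by auto
      have e2: "2 * Suc s = 2 * s + 2" by simp
      show ?thesis
        unfolding e2 using pair_append(1,3)[OF W ef(1-4), of "2 * s" b] b ef(5) even unfolding eq
        by (intro exI[of _ "\<lambda>i. if i \<le> 2 * s then b i else if i - 2 * s = 1 then e' else f"])
           (simp add: sym_ell_def)
    qed
  qed
qed simp

end

end

lemma std_mat_quad:
  fixes A :: "nat \<Rightarrow> nat \<Rightarrow> 'a::comm_ring_1"
  assumes "\<kappa> + 2 * s \<le> n"
  shows "(\<Sum>i = 1..n. \<Sum>j = 1..n. std_mat \<kappa> A c s i j * x i * x j)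
    = (\<Sum>i = 1..\<kappa>. \<Sum>j = 1..\<kappa>. A i j * x i * x j) + c
        * (\<Sum>l = 1..s. x (\<kappa> + 2 * l - 1) * x (\<kappa> + 2 * l))"
  using assms
proof (induction s)
  case 0
  have "(\<Sum>i = 1..n. \<Sum>j = 1..n. std_mat \<kappa> A c 0 i j * x i * x j)
      = (\<Sum>i = 1..\<kappa>. \<Sum>j = 1..n. std_mat \<kappa> A c 0 i j * x i * x j)"
    using 0 by (intro sum.mono_neutral_right) auto
  also have "\<dots> = (\<Sum>i = 1..\<kappa>. \<Sum>j = 1..\<kappa>. std_mat \<kappa> A c 0 i j * x i * x j)"
    using 0 by (intro sum.cong[OF refl] sum.mono_neutral_right) auto
  finally show ?case by simp
next
  case (Suc s)
  let ?p = "\<kappa> + 2 * s + 1" and ?r = "\<kappa> + 2 * s + 2"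
  have p: "?p \<in> {1..n}" "?r \<in> {1..n}" using Suc.prems by auto
  have "std_mat \<kappa> A c (Suc s) i j = std_mat \<kappa> A c s i j
      + (if i = ?p then if j = ?r then c else 0 else 0)" for i j
    using std_mat_eq_0[of \<kappa> s ?p ?r A c] by auto
  then have "(\<Sum>i = 1..n. \<Sum>j = 1..n. std_mat \<kappa> A c (Suc s) i j * x i * x j)
      = (\<Sum>i = 1..n. \<Sum>j = 1..n. std_mat \<kappa> A c s i j * x i * x j)
        + (\<Sum>i = 1..n. \<Sum>j = 1..n. (if i = ?p then if j = ?r then c else 0 else 0) * x i * x j)"
    by (simp only: distrib_right sum.distrib)
  also have "(\<Sum>i = 1..n. \<Sum>j = 1..n. (if i = ?p then if j = ?r then c else 0 else 0) * x i * x j)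
      = (\<Sum>i = 1..n. if i = ?p then \<Sum>j = 1..n. if j = ?r then c * x ?p * x ?r else 0 else 0)"
  proof (rule sum.cong[OF refl])
    fix i
    show "(\<Sum>j = 1..n. (if i = ?p then if j = ?r then c else 0 else 0) * x i * x j)
        = (if i = ?p then \<Sum>j = 1..n. if j = ?r then c * x ?p * x ?r else 0 else 0)"
      by (cases "i = ?p") (auto simp: if_distrib[of "\<lambda>c. c * _"] cong: if_cong)
  qed
  also have "\<dots> = c * x ?p * x ?r"
    using p by simp
  finally show ?case
    using Suc by (simp add: algebra_simps)
qed

section \<open>Bases adapted to the radical\<close>

context form_space
begin

lemma complement_exists:
  assumes R: "subspace R"
  obtains W where "subspace W" "card W = CARD('a) ^ (m - dim R)" "\<And>x. \<exists>w\<in>W. \<exists>r\<in>R. x = w + r"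
    "\<And>x. x \<in> R \<Longrightarrow> x \<in> W \<Longrightarrow> x = 0"
proof -
  obtain B0 where B0: "B0 \<subseteq> R" "independent B0" "R \<subseteq> span B0" "card B0 = dim R"
    using basis_exists by blast
  define B where "B = extend_basis B0"
  have B: "B0 \<subseteq> B" "independent B" "span B = UNIV"
    unfolding B_def using B0(2) by (rule extend_basis_superset
        independent_extend_basis span_extend_basis)+
  have fin: "finite B" using B(2) by (rule finiteI_independent)
  have R_eq: "span B0 = R" using B0 R by (metis span_subspace)
  let ?W = "span (B - B0)"
  have "card B = m"
    unfolding vdim_def using basis_card_eq_dim[of B UNIV] B by simp
  then have "card (B - B0) = m - dim R"
    using B(1) B0(4) fin by (simp add: card_Diff_subset finite_subset)
  moreover have "independent (B - B0)" using B(2) by (rule independent_mono) auto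
  ultimately have cW: "card ?W = CARD('a) ^ (m - dim R)"
    using card_span_independent[of "B - B0"] fin by simp
  have split: "\<exists>w\<in>?W. \<exists>r\<in>R. x = w + r" for x
  proof -
    have "x \<in> span ((B - B0) \<union> B0)" using B by (simp add: Un_absorb2)
    then show ?thesis unfolding span_Un R_eq by blast
  qed
  have "dim R \<le> m" unfolding vdim_def by (intro dim_subset) auto
  \<comment> \<open>The addition map is onto and the two sides have equal size, so it is injective;
    this gives the trivial intersection.\<close>
  then have "card (?W \<times> R) = CARD('v)"
    using card_subspace[OF R] cW card_subspace[of UNIV]
    by (simp add: card_cartesian_product vdim_def flip: power_add)
  moreover have "(\<lambda>(w, r). w + r) ` (?W \<times> R) = UNIV"
    using split by (auto simp: image_iff)
  moreover have "finite (?W \<times> R)" by (intro finite_cartesian_product finite_space)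
  ultimately have inj: "inj_on (\<lambda>(w, r). w + r) (?W \<times> R)"
    by (intro eq_card_imp_inj_on) simp_all
  have "x = 0" if "x \<in> R" "x \<in> ?W" for x
  proof -
    have "(x, 0 :: 'v) = (0, x)"
      by (rule inj_onD[OF inj]) (use that R in \<open>auto intro: subspace_0 span_zero\<close>)
    then show ?thesis by simp
  qed
  then show ?thesis using that[of ?W] cW split by blast
qed

lemma spanning_exists:
  assumes "subspace R"
  obtains r where "spanning R (dim R) r"
proof -
  obtain B where B: "B \<subseteq> R" "independent B" "R \<subseteq> span B" "card B = dim R"
    using basis_exists by blast
  have fin: "finite B" using B(2) by (rule finiteI_independent)
  obtain r where r: "bij_betw r {1..dim R} B"
    using ex_bij_betw_nat_finite_1[OF fin] B(4) by auto
  have "spanning R (dim R) r"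
    unfolding spanning_def
  proof (intro conjI ballI)
    show "r i \<in> R" if "i \<in> {1..dim R}" for i
      using r B(1) that by (auto simp: bij_betw_def)
    fix x assume "x \<in> R"
    then obtain u where "x = (\<Sum>v\<in>B. scale (u v) v)"
      using B(3) span_finite[OF fin] by auto
    then have "x = comb (dim R) r (\<lambda>i. u (r i))"
      unfolding comb_def by (simp add: sum.reindex_bij_betw[OF r, symmetric])
    then show "\<exists>c. x = comb (dim R) r c" by blast
  qed
  then show ?thesis using that by blast
qed

lemma extend_spanning_to_basis:
  assumes R: "subspace R" and split: "\<And>x. \<exists>w\<in>W. \<exists>r\<in>R. x = w + r" and b: "spanning W (m - dim R) b"
  obtains b' where "is_basis scale b'" "\<And>x. \<exists>r\<in>R. lincomb scale b' x = comb (m - dim R) b x + r"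
proof -
  let ?n = "m - dim R"
  have "dim R \<le> m" unfolding vdim_def by (intro dim_subset) auto
  then have nk: "?n + dim R = m" by simp
  obtain r where r: "spanning R (dim R) r" using spanning_exists[OF R] .
  let ?b = "\<lambda>i. if i \<le> ?n then b i else r (i - ?n)"
  have lin: "lincomb scale ?b x = comb (?n + dim R) ?b x" for x
    by (simp add: lincomb_def comb_def nk)
  have "spanning UNIV (?n + dim R) ?b"
  proof (rule spanning_appendI[OF b])
    fix x
    obtain w r' where "w \<in> W" "r' \<in> R" "x = w + r'" using split by blast
    moreover then obtain c where "r' = comb (dim R) r c" using r unfolding spanning_def by blast
    ultimately show "\<exists>u\<in>W. \<exists>c. x = u + comb (dim R) r c" by blast
  qed auto
  then have "is_basis scale ?b"
    by (intro is_basisI) (auto simp: spanning_def lin)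
  moreover have "\<exists>r\<in>R. lincomb scale ?b x = comb ?n b x + r" for x
    unfolding lin comb_append
    by (rule bexI, rule refl, rule comb_in_subspace[OF R]) (use r in \<open>auto simp: spanning_def\<close>)
  ultimately show ?thesis using that by blast
qed

lemma sym_equiv_coordI:
  assumes "is_basis scale b" "\<And>x y. S (lincomb scale b x) (lincomb scale b y) = f x y"
  shows "sym_equiv_coord scale f S"
proof -
  have "(\<lambda>x. x) \<in> general_linear scale"
    by (simp add: general_linear_def Vector_Spaces.linear_iff vector_space_axioms bij_def)
  then have "sym_equiv scale S S"
    unfolding sym_equiv_def by (intro exI[of _ "1 :: 'a"] exI[of _ "\<lambda>x. x"]) simp
  then show ?thesis
    using assms unfolding sym_equiv_coord_def by blast
qed

text \<open>The form is nondegenerate on a complement of its radical, and the normal form found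
  there persists when a basis of the radical is appended. The scalar in the equivalence can be taken
  to be 1.\<close>

lemma sym_type_exists:
  assumes S: "S \<in> sym_forms scale" and rank: "sym_rank scale S = 2 * s" and s: "s \<ge> 1"
    and eta: "odd CARD('a) \<Longrightarrow> \<nexists>x. eta = x\<^sup>2"
  shows "sym_has_type scale eta S 1 \<or> sym_has_type scale eta S (- 1)"
proof -
  let ?R = "{x. \<forall>y. S x y = 0}"
  have R: "subspace ?R" by (rule subspace_radical[OF S])
  have n: "m - dim ?R = 2 * s" using rank by (simp add: sym_rank_def codimension_def)
  obtain W where W: "subspace W" "card W = CARD('a) ^ (2 * s)" "\<And>x. \<exists>w\<in>W. \<exists>r\<in>?R. x = w + r"
    "\<And>x. x \<in> ?R \<Longrightarrow> x \<in> W \<Longrightarrow> x = 0"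
    by (rule complement_exists[OF R, unfolded n], blast)
  have rad: "S r x = 0" "S x r = 0" if "r \<in> ?R" for r x
    using that form_sym[OF S, of x r] by simp_all
  have nd: "nondegenerate S W"
    unfolding nondegenerate_def[OF S]
  proof (intro ballI impI)
    fix x assume x: "x \<in> W" "\<forall>y\<in>W. S x y = 0"
    have "S x y = 0" for y
    proof -
      obtain w r where y: "w \<in> W" "r \<in> ?R" "y = w + r" using W(3) by blast
      then have "S x y = S x w + S x r" by (simp only: form_simps[OF S])
      then show ?thesis using x(2) y(1) rad(2)[OF y(2)] by simp
    qed
    then show "x = 0" using W(4) x by blast
  qed
  have "\<exists>b. spanning W (2 * s) b \<and> ((\<forall>x y. S (comb (2 * s) b x) (comb (2 * s) b y) = sym_hyp s x y)
    \<or> (\<forall>x y. S (comb (2 * s) b x) (comb (2 * s) b y) = sym_ell eta s x y))"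
  proof (cases "even CARD('a)")
    case True
    then have 2: "(2 :: 'a) = 0" by (simp add: even_CARD_iff)
    show ?thesis
      using classification_alternating[OF S _ W(1,2) nd] classification_even[OF S 2 W(1,2) nd _ s]
          by blast
  next
    case False
    then have 2: "(2 :: 'a) \<noteq> 0" by (simp add: even_CARD_iff)
    show ?thesis using classification_odd[OF S 2 eta[OF False] W(1,2) nd s] .
  qed
  then obtain b where b: "spanning W (2 * s) b" and
    f: "(\<forall>x y. S (comb (2 * s) b x) (comb (2 * s) b y) = sym_hyp s x y)
      \<or> (\<forall>x y. S (comb (2 * s) b x) (comb (2 * s) b y) = sym_ell eta s x y)"
    by blast
  obtain b' where b': "is_basis scale b'" "\<And>x. \<exists>r\<in>?R. lincomb scale b' x = comb (2 * s) b x + r"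
    by (rule extend_spanning_to_basis[OF R W(3), unfolded n, OF b], blast)
  have eq: "S (lincomb scale b' x) (lincomb scale b' y) = S (comb (2 * s) b x) (comb (2 * s) b y)"
      for x y
  proof -
    obtain r r' where r: "r \<in> ?R" "r' \<in> ?R" and
      eq: "lincomb scale b' x = comb (2 * s) b x + r" "lincomb scale b' y = comb (2 * s) b y + r'"
      using b'(2) by blast
    show ?thesis unfolding eq by (simp only: form_simps[OF S] rad[OF r(1)] rad[OF r(2)]) simp
  qed
  from f show ?thesis
  proof
    assume "\<forall>x y. S (comb (2 * s) b x) (comb (2 * s) b y) = sym_hyp s x y"
    then have "sym_equiv_coord scale (sym_hyp s) S"
      by (intro sym_equiv_coordI[OF b'(1)]) (simp add: eq)
    then show ?thesis using rank s unfolding sym_has_type_def by blast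
  next
    assume "\<forall>x y. S (comb (2 * s) b x) (comb (2 * s) b y) = sym_ell eta s x y"
    then have "sym_equiv_coord scale (sym_ell eta s) S"
      by (intro sym_equiv_coordI[OF b'(1)]) (simp add: eq)
    then show ?thesis using rank s unfolding sym_has_type_def by blast
  qed
qed

section \<open>Quadratic forms of odd rank\<close>

context
  fixes Q assumes Q: "Q \<in> quad_forms scale"
begin

lemma quad_scale: "Q (scale a x) = a\<^sup>2 * Q x"
  using Q by (simp add: quad_forms_def)

lemma quad_zero: "Q 0 = 0"
  using quad_scale[of 0 0] by simp

lemma quad_add: "Q (x + y) = Q x + Q y + polar_form Q x y"
  by (simp add: polar_form_def)

lemma polar_in_sym_forms: "polar_form Q \<in> sym_forms scale"
  using Q by (simp add: quad_forms_def sym_forms_def polar_form_def add.commute)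

lemma polar_self: "polar_form Q x x = 2 * Q x"
proof -
  have "Q (x + x) = Q (scale (1 + 1) x)"
    unfolding scale_left_distrib by simp
  then show ?thesis
    by (simp add: polar_form_def quad_scale power2_eq_square)
qed

definition quad_nondegenerate :: "'v set \<Rightarrow> bool" where
  "quad_nondegenerate W \<longleftrightarrow> (\<forall>x\<in>W. Q x = 0 \<longrightarrow> (\<forall>y\<in>W. polar_form Q x y = 0) \<longrightarrow> x = 0)"

text \<open>For odd q the singular vectors are the isotropic vectors of the polar form. In
  characteristic 2, take \<open>w\<close> orthogonal to \<open>v\<close> and off its line: then
  \<open>Q (w + t v) = Q w + t\<^sup>2 * Q v\<close>, and bijectivity of squaring supplies
  t.\<close>

lemma singular_vector_exists:
  assumes W: "subspace W" and card: "card W \<ge> CARD('a) ^ 3"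
  obtains v where "v \<in> W" "v \<noteq> 0" "Q v = 0"
proof (cases "(2 :: 'a) = 0")
  case False
  obtain v where "v \<in> W" "v \<noteq> 0" "polar_form Q v v = 0"
    using isotropic_exists_odd[OF polar_in_sym_forms False W card] .
  then show ?thesis using that False by (simp add: polar_self)
next
  case 2: True
  note P = form_simps[OF polar_in_sym_forms]
  have add_self: "z + z = 0" for z :: 'a using 2 by (metis mult_2 mult_zero_left)
  have q: "CARD('a) > 1" using CARD_ge_2[where 'a = 'a] by simp
  have "CARD('a) ^ 0 < CARD('a) ^ 3" using q by (intro power_strict_increasing) auto
  then have "card W > 1" using card by simp
  then obtain v where v: "v \<in> W" "v \<noteq> 0" using exists_nonzero[OF W] by blast
  show ?thesis
  proof (cases "Q v = 0")
    case False
    let ?W = "{x \<in> W. polar_form Q x v = 0}"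
    have "CARD('a) * CARD('a)\<^sup>2 \<le> card W"
      using card by (simp add: power3_eq_cube power2_eq_square mult_ac)
    also have "\<dots> \<le> CARD('a) * card ?W"
      by (rule card_le_kernel[OF W]) (simp add: P)
    finally have "CARD('a)\<^sup>2 \<le> card ?W" using q by simp
    moreover have "CARD('a) ^ 1 < CARD('a)\<^sup>2" using q by (intro power_strict_increasing) auto
    ultimately obtain w where w: "w \<in> ?W" "\<forall>t. w \<noteq> scale t v"
      using exists_not_in_line[of ?W v] by auto
    obtain t where t: "t\<^sup>2 = Q w / Q v" using bij_square[OF 2] by (metis bij_pointE)
    have "Q (w + scale t v) = Q w + t\<^sup>2 * Q v"
      using w by (simp add: quad_add quad_scale P)
    then have "Q (w + scale t v) = 0" using False by (simp add: t add_self)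
    moreover have "w + scale t v \<noteq> 0"
    proof
      assume "w + scale t v = 0"
      then have "w = scale (- t) v" by (simp add: eq_neg_iff_add_eq_0)
      then show False using w by blast
    qed
    moreover have "w + scale t v \<in> W" using v w W by (auto intro!: subspace_add subspace_scale)
    ultimately show ?thesis using that by blast
  qed (use v that in blast)
qed

text \<open>Singular vectors split off hyperbolic planes until a line is left. Its value
  \<open>a\<close> is not normalised, since the character sums use only that it is nonzero.\<close>

lemma quad_classification_odd:
  assumes "subspace W" "card W = CARD('a) ^ (1 + 2 * s)" "quad_nondegenerate W"
  shows "\<exists>b a. a \<noteq> 0 \<and> spanning W (1 + 2 * s) b \<and>
    (\<forall>x. Q (comb (1 + 2 * s) b x) = a * x 1 * x 1 + (\<Sum>l = 1..s. x (1 + 2 * l - 1) * x (1 + 2 * l)))"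
  using assms
proof (induction s arbitrary: W)
  case 0
  note W = 0(1)
  have card: "card W = CARD('a)" using 0 by simp
  then have "card W > 1" using CARD_ge_2[where 'a = 'a] by simp
  then obtain v where v: "v \<in> W" "v \<noteq> 0" using exists_nonzero[OF W] by blast
  have W_eq: "W = range (\<lambda>t. scale t v)" using line_eq[OF W card v] .
  have "Q v \<noteq> 0"
  proof
    assume "Q v = 0"
    moreover have "polar_form Q v y = 0" if "y \<in> W" for y
      using that \<open>Q v = 0\<close> unfolding W_eq by (auto simp: form_simps[OF polar_in_sym_forms]
          polar_self)
    ultimately show False using 0(3) v unfolding quad_nondegenerate_def by blast
  qed
  moreover have "spanning W 1 (\<lambda>_. v)"
    unfolding spanning_def
  proof (intro conjI ballI)
    fix x assume "x \<in> W"
    then obtain t where "x = scale t v" unfolding W_eq by blast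
    then show "\<exists>c. x = comb 1 (\<lambda>_. v) c" by (intro exI[of _ "\<lambda>_. t"]) (simp add: comb_def)
  qed (use v in auto)
  moreover have "Q (comb 1 (\<lambda>_. v) x) = Q v * x 1 * x 1" for x
    by (simp add: comb_def quad_scale power2_eq_square)
  ultimately show ?case
    by (intro exI[of _ "\<lambda>_. v"] exI[of _ "Q v"]) simp
next
  case (Suc s)
  note W = Suc.prems(1) and P = polar_in_sym_forms
  note Ps = form_simps[OF P]
  have q: "CARD('a) > 1" using CARD_ge_2[where 'a = 'a] by simp
  have "card W \<ge> CARD('a) ^ 3"
    unfolding Suc.prems(2) using q by (intro power_increasing) auto
  from singular_vector_exists[OF W this] obtain e where e: "e \<in> W" "e \<noteq> 0" "Q e = 0" .
  obtain y where y: "y \<in> W" "polar_form Q e y \<noteq> 0"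
    using Suc.prems(3) e unfolding quad_nondegenerate_def by blast
  define g where "g = scale (inverse (polar_form Q e y)) y"
  have g: "g \<in> W" "polar_form Q e g = 1" using y W by (simp_all add: g_def Ps subspace_scale)
  have ge: "polar_form Q g e = 1" using g form_sym[OF P] by metis
  \<comment> \<open>Since \<open>Q (g + h e) = Q g + h\<close>, a singular partner is found in every
    characteristic, without division by 2.\<close>
  define h where "h = - Q g"
  define f where "f = g + scale h e"
  have ee: "polar_form Q e e = 0" using e by (simp add: polar_self)
  have "Q f = Q g + h"
    using e by (simp add: f_def Ps quad_add quad_scale ge)
  then have "Q f = 0" by (simp add: h_def)
  moreover have "f \<in> W" using e g W by (simp add: f_def subspace_add subspace_scale)
  moreover have "polar_form Q e f = 1" by (simp add: f_def Ps ee g)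
  ultimately have f: "f \<in> W" "polar_form Q e f = 1" "Q f = 0" by blast+
  let ?U = "{x \<in> W. polar_form Q x e = 0 \<and> polar_form Q x f = 0}"
  note split = pair_split[OF P W e(1) f(1) ee f(2)]
  have "CARD('a)\<^sup>2 * card ?U = CARD('a)\<^sup>2 * CARD('a) ^ (1 + 2 * s)"
    using split(2) Suc.prems(2) by (simp add: power_add power2_eq_square)
  then have cU: "card ?U = CARD('a) ^ (1 + 2 * s)" by simp
  have nd: "quad_nondegenerate ?U"
    unfolding quad_nondegenerate_def
  proof (intro ballI impI)
    fix x assume x: "x \<in> ?U" "Q x = 0" "\<forall>y\<in>?U. polar_form Q x y = 0"
    have "polar_form Q x y = 0" if "y \<in> W" for y
      using split(3)[OF that] x by (auto simp: Ps)
    then show "x = 0" using Suc.prems(3) x unfolding quad_nondegenerate_def by blast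
  qed
  obtain b a where b: "a \<noteq> 0" "spanning ?U (1 + 2 * s) b"
    "\<And>x. Q (comb (1 + 2 * s) b x) = a * x 1 * x 1 + (\<Sum>l = 1..s. x (1 + 2 * l - 1) * x (1 + 2 * l))"
    using Suc.IH[OF split(1) cU nd] by blast
  note app = pair_append[OF P W e(1) f(1) ee f(2) b(2)]
  let ?b = "\<lambda>i. if i \<le> 1 + 2 * s then b i else if i - (1 + 2 * s) = 1 then e else f"
  have "Q (comb (1 + 2 * s + 2) ?b x) = a * x 1 * x 1
      + (\<Sum>l = 1..Suc s. x (1 + 2 * l - 1) * x (1 + 2 * l))" for x
  proof -
    let ?n = "1 + 2 * s"
    let ?v = "scale (x (?n + 1)) e + scale (x (?n + 2)) f"
    have "comb ?n b x \<in> ?U"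
      using b(2) by (intro comb_in_subspace split(1)) (auto simp: spanning_def)
    then have "polar_form Q (comb ?n b x) ?v = 0" by (simp add: Ps)
    then have "Q (comb (?n + 2) ?b x) = Q (comb ?n b x) + Q ?v"
      unfolding app(2) by (simp add: quad_add)
    also have "Q ?v = x (?n + 1) * x (?n + 2)"
      using e f by (simp add: quad_add quad_scale Ps mult.commute)
    finally show ?thesis
      by (simp add: b(3)[simplified] add.assoc)
  qed
  moreover have e2: "1 + 2 * Suc s = 1 + 2 * s + 2" by simp
  ultimately show ?case
    unfolding e2 using b(1) app(1) by blast
qed

lemma subspace_quad_radical: "subspace {x. (\<forall>y. polar_form Q x y = 0) \<and> Q x = 0}"
  by (auto simp: subspace_def form_simps[OF polar_in_sym_forms] quad_zero quad_add quad_scale)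

lemma adapted_basis_odd:
  assumes rank: "quad_rank scale Q = 2 * s + 1"
  obtains b a where "is_basis scale b" "a \<noteq> 0" "matrix_of_quad scale b Q (std_mat 1 (\<lambda>_ _. a) 1 s)"
proof -
  let ?R = "{x. (\<forall>y. polar_form Q x y = 0) \<and> Q x = 0}"
  note R = subspace_quad_radical
  note Ps = form_simps[OF polar_in_sym_forms]
  have n: "m - dim ?R = 1 + 2 * s" using rank by (simp add: quad_rank_def codimension_def)
  obtain W where W: "subspace W" "card W = CARD('a) ^ (1 + 2 * s)" "\<And>x. \<exists>w\<in>W. \<exists>r\<in>?R. x = w + r"
    "\<And>x. x \<in> ?R \<Longrightarrow> x \<in> W \<Longrightarrow> x = 0"
    by (rule complement_exists[OF R, unfolded n], blast)
  have rad: "polar_form Q r x = 0" "polar_form Q x r = 0" if "r \<in> ?R" for r x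
    using that form_sym[OF polar_in_sym_forms, of x r] by simp_all
  have "quad_nondegenerate W"
    unfolding quad_nondegenerate_def
  proof (intro ballI impI)
    fix x assume x: "x \<in> W" "Q x = 0" "\<forall>y\<in>W. polar_form Q x y = 0"
    have "polar_form Q x y = 0" for y
    proof -
      obtain w r where y: "w \<in> W" "r \<in> ?R" "y = w + r" using W(3) by blast
      then have "polar_form Q x y = polar_form Q x w + polar_form Q x r" by (simp only: Ps)
      then show ?thesis using x(3) y(1) rad(2)[OF y(2)] by simp
    qed
    then show "x = 0" using W(4) x by blast
  qed
  then obtain b a where b: "a \<noteq> 0" "spanning W (1 + 2 * s) b"
    "\<And>x. Q (comb (1 + 2 * s) b x) = a * x 1 * x 1 + (\<Sum>l = 1..s. x (1 + 2 * l - 1) * x (1 + 2 * l))"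
    using quad_classification_odd[OF W(1,2)] by blast
  obtain b' where b': "is_basis scale b'" "\<And>x. \<exists>r\<in>?R. lincomb scale b' x = comb (1 + 2 * s) b x + r"
    by (rule extend_spanning_to_basis[OF R W(3), unfolded n, OF b(2)], blast)
  have "1 + 2 * s \<le> m" using n by simp
  have "matrix_of_quad scale b' Q (std_mat 1 (\<lambda>_ _. a) 1 s)"
    unfolding matrix_of_quad_def
  proof
    fix x
    obtain r where r: "r \<in> ?R" "lincomb scale b' x = comb (1 + 2 * s) b x + r" using b'(2) by blast
    then have "Q (lincomb scale b' x) = Q (comb (1 + 2 * s) b x)"
      using rad(2)[OF r(1)] by (simp add: quad_add)
    then show "Q (lincomb scale b' x) = (\<Sum>i = 1..m. \<Sum>j
        = 1..m. std_mat 1 (\<lambda>_ _. a) 1 s i j * x i * x j)"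
      unfolding std_mat_quad[OF \<open>1 + 2 * s \<le> m\<close>] b(3) by simp
  qed
  then show ?thesis using that b'(1) b(1) by blast
qed

end

text \<open>The basis is moved by \<open>L\<close>, and the scalar of the equivalence reappears
  inverted.\<close>

lemma quad_equiv_coordE:
  assumes "quad_equiv_coord scale f Q"
  obtains b c where "is_basis scale b" "c \<noteq> 0" "\<And>x. Q (lincomb scale b x) = c * f x"
proof -
  obtain Q' b a L where b: "is_basis scale b" and f: "\<And>x. Q' (lincomb scale b x) = f x"
    and a: "a \<noteq> 0" and L: "L \<in> general_linear scale" and Q': "\<And>x. Q' x = a * Q (L x)"
    using assms unfolding quad_equiv_coord_def quad_equiv_def by metis
  have lin: "Vector_Spaces.linear scale scale L" and "bij L" using L
      by (auto simp: general_linear_def)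
  interpret L: Vector_Spaces.linear scale scale L by (rule lin)
  have Lb: "lincomb scale (\<lambda>i. L (b i)) x = L (lincomb scale b x)" for x
    by (simp add: lincomb_def L.sum L.scale)
  have "is_basis scale (\<lambda>i. L (b i))"
  proof (rule is_basisI)
    fix v
    obtain w where "v = L w" using \<open>bij L\<close> by (metis bij_pointE)
    moreover obtain c where "w = lincomb scale b c" using lincomb_ex[OF b] by blast
    ultimately show "\<exists>c. v = lincomb scale (\<lambda>i. L (b i)) c" unfolding Lb by blast
  qed
  moreover have "Q (lincomb scale (\<lambda>i. L (b i)) x) = inverse a * f x" for x
    using a Q'[of "lincomb scale b x"] by (simp add: Lb f)
  ultimately show ?thesis using that[of "\<lambda>i. L (b i)" "inverse a"] a by simp
qed

lemma quad_rank_le: "quad_rank scale Q \<le> m"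
  by (simp add: quad_rank_def codimension_def)

text \<open>The first hyperbolic plane serves as the initial block, so that forms of both types have
  s - 1 further planes.\<close>

lemma adapted_basis_hyp:
  assumes rank: "2 * s \<le> m" and s: "s \<ge> 1" and Q: "quad_equiv_coord scale (quad_hyp s) Q"
  obtains b c where "is_basis scale b" "c \<noteq> 0"
    "matrix_of_quad scale b Q (std_mat 2 (\<lambda>i j. if i = 1 \<and> j = 2 then c else 0) c (s - 1))"
proof -
  obtain b c where b: "is_basis scale b" "c \<noteq> 0" "\<And>x. Q (lincomb scale b x) = c * quad_hyp s x"
    by (rule quad_equiv_coordE[OF Q], blast)
  obtain t where t: "s = Suc t" using s by (cases s) auto
  have m: "2 + 2 * (s - 1) \<le> m" using rank t by simp
  have "matrix_of_quad scale b Q (std_mat 2 (\<lambda>i j. if i = 1 \<and> j = 2 then c else 0) c (s - 1))"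
    unfolding matrix_of_quad_def std_mat_quad[OF m] b(3)
  proof
    fix x :: "nat \<Rightarrow> 'a"
    have "quad_hyp s x = x 1 * x 2 + (\<Sum>l = 1..t. x (2 + 2 * l - 1) * x (2 + 2 * l))"
      unfolding quad_hyp_def t sum_shift_1 by (simp add: numeral_2_eq_2)
    then show "c * quad_hyp s x = (\<Sum>i = 1..2. \<Sum>j
        = 1..2. (if i = 1 \<and> j = 2 then c else 0) * x i * x j)
        + c * (\<Sum>l = 1..s - 1. x (2 + 2 * l - 1) * x (2 + 2 * l))"
      by (simp add: t numeral_2_eq_2 algebra_simps)
  qed
  then show ?thesis using that b by blast
qed

end

context form_char
begin

lemma adapted_basis_ell:
  assumes rank: "2 * s \<le> m" and s: "s \<ge> 1" and Q: "quad_equiv_coord scale (quad_ell lam eta s) Q"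
  obtains b c where "is_basis scale b" "c \<noteq> 0"
    "matrix_of_quad scale b Q (std_mat 2 (elliptic_base lam eta c) c (s - 1))"
proof -
  obtain b c where b: "is_basis scale b" "c \<noteq> 0"
      "\<And>x. Q (lincomb scale b x) = c * quad_ell lam eta s x"
    by (rule quad_equiv_coordE[OF Q], blast)
  obtain t where t: "s = Suc t" using s by (cases s) auto
  have m: "2 + 2 * (s - 1) \<le> m" using rank t by simp
  \<comment> \<open>\<open>quad_ell\<close> has its special plane last, \<open>std_mat\<close> has
    it first; \<open>to\<close> and \<open>fro\<close> are mutually inverse permutations of the
    indices that move it to the front.\<close>
  define to where "to j = (if j \<le> 2 * t then j + 2 else if j \<le> 2 * s then j - 2 * t else j)" for j
  define fro where "fro i = (if i \<le> 2 then 2 * t + i else if i \<le> 2 * s then i - 2 else i)" for i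
  have lin: "lincomb scale (\<lambda>i. b (fro i)) x = lincomb scale b (\<lambda>j. x (to j))" for x
    unfolding lincomb_def
  proof (rule sum.reindex_bij_witness[where i = to and j = fro])
    fix i assume i: "i \<in> {1..m}"
    show eq: "to (fro i) = i" "fro (to i) = i" "fro i \<in> {1..m}" "to i \<in> {1..m}"
      using i rank t by (auto simp: to_def fro_def)
    show "scale (x (to (fro i))) (b (fro i)) = scale (x i) (b (fro i))"
      unfolding eq ..
  qed
  have "is_basis scale (\<lambda>i. b (fro i))"
  proof (rule is_basisI)
    fix v
    obtain d where d: "v = lincomb scale b d" using lincomb_ex[OF b(1)] by blast
    have "lincomb scale b (\<lambda>j. d (fro (to j))) = lincomb scale b d"
      by (rule lincomb_cong) (use t in \<open>auto simp: to_def fro_def\<close>)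
    then show "\<exists>d. v = lincomb scale (\<lambda>i. b (fro i)) d"
      unfolding lin d by (intro exI[of _ "\<lambda>i. d (fro i)"]) simp
  qed
  moreover have "matrix_of_quad scale (\<lambda>i. b (fro i)) Q
      (std_mat 2 (elliptic_base lam eta c) c (s - 1))"
    unfolding matrix_of_quad_def std_mat_quad[OF m] lin b(3)
  proof
    fix x :: "nat \<Rightarrow> 'a"
    have "quad_hyp t (\<lambda>j. x (to j)) = (\<Sum>l = 1..t. x (2 + 2 * l - 1) * x (2 + 2 * l))"
      unfolding quad_hyp_def
    proof (intro sum.cong refl)
      fix l assume "l \<in> {1..t}"
      then have "to (2 * l - 1) = 2 + 2 * l - 1" "to (2 * l) = 2 + 2 * l"
        by (auto simp: to_def)
      then show "x (to (2 * l - 1)) * x (to (2 * l)) = x (2 + 2 * l - 1) * x (2 + 2 * l)"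
          by (simp only:)
    qed
    moreover have "to (2 * s - 1) = 1" "to (2 * s) = 2" by (auto simp: to_def t)
    ultimately have "quad_ell lam eta s (\<lambda>j. x (to j))
        = (\<Sum>l = 1..t. x (2 + 2 * l - 1) * x (2 + 2 * l))
      + (if even CARD('a) then (x 1)\<^sup>2 + x 1 * x 2 + lam * (x 2)\<^sup>2 else (x 1)\<^sup>2 - eta * (x 2)\<^sup>2)"
      unfolding quad_ell_def by (simp add: t)
    moreover have "(\<Sum>i = 1..2. \<Sum>j = 1..2. elliptic_base lam eta c i j * x i * x j)
       = c * (if even CARD('a) then (x 1)\<^sup>2 + x 1 * x 2 + lam * (x 2)\<^sup>2 else (x 1)\<^sup>2 - eta * (x 2)\<^sup>2)"
      by (simp add: numeral_2_eq_2 elliptic_base_def algebra_simps)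
    ultimately show "c * quad_ell lam eta s (\<lambda>j. x (to j))
        = (\<Sum>i = 1..2. \<Sum>j = 1..2. elliptic_base lam eta c i j * x i * x j)
        + c * (\<Sum>l = 1..s - 1. x (2 + 2 * l - 1) * x (2 + 2 * l))"
      by (simp add: t distrib_left add.commute)
  qed
  ultimately show ?thesis using that b by blast
qed

end

section \<open>The \<open>Q\<close>-numbers\<close>

context form_char
begin

lemma sum_sym_forms_rank:
  fixes g :: "(nat \<Rightarrow> nat \<Rightarrow> 'a) \<Rightarrow> complex"
  assumes b: "is_basis scale b"
  shows "(\<Sum>S\<in>{S \<in> sym_forms scale. int (sym_rank scale S) = k}. g (gram b S))
      = (\<Sum>B\<in>rank_mats m k. g B)"
proof (rule sum.reindex_bij_betw)
  have bij: "bij_betw (gram b) (sym_forms scale) (sym_mats m)" by (rule gram_bij[OF b])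
  show "bij_betw (gram b) {S \<in> sym_forms scale. int (sym_rank scale S) = k} (rank_mats m k)"
    unfolding bij_betw_def
  proof
    show "inj_on (gram b) {S \<in> sym_forms scale. int (sym_rank scale S) = k}"
      using bij by (auto simp: bij_betw_def inj_on_def)
    show "gram b ` {S \<in> sym_forms scale. int (sym_rank scale S) = k}
        = (rank_mats m k :: (nat \<Rightarrow> nat \<Rightarrow> 'a) set)"
    proof (intro subset_antisym subsetI)
      fix B :: "nat \<Rightarrow> nat \<Rightarrow> 'a"
      assume B: "B \<in> rank_mats m k"
      then have "B \<in> gram b ` sym_forms scale"
        using bij by (simp add: bij_betw_def rank_mats_def)
      then obtain S where "S \<in> sym_forms scale" "B = gram b S" by blast
      then show "B \<in> gram b ` {S \<in> sym_forms scale. int (sym_rank scale S) = k}"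
        using B gram_in_rank_mats_iff[OF b] by blast
    next
      fix B :: "nat \<Rightarrow> nat \<Rightarrow> 'a"
      assume "B \<in> gram b ` {S \<in> sym_forms scale. int (sym_rank scale S) = k}"
      then show "B \<in> rank_mats m k"
        using gram_in_rank_mats_iff[OF b] by blast
    qed
  qed
qed

text \<open>A type exists by \<open>sym_type_exists\<close> and is unique because \<Omega> separates
  the two types; the formula interpolates linearly between the two values of \<Omega>. For odd q it
  reads (1 + \<epsilon>\<tau>)/2.\<close>

lemma type_indicator:
  assumes S: "S \<in> sym_forms scale" and rank: "int (sym_rank scale S) = 2 * r" and r: "r \<ge> 1"
    and \<epsilon>: "\<epsilon> \<in> {1, -1}" and eta: "odd CARD('a) \<longrightarrow> (\<nexists>x. eta = x\<^sup>2)"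
  shows "(if sym_has_type scale eta S \<epsilon> then 1 else 0)
    = of_real (alpha_coeff CARD('a) \<epsilon>) + of_int \<epsilon> * of_real (beta_coeff CARD('a) r) * avg_form S"
proof -
  obtain s where s: "r = int s" "s \<ge> 1" using r
      by (metis nonneg_int_cases of_nat_1 of_nat_le_iff order_trans zero_le_one)
  have rank': "sym_rank scale S = 2 * s" using rank s by simp
  obtain \<tau> where \<tau>: "\<tau> \<in> {1, -1}" "sym_has_type scale eta S \<tau>"
    using sym_type_exists[OF S rank' s(2) eta[rule_format]] by blast
  note avg = avg_form_type[OF _ rank' s(2) eta[rule_format]]
  have "sym_has_type scale eta S \<epsilon> \<longleftrightarrow> \<epsilon> = \<tau>"
  proof
    assume "sym_has_type scale eta S \<epsilon>"
    from avg[OF this] avg[OF \<tau>(2)] show "\<epsilon> = \<tau>"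
      using \<epsilon> \<tau>(1) by (auto split: if_splits)
  qed (use \<tau> in simp)
  then show ?thesis
    using \<epsilon> \<tau>(1) avg[OF \<tau>(2)] s(1)
    by (auto simp: alpha_coeff_def beta_coeff_def power_int_of_nat)
qed

lemma class_sum_odd:
  assumes u: "is_basis scale u" and w: "is_basis scale w" and b: "is_basis scale b"
    and A: "matrix_of_quad scale b Q A"
  shows "(\<Sum>S\<in>sym_class scale eta (Odd r). pairing scale \<chi> u w Q S) = rank_sum m (2 * r + 1) A"
proof -
  obtain b' where b': "is_basis scale b'"
    "\<And>S. S \<in> sym_forms scale \<Longrightarrow> pairing scale \<chi> u w Q S = \<chi> (trace_prod m A (gram b' S))"
    by (rule pairing_basis_change[OF u w b], use A in blast)
  have "(\<Sum>S\<in>sym_class scale eta (Odd r). pairing scale \<chi> u w Q S)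
      = (\<Sum>S\<in>{S \<in> sym_forms scale. int (sym_rank scale S) = 2 * r + 1}. \<chi>
          (trace_prod m A (gram b' S)))"
    by (rule sum.cong) (simp_all add: b'(2))
  then show ?thesis
    unfolding sum_sym_forms_rank[OF b'(1), of "\<lambda>B. \<chi> (trace_prod m A B)"] rank_sum_def .
qed

lemma class_sum_even:
  assumes u: "is_basis scale u" and w: "is_basis scale w" and b: "is_basis scale b"
    and A: "matrix_of_quad scale b Q A"
    and r: "r \<ge> 1" and \<epsilon>: "\<epsilon> \<in> {1, -1}" and eta: "odd CARD('a) \<longrightarrow> (\<nexists>x. eta = x\<^sup>2)"
  shows "(\<Sum>S\<in>sym_class scale eta (Even r \<epsilon>). pairing scale \<chi> u w Q S)
    = of_real (alpha_coeff CARD('a) \<epsilon>) * rank_sum m (2 * r) A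
      + of_int \<epsilon> * of_real (beta_coeff CARD('a) r) * avg_sum m (2 * r) A"
proof -
  obtain b' where b': "is_basis scale b'"
    "\<And>S. S \<in> sym_forms scale \<Longrightarrow> pairing scale \<chi> u w Q S = \<chi> (trace_prod m A (gram b' S))"
    by (rule pairing_basis_change[OF u w b], use A in blast)
  define K where "K = {S \<in> sym_forms scale. int (sym_rank scale S) = 2 * r}"
  have "finite (sym_forms scale)"
    using bij_betw_finite[OF gram_bij[OF b]] by simp
  then have fin: "finite K" by (simp add: K_def)
  let ?a = "of_real (alpha_coeff CARD('a) \<epsilon>) :: complex"
  let ?b = "of_int \<epsilon> * of_real (beta_coeff CARD('a) r) :: complex"
  have "sym_class scale eta (Even r \<epsilon>) = {S \<in> K. sym_has_type scale eta S \<epsilon>}"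
    by (auto simp: K_def)
  then have "(\<Sum>S\<in>sym_class scale eta (Even r \<epsilon>). pairing scale \<chi> u w Q S)
      = (\<Sum>S\<in>K. if sym_has_type scale eta S \<epsilon> then pairing scale \<chi> u w Q S else 0)"
    using fin by (simp add: sum.inter_filter)
  also have "\<dots> = (\<Sum>S\<in>K. (?a + ?b * avg_chi m (gram b' S)) * \<chi> (trace_prod m A (gram b' S)))"
  proof (rule sum.cong[OF refl])
    fix S assume "S \<in> K"
    then have S: "S \<in> sym_forms scale" "int (sym_rank scale S) = 2 * r" by (auto simp: K_def)
    have "(if sym_has_type scale eta S \<epsilon> then pairing scale \<chi> u w Q S else 0)
        = (if sym_has_type scale eta S \<epsilon> then 1 else 0) * \<chi> (trace_prod m A (gram b' S))"
      by (simp add: b'(2)[OF S(1)])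
    then show "(if sym_has_type scale eta S \<epsilon> then pairing scale \<chi> u w Q S else 0)
        = (?a + ?b * avg_chi m (gram b' S)) * \<chi> (trace_prod m A (gram b' S))"
      unfolding type_indicator[OF S r \<epsilon> eta] avg_chi_gram[OF b'(1) S(1)] .
  qed
  also have "\<dots> = (\<Sum>B\<in>rank_mats m (2 * r). (?a + ?b * avg_chi m B) * \<chi> (trace_prod m A B))"
    unfolding K_def by (rule sum_sym_forms_rank[OF b'(1)])
  also have "\<dots> = ?a * rank_sum m (2 * r) A + ?b * avg_sum m (2 * r) A"
    by (simp add: rank_sum_def avg_sum_def distrib_right sum.distrib sum_distrib_left mult.assoc)
  finally show ?thesis .
qed

lemma quad_class_odd_sums:
  assumes Q: "Q \<in> quad_class scale lam eta (Odd s)" and s: "s \<ge> 0"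
  obtains b A where "is_basis scale b" "matrix_of_quad scale b Q A"
    "\<And>k. rank_sum m k A = of_real (odd_value CARD('a) (m - 1) (nat s) k)"
    "\<And>r. avg_sum m (2 * r) A = of_real (F_number CARD('a) (int m) r s)"
proof -
  have Q': "Q \<in> quad_forms scale" "quad_rank scale Q = 2 * nat s + 1" using Q s by auto
  obtain b a where b: "is_basis scale b" "a \<noteq> 0"
      "matrix_of_quad scale b Q (std_mat 1 (\<lambda>_ _. a) 1 (nat s))"
    by (rule adapted_basis_odd[OF Q'])
  have m: "1 + 2 * nat s \<le> m" using quad_rank_le[of Q] Q'(2) by simp
  have "avg_sum m (2 * r) (std_mat 1 (\<lambda>_ _. a) 1 (nat s)) = of_real (F_number CARD('a) (int m) r s)"
      for r
  proof -
    have "avg_sum m (2 * r) (std_mat 1 (\<lambda>_ _. a) 1 (nat s))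
        = of_real (F_number CARD('a) (int m) r (int (nat s + 0)))"
      using avg_sum_1 by (intro avg_sum_std_mat m) simp_all
    then show ?thesis using s by simp
  qed
  moreover have "rank_sum m k (std_mat 1 (\<lambda>_ _. a) 1 (nat s))
      = of_real (odd_value CARD('a) (m - 1) (nat s) k)" for k
    by (rule rank_sum_odd) (use b(2) m in auto)
  ultimately show ?thesis using that b by blast
qed

lemma quad_class_even_sums:
  assumes Q: "Q \<in> quad_class scale lam eta (Even s \<tau>)" and s: "s \<ge> 1" and \<tau>: "\<tau> \<in> {1, -1}"
    and lam: "even CARD('a) \<Longrightarrow> abs_trace lam = 1" and eta: "odd CARD('a) \<Longrightarrow> \<nexists>x. eta = x\<^sup>2"
  obtains b A where "is_basis scale b" "matrix_of_quad scale b Q A"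
    "\<And>k. rank_sum m k A = of_real (even_value CARD('a) \<tau> (m - 2) (nat s - 1) k)"
    "\<And>r. avg_sum m (2 * r) A = of_real (F_number CARD('a) (int m) r s)" "m \<ge> 2"
proof -
  define n where "n = nat s"
  have n: "s = int n" "n \<ge> 1" using s by (auto simp: n_def)
  have rank: "quad_rank scale Q = 2 * n" using Q n by auto
  have m: "2 * n \<le> m" using quad_rank_le[of Q] rank by simp
  then have m': "2 + 2 * (n - 1) \<le> m" using n(2) by simp
  \<comment> \<open>Both types are brought to one statement, in which the type survives only as
    \<tau> in the sums of the initial plane.\<close>
  have "\<exists>b A c. is_basis scale b \<and> c \<noteq> 0 \<and> matrix_of_quad scale b Q (std_mat 2 A c (n - 1)) \<and>
    (\<forall>k. rank_sum 2 k A = (if k = 0 then 1 else if k = 1 then of_int \<tau> * q - 1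
              else if k = 2 then - (of_int \<tau> * q) else 0)) \<and>
    (\<forall>r. avg_sum 2 (2 * r) A = of_real (F_number CARD('a) 2 r 1))"
  proof -
    consider "\<tau> = 1" "quad_equiv_coord scale (quad_hyp n) Q" | "\<tau> = - 1"
        "quad_equiv_coord scale (quad_ell lam eta n) Q"
      using Q rank n unfolding quad_class.simps quad_has_type_def by auto
    then show ?thesis
    proof cases
      case 1
      obtain b c where b: "is_basis scale b" "c \<noteq> 0"
        "matrix_of_quad scale b Q (std_mat 2 (\<lambda>i j. if i = 1 \<and> j = 2 then c else 0) c (n - 1))"
        by (rule adapted_basis_hyp[OF m n(2) 1(2)])
      have "rank_sum 2 k (\<lambda>i j. if i = 1 \<and> j = 2 then c else 0)
          = (if k = 0 then 1 else if k = 1 then of_int \<tau> * q - 1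
              else if k = 2 then - (of_int \<tau> * q) else 0)" for k
        unfolding 1(1) by (rule hyperbolic_base(1)) (use b in auto)
      moreover have "avg_sum 2 (2 * r) (\<lambda>i j. if i = 1 \<and> j = 2 then c else 0)
          = of_real (F_number CARD('a) 2 r 1)" for r
        by (rule hyperbolic_base(2)) (use b in auto)
      ultimately show ?thesis using b by blast
    next
      case 2
      obtain b c where b: "is_basis scale b" "c \<noteq> 0"
        "matrix_of_quad scale b Q (std_mat 2 (elliptic_base lam eta c) c (n - 1))"
        by (rule adapted_basis_ell[OF m n(2) 2(2)])
      show ?thesis
        using b elliptic_base[OF b(2) lam eta] unfolding 2(1) by blast
    qed
  qed
  then obtain b A c where b: "is_basis scale b" "c \<noteq> 0"
      "matrix_of_quad scale b Q (std_mat 2 A c (n - 1))"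
    and A: "\<And>k. rank_sum 2 k A = (if k = 0 then 1 else if k = 1 then of_int \<tau> * q - 1
              else if k = 2 then - (of_int \<tau> * q) else 0)"
      "\<And>r. avg_sum 2 (2 * r) A = of_real (F_number CARD('a) 2 r 1)"
    by blast
  have "rank_sum m k (std_mat 2 A c (n - 1)) = of_real
      (even_value CARD('a) \<tau> (m - 2) (nat s - 1) k)" for k
    using rank_sum_even[OF b(2) m' A(1)] by (simp add: n_def)
  \<comment> \<open>The initial plane counts as one, so with the n - 1 others the argument of F is
    again s.\<close>
  moreover have "avg_sum m (2 * r) (std_mat 2 A c (n - 1))
      = of_real (F_number CARD('a) (int m) r s)" for r
    using avg_sum_std_mat[where A = A and ?s0.0 = 1, OF b(2) m'] A(2) n by simp
  ultimately show ?thesis using that b m' by simp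
qed

lemma sym_rank_eq_0_iff:
  assumes S: "S \<in> sym_forms scale"
  shows "sym_rank scale S = 0 \<longleftrightarrow> S = (\<lambda>_ _. 0)"
proof
  assume 0: "sym_rank scale S = 0"
  let ?R = "{x. \<forall>y. S x y = 0}"
  have "dim ?R \<le> m" unfolding vdim_def by (intro dim_subset) auto
  then have "card ?R = CARD('v)"
    using 0 card_subspace[OF subspace_radical[OF S]] card_subspace[of UNIV]
    by (simp add: sym_rank_def codimension_def vdim_def)
  from card_subset_eq[OF finite_space subset_UNIV this] have "?R = UNIV" .
  then show "S = (\<lambda>_ _. 0)" by (auto simp: fun_eq_iff)
qed (simp add: sym_rank_def codimension_def vdim_def)

lemma quad_rank_eq_0_iff:
  assumes Q: "Q \<in> quad_forms scale"
  shows "quad_rank scale Q = 0 \<longleftrightarrow> Q = (\<lambda>_. 0)"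
proof
  assume 0: "quad_rank scale Q = 0"
  let ?R = "{x. (\<forall>y. polar_form Q x y = 0) \<and> Q x = 0}"
  have "dim ?R \<le> m" unfolding vdim_def by (intro dim_subset) auto
  then have "card ?R = CARD('v)"
    using 0 card_subspace[OF subspace_quad_radical[OF Q]] card_subspace[of UNIV]
    by (simp add: quad_rank_def codimension_def vdim_def)
  from card_subset_eq[OF finite_space subset_UNIV this] have "?R = UNIV" .
  then show "Q = (\<lambda>_. 0)" by (auto simp: fun_eq_iff)
qed (simp add: quad_rank_def codimension_def vdim_def polar_form_def)

lemma sym_class_zero: "sym_class scale eta (Even 0 1) = {\<lambda>_ _. 0}"
proof -
  have "(\<lambda>_ _. 0) \<in> sym_forms scale"
    by (auto simp: sym_forms_def intro!: bilinear_formI vector_space_axioms)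
  then show ?thesis
    using sym_rank_eq_0_iff by (auto simp: sym_has_type_def)
qed

lemma quad_class_zero: "quad_class scale lam eta (Even 0 1) = {\<lambda>_. 0}"
proof -
  have "(\<lambda>_. 0) \<in> quad_forms scale"
    by (auto simp: quad_forms_def polar_form_def intro!: bilinear_formI vector_space_axioms)
  then show ?thesis
    using quad_rank_eq_0_iff by (auto simp: quad_has_type_def)
qed

end

text \<open>On a nonempty class a common value of the sums is the only number that fits the definite
  description.\<close>

lemma Q_number_eqI:
  assumes "quad_class scale lam eta i \<noteq> {}"
    and "\<And>Q. Q \<in> quad_class scale lam eta i \<Longrightarrow> (\<Sum>S\<in>sym_class scale eta k. pairing scale \<chi> u w Q S)
        = v"
  shows "Q_number scale lam eta \<chi> u w k i = v"
  unfolding Q_number_def using assms by (intro the_equality) auto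

theorem theorem3p1:
  fixes scale :: "'a::{finite,field} \<Rightarrow> 'v::ab_group_add \<Rightarrow> 'v"
    and u w :: "nat \<Rightarrow> 'v"
    and \<chi> :: "'a \<Rightarrow> complex"
    and lam eta :: 'a
    and q m :: nat
  defines "\<Q> \<equiv> quad_class scale lam eta"
    and "\<S> \<equiv> sym_class scale eta"
    and "Qn \<equiv> Q_number scale lam eta \<chi> u w"
    and "F \<equiv> F_number q"
    and "\<alpha> \<equiv> alpha_coeff q"
    and "\<beta> \<equiv> beta_coeff q"
  assumes "q = CARD('a)"
    and "vector_space scale"
    and "vector_space.dim scale UNIV = m"
    and "m \<ge> 1"
    and "is_basis scale u"
    and "is_basis scale w"
    and "additive_character \<chi>"
    and "\<exists>x. \<chi> x \<noteq> 1"
    and "even q \<Longrightarrow> abs_trace lam = 1"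
    and "odd q \<Longrightarrow> eta \<noteq> 0 \<and> (\<nexists>x. eta = x\<^sup>2)"
  shows
    "(\<forall>i \<in> index_set. \<Q> i \<noteq> {} \<longrightarrow> Qn (Even 0 1) i = 1) \<and>
     (\<forall>k \<in> index_set. Qn k (Even 0 1) = of_nat (card (\<S> k))) \<and>
     (\<forall>r s \<epsilon> \<tau> :: int. \<epsilon> \<in> {1, -1} \<longrightarrow> \<tau> \<in> {1, -1} \<longrightarrow>
        (r \<ge> 0 \<longrightarrow> s \<ge> 0 \<longrightarrow> \<Q> (Odd s) \<noteq> {} \<longrightarrow>
           Qn (Odd r) (Odd s) = of_real (- (real q powi (2 * r) * F (int m - 1) r s))) \<and>
        (r \<ge> 0 \<longrightarrow> s \<ge> 1 \<longrightarrow> \<Q> (Even s \<tau>) \<noteq> {} \<longrightarrow>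
           Qn (Odd r) (Even s \<tau>) = of_real
             (- (real q powi (2 * r) * F (int m - 1) r (s - 1))
              + of_int \<tau> * real q powi (int m - s + 2 * r) * F (int m - 2) r (s - 1))) \<and>
        (r \<ge> 1 \<longrightarrow> s \<ge> 0 \<longrightarrow> \<Q> (Odd s) \<noteq> {} \<longrightarrow>
           Qn (Even r \<epsilon>) (Odd s) = of_real
             (\<alpha> \<epsilon> * real q powi (2 * r) * F (int m - 1) r s
              + of_int \<epsilon> * \<beta> r * F (int m) r s)) \<and>
        (r \<ge> 1 \<longrightarrow> s \<ge> 1 \<longrightarrow> \<Q> (Even s \<tau>) \<noteq> {} \<longrightarrow>
           Qn (Even r \<epsilon>) (Even s \<tau>) = of_real
             (\<alpha> \<epsilon> * (real q powi (2 * r) * F (int m - 1) r (s - 1)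
                - of_int \<tau> * real q powi (int m - s + 2 * r - 2) * F (int m - 2) (r - 1) (s - 1))
              + of_int \<epsilon> * \<beta> r * F (int m) r s)))"
proof -
  interpret vector_space scale by fact
  have dim: "vdim scale = m" using assms(9) by (simp add: vdim_def)
  interpret form_char scale "u ` {1..vdim scale}" \<chi> "of_nat CARD('a)"
  proof unfold_locales
    show "independent (u ` {1..vdim scale})" "span (u ` {1..vdim scale}) = UNIV"
      using \<open>is_basis scale u\<close> by (auto simp: is_basis_def)
    show "\<chi> 0 = 1" "\<chi> (x + y) = \<chi> x * \<chi> y" for x y
      using \<open>additive_character \<chi>\<close> by (auto simp: additive_character_def)
    show "\<exists>x. \<chi> x \<noteq> 1" by fact
  qed simp_all
  note u = \<open>is_basis scale u\<close> and w = \<open>is_basis scale w\<close>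
  have q: "q = CARD('a)" by fact
  have lam: "abs_trace lam = 1" if "even CARD('a)"
    using assms(15) that by (simp add: q)
  have eta: "odd CARD('a) \<longrightarrow> (\<nexists>x. eta = x\<^sup>2)"
    using assms(16) by (simp add: q)
  have zero: "Qn (Even 0 1) i = 1" if "\<Q> i \<noteq> {}" for i
    unfolding Qn_def
  proof (rule Q_number_eqI)
    show "quad_class scale lam eta i \<noteq> {}" using that by (simp add: \<Q>_def)
    show "(\<Sum>S\<in>sym_class scale eta (Even 0 1). pairing scale \<chi> u w Q S) = 1" for Q
      by (simp only: sym_class_zero) (simp add: pairing_def Let_def)
  qed
  have valency: "Qn k (Even 0 1) = of_nat (card (\<S> k))" for k
    unfolding Qn_def
  proof (rule Q_number_eqI)
    show "quad_class scale lam eta (Even 0 1) \<noteq> {}" by (simp only: quad_class_zero) simp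
    fix Q assume "Q \<in> quad_class scale lam eta (Even 0 1)"
    \<comment> \<open>The only form in this class is zero, so it has the zero matrix and every
      pairing is \<open>\<chi> 0 = 1\<close>.\<close>
    then have "matrix_of_quad scale u Q (\<lambda>_ _. 0)"
      by (simp only: quad_class_zero) (simp add: matrix_of_quad_def)
    moreover obtain b' where "\<And>Q A S \<chi>. matrix_of_quad scale u Q A \<Longrightarrow> S \<in> sym_forms scale \<Longrightarrow>
       pairing scale \<chi> u w Q S = \<chi> (trace_prod (vdim scale) A (gram b' S))"
      by (rule pairing_basis_change[OF u w u], blast)
    ultimately have "pairing scale \<chi> u w Q S = 1" if "S \<in> sym_forms scale" for S
      using that by (simp add: trace_prod_def)
    moreover have "sym_class scale eta k \<subseteq> sym_forms scale"
      by (cases k) auto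
    ultimately show "(\<Sum>S\<in>sym_class scale eta k. pairing scale \<chi> u w Q S) = of_nat (card (\<S> k))"
      by (simp add: \<S>_def subset_iff)
  qed
  have odd_odd: "Qn (Odd r) (Odd s) = of_real (- (real q powi (2 * r) * F (int m - 1) r s))"
    if s: "s \<ge> 0" and ne: "\<Q> (Odd s) \<noteq> {}" for r s
    unfolding Qn_def
  proof (rule Q_number_eqI)
    fix Q assume Q: "Q \<in> quad_class scale lam eta (Odd s)"
    obtain b A where b: "is_basis scale b" "matrix_of_quad scale b Q A"
      "\<And>k. rank_sum (vdim scale) k A = of_real (odd_value CARD('a) (vdim scale - 1) (nat s) k)"
      "\<And>r. avg_sum (vdim scale) (2 * r) A = of_real (F_number CARD('a) (int (vdim scale)) r s)"
      by (rule quad_class_odd_sums[OF Q s]) (erule (1) that; blast)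
    have e: "int (m - 1) = int m - 1" "int (nat s) = s" using s \<open>m \<ge> 1\<close> by auto
    show "(\<Sum>S\<in>sym_class scale eta (Odd r). pairing scale \<chi> u w Q S)
        = of_real (- (real q powi (2 * r) * F (int m - 1) r s))"
      unfolding class_sum_odd[OF u w b(1,2)] b(3) unfolding value_simps dim e q F_def by (rule refl)
  qed (use ne in \<open>simp add: \<Q>_def\<close>)
  have odd_even: "Qn (Odd r) (Even s \<tau>) = of_real
             (- (real q powi (2 * r) * F (int m - 1) r (s - 1))
              + of_int \<tau> * real q powi (int m - s + 2 * r) * F (int m - 2) r (s - 1))"
    if s: "s \<ge> 1" and \<tau>: "\<tau> \<in> {1, -1}" and ne: "\<Q> (Even s \<tau>) \<noteq> {}" for r s \<tau>
    unfolding Qn_def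
  proof (rule Q_number_eqI)
    fix Q assume Q: "Q \<in> quad_class scale lam eta (Even s \<tau>)"
    obtain b A where b: "is_basis scale b" "matrix_of_quad scale b Q A"
      "\<And>k. rank_sum (vdim scale) k A = of_real
          (even_value CARD('a) \<tau> (vdim scale - 2) (nat s - 1) k)"
      "\<And>r. avg_sum (vdim scale) (2 * r) A = of_real (F_number CARD('a) (int (vdim scale)) r s)"
          "vdim scale \<ge> 2"
      by (rule quad_class_even_sums[OF Q s \<tau> lam eta[rule_format]], assumption, assumption)
          (erule (1) that; blast)
    \<comment> \<open>The natural number \<open>m - 2\<close> is not truncated: a form of rank 2s
      with s \<ge> 1 requires m \<ge> 2.\<close>
    have e: "int (m - 2) = int m - 2" "int m - 2 + 1 = int m - 1" "int (nat s - 1) = s - 1"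
      "int m - 1 - (s - 1) = int m - s"
      using b(5) s dim by auto
    show "(\<Sum>S\<in>sym_class scale eta (Odd r). pairing scale \<chi> u w Q S) = of_real
             (- (real q powi (2 * r) * F (int m - 1) r (s - 1))
              + of_int \<tau> * real q powi (int m - s + 2 * r) * F (int m - 2) r (s - 1))"
      unfolding class_sum_odd[OF u w b(1,2)] b(3) unfolding value_simps dim e q F_def by (rule refl)
  qed (use ne in \<open>simp add: \<Q>_def\<close>)
  have even_odd: "Qn (Even r \<epsilon>) (Odd s) = of_real
             (\<alpha> \<epsilon> * real q powi (2 * r) * F (int m - 1) r s
              + of_int \<epsilon> * \<beta> r * F (int m) r s)"
    if r: "r \<ge> 1" and s: "s \<ge> 0" and \<epsilon>: "\<epsilon> \<in> {1, -1}" and ne: "\<Q> (Odd s) \<noteq> {}" for r s \<epsilon>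
    unfolding Qn_def
  proof (rule Q_number_eqI)
    fix Q assume Q: "Q \<in> quad_class scale lam eta (Odd s)"
    obtain b A where b: "is_basis scale b" "matrix_of_quad scale b Q A"
      "\<And>k. rank_sum (vdim scale) k A = of_real (odd_value CARD('a) (vdim scale - 1) (nat s) k)"
      "\<And>r. avg_sum (vdim scale) (2 * r) A = of_real (F_number CARD('a) (int (vdim scale)) r s)"
      by (rule quad_class_odd_sums[OF Q s]) (erule (1) that; blast)
    have e: "int (m - 1) = int m - 1" "int (nat s) = s" using s \<open>m \<ge> 1\<close> by auto
    show "(\<Sum>S\<in>sym_class scale eta (Even r \<epsilon>). pairing scale \<chi> u w Q S) = of_real
             (\<alpha> \<epsilon> * real q powi (2 * r) * F (int m - 1) r s + of_int \<epsilon> * \<beta> r * F (int m) r s)"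
      unfolding class_sum_even[OF u w b(1,2) r \<epsilon> eta] b(3,4)
          unfolding value_simps dim e q F_def \<alpha>_def \<beta>_def
      by (simp only: of_real_mult of_real_add of_real_diff of_real_of_int_eq mult.assoc)
  qed (use ne in \<open>simp add: \<Q>_def\<close>)
  have even_even: "Qn (Even r \<epsilon>) (Even s \<tau>) = of_real
             (\<alpha> \<epsilon> * (real q powi (2 * r) * F (int m - 1) r (s - 1)
                - of_int \<tau> * real q powi (int m - s + 2 * r - 2) * F (int m - 2) (r - 1) (s - 1))
              + of_int \<epsilon> * \<beta> r * F (int m) r s)"
    if r: "r \<ge> 1" and s: "s \<ge> 1" and \<epsilon>: "\<epsilon> \<in> {1, -1}" and \<tau>: "\<tau> \<in> {1, -1}"
        and ne: "\<Q> (Even s \<tau>) \<noteq> {}" for r s \<epsilon> \<tau>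
    unfolding Qn_def
  proof (rule Q_number_eqI)
    fix Q assume Q: "Q \<in> quad_class scale lam eta (Even s \<tau>)"
    obtain b A where b: "is_basis scale b" "matrix_of_quad scale b Q A"
      "\<And>k. rank_sum (vdim scale) k A = of_real
          (even_value CARD('a) \<tau> (vdim scale - 2) (nat s - 1) k)"
      "\<And>r. avg_sum (vdim scale) (2 * r) A = of_real (F_number CARD('a) (int (vdim scale)) r s)"
          "vdim scale \<ge> 2"
      by (rule quad_class_even_sums[OF Q s \<tau> lam eta[rule_format]], assumption, assumption)
          (erule (1) that; blast)
    have e: "int (m - 2) = int m - 2" "int m - 2 + 1 = int m - 1" "int (nat s - 1) = s - 1"
      "int m - 1 - (s - 1) = int m - s"
      using b(5) s dim by auto
    show "(\<Sum>S\<in>sym_class scale eta (Even r \<epsilon>). pairing scale \<chi> u w Q S) = of_real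
             (\<alpha> \<epsilon> * (real q powi (2 * r) * F (int m - 1) r (s - 1)
                - of_int \<tau> * real q powi (int m - s + 2 * r - 2) * F (int m - 2) (r - 1) (s - 1))
              + of_int \<epsilon> * \<beta> r * F (int m) r s)"
      unfolding class_sum_even[OF u w b(1,2) r \<epsilon> eta] b(3,4)
          unfolding value_simps dim e q F_def \<alpha>_def \<beta>_def
      by (simp only: of_real_mult of_real_add of_real_diff of_real_of_int_eq mult.assoc)
  qed (use ne in \<open>simp add: \<Q>_def\<close>)
  show ?thesis
    by (intro conjI ballI allI impI zero valency odd_odd odd_even even_odd even_even)
qed

end
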